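(* Let $\Bbbk$ be an algebraically closed field of characteristic $0$, $H$ a finite-dimensional Hopf algebra over $\Bbbk$, $K$ a finite-dimensional left $H$-comodule algebra, and $U,W,Z\in{}_K\mathcal{M}$. Consider ${}_K\mathcal{M}$ as a module category over $\mathrm{Rep}\,H$. Then the internal Hom is the Yan–Zhu stabilizer: $\underline{\mathrm{Hom}}(U,W)=\mathrm{Stab}_K(U,W)$ (that is, the $H$-module $\mathrm{Stab}_K(U,W)$ represents the functor $X\mapsto\mathrm{Hom}_K(X\otimes U,W)$ on $\mathrm{Rep}\,H$), and the composition of internal Homs $$\underline{\mathrm{Hom}}(U,W)\times\underline{\mathrm{Hom}}(W,Z)\to\underline{\mathrm{Hom}}(U,Z)$$ coincides with the map $\mathrm{Stab}_K(U,W)\times\mathrm{Stab}_K(W,Z)\to\mathrm{Stab}_K(U,Z)$, $(A,B)\mapsto B\circ A$, induced by composition of linear maps.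
   Context: ${}_K\mathcal{M}$ is the category of finite-dimensional left $K$-modules, and $\mathrm{Rep}\,H$ is the tensor category of finite-dimensional left $H$-modules. A left $H$-comodule algebra is an algebra $K$ with a left $H$-coaction $k\mapsto k_{(-1)}\otimes k_{(0)}\in H\otimes K$ that is an algebra map. The module category structure on ${}_K\mathcal{M}$ is $X\otimes V=X\otimes_\Bbbk V$ with $k\cdot(x\otimes v)=k_{(-1)}\cdot x\otimes k_{(0)}\cdot v$. The internal Hom $\underline{\mathrm{Hom}}(M_1,M_2)\in\mathrm{Rep}\,H$ of $M_1,M_2\in{}_K\mathcal{M}$ is an object representing $X\mapsto\mathrm{Hom}_K(X\otimes M_1,M_2)$, i.e. $\mathrm{Hom}_K(X\otimes M_1,M_2)\simeq\mathrm{Hom}_H(X,\underline{\mathrm{Hom}}(M_1,M_2))$ naturally in $X$. The evaluation $ev:\underline{\mathrm{Hom}}(M_1,M_2)\otimes M_1\to M_2$ corresponds to the identity. Composition of internal Homs is the map $\underline{\mathrm{Hom}}(W,Z)\otimes\underline{\mathrm{Hom}}(U,W)\to\underline{\mathrm{Hom}}(U,Z)$ corresponding to $ev\,(\mathrm{id}\otimes ev):\underline{\mathrm{Hom}}(W,Z)\otimes\underline{\mathrm{Hom}}(U,W)\otimes U\to Z$. Yan–Zhu stabilizer: let $\mathcal{S}$ be the antipode of $H$ and let $H$ act on $H^*$ by $\langle h\rightharpoondown\beta,a\rangle=\langle\beta,\mathcal{S}^{-1}(h)a\rangle$. For $U\in{}_K\mathcal{M}$, $H^*\otimes U$ is a $K$-module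 by $k\cdot(\beta\otimes u)=(k_{(-1)}\rightharpoondown\beta)\otimes k_{(0)}\cdot u$. Let $\mathcal{L}:H^*\otimes\mathrm{Hom}(U,W)\to\mathrm{Hom}(H^*\otimes U,H^*\otimes W)$, $\mathcal{L}(\alpha\otimes f)(\beta\otimes u)=\alpha\beta\otimes f(u)$ (injective). Then $\mathrm{Stab}_K(U,W)=\mathrm{Hom}_K(H^*\otimes U,H^*\otimes W)\cap\mathcal{L}(H^*\otimes\mathrm{Hom}(U,W))$. Identified with a subspace of $H^*\otimes\mathrm{Hom}(U,W)$, it is a left $H$-module by $h\cdot(\alpha\otimes f)=(h\rightharpoonup\alpha)\otimes f$, where $\langle h\rightharpoonup\alpha,a\rangle=\langle\alpha,ah\rangle$. *)

theory Defs
  imports "HOL-Library.Function_Algebras" "HOL-Computational_Algebra.Polynomial"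
begin

section \<open>Vector spaces, Hom spaces and tensor products\<close>

text \<open>A vector space is a linear subspace \<open>car V\<close> of an ambient vector space whose addition is that
  of the type and whose scalar multiplication is \<open>scl V\<close>. Taking \<open>car V = UNIV\<close> makes the
  whole type a vector space; proper subspaces are needed for spans and Hom spaces.\<close>

record ('k, 'v) vspace =
  car :: "'v set"
  scl :: "'k \<Rightarrow> 'v \<Rightarrow> 'v"

definition vspace :: "('k::field, 'v::ab_group_add, 'm) vspace_scheme \<Rightarrow> bool" where
  "vspace V \<longleftrightarrow> vector_space (scl V) \<and> module.subspace (scl V) (car V)"

definition fin_dim :: "('k::field, 'v::ab_group_add, 'm) vspace_scheme \<Rightarrow> bool" where
  "fin_dim V \<longleftrightarrow> (\<exists>B. finite B \<and> module.span (scl V) B = car V)"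

definition ground :: "('k::field, 'k) vspace" where
  "ground = \<lparr>car = UNIV, scl = (*)\<rparr>"

definition linear_on ::
  "('k::field, 'v::ab_group_add, 'm) vspace_scheme \<Rightarrow> ('k, 'w::ab_group_add, 'n) vspace_scheme
    \<Rightarrow> ('v \<Rightarrow> 'w) \<Rightarrow> bool" where
  "linear_on V W f \<longleftrightarrow>
    (\<forall>x\<in>car V. f x \<in> car W) \<and>
    (\<forall>x\<in>car V. \<forall>y\<in>car V. f (x + y) = f x + f y) \<and>
    (\<forall>c. \<forall>x\<in>car V. f (scl V c x) = scl W c (f x))"

text \<open>Linear maps are represented by functions that vanish outside the carrier of the domain, so that
  equality of linear maps is equality of functions; this is compatible with composition.\<close>

definition hom ::
  "('k::field, 'v::ab_group_add, 'm) vspace_scheme \<Rightarrow> ('k, 'w::ab_group_add, 'n) vspace_scheme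
    \<Rightarrow> ('k, 'v \<Rightarrow> 'w) vspace" where
  "hom V W = \<lparr>car = {f. linear_on V W f \<and> (\<forall>x. x \<notin> car V \<longrightarrow> f x = 0)},
              scl = (\<lambda>c f x. scl W c (f x))\<rparr>"

definition idm :: "('k, 'v::zero, 'm) vspace_scheme \<Rightarrow> 'v \<Rightarrow> 'v" where
  "idm V = (\<lambda>x. if x \<in> car V then x else 0)"

definition bilinear_on ::
  "('k::field, 'v::ab_group_add, 'm) vspace_scheme \<Rightarrow> ('k, 'w::ab_group_add, 'n) vspace_scheme
    \<Rightarrow> ('k, 'e::ab_group_add, 'p) vspace_scheme \<Rightarrow> ('v \<Rightarrow> 'w \<Rightarrow> 'e) \<Rightarrow> bool" where
  "bilinear_on V W E b \<longleftrightarrow>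
    (\<forall>x\<in>car V. linear_on W E (b x)) \<and> (\<forall>y\<in>car W. linear_on V E (\<lambda>x. b x y))"

text \<open>Over a field, the canonical map from the tensor product of \<open>V\<close> and \<open>W\<close> to the dual of the space
  of bilinear forms on \<open>V \<times> W\<close>, sending \<open>v \<otimes> w\<close> to evaluation at \<open>(v, w)\<close>, is injective. The
  tensor product is realised as its image. The universal property is \<open>tensor_universal\<close> below.\<close>

type_synonym ('k, 'v, 'w) tens = "('v \<Rightarrow> 'w \<Rightarrow> 'k) \<Rightarrow> 'k"

definition tpure ::
  "('k::field, 'v::ab_group_add, 'm) vspace_scheme \<Rightarrow> ('k, 'w::ab_group_add, 'n) vspace_scheme
    \<Rightarrow> 'v \<Rightarrow> 'w \<Rightarrow> ('k, 'v, 'w) tens" where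
  "tpure V W v w = (\<lambda>b. if bilinear_on V W ground b then b v w else 0)"

definition tscl :: "'k::field \<Rightarrow> ('k, 'v, 'w) tens \<Rightarrow> ('k, 'v, 'w) tens" where
  "tscl c t = (\<lambda>b. c * t b)"

definition tensor ::
  "('k::field, 'v::ab_group_add, 'm) vspace_scheme \<Rightarrow> ('k, 'w::ab_group_add, 'n) vspace_scheme
    \<Rightarrow> ('k, ('k, 'v, 'w) tens) vspace" where
  "tensor V W = \<lparr>car = module.span tscl {tpure V W v w | v w. v \<in> car V \<and> w \<in> car W},
                 scl = tscl\<rparr>"

text \<open>\<open>tlift V W E b\<close> is the linear map \<open>V \<otimes> W \<rightarrow> E\<close> induced by the bilinear map \<open>b\<close>. Expressions
  in Sweedler notation are values of such maps.\<close>

definition tlift ::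
  "('k::field, 'v::ab_group_add, 'm) vspace_scheme \<Rightarrow> ('k, 'w::ab_group_add, 'n) vspace_scheme
    \<Rightarrow> ('k, 'e::ab_group_add, 'p) vspace_scheme \<Rightarrow> ('v \<Rightarrow> 'w \<Rightarrow> 'e) \<Rightarrow> ('k, 'v, 'w) tens \<Rightarrow> 'e" where
  "tlift V W E b = (THE f. f \<in> car (hom (tensor V W) E) \<and>
     (\<forall>v\<in>car V. \<forall>w\<in>car W. f (tpure V W v w) = b v w))"

lemma vector_space_tscl: "vector_space (tscl :: 'k::field \<Rightarrow> ('k, 'v, 'w) tens \<Rightarrow> _)"
  by unfold_locales (auto simp: tscl_def fun_eq_iff algebra_simps)

text \<open>Scalar-valued linear functionals separate points.\<close>

lemma separating_functional:
  fixes s :: "'k::field \<Rightarrow> 'e::ab_group_add \<Rightarrow> 'e"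
  assumes "vector_space s" "e \<noteq> 0"
  obtains \<phi> where "Vector_Spaces.linear s (*) \<phi>" "\<phi> e = (1::'k)"
proof -
  interpret vector_space s by fact
  interpret k: vector_space "(*) :: 'k \<Rightarrow> 'k \<Rightarrow> 'k"
    by unfold_locales (auto simp: algebra_simps)
  interpret p: vector_space_pair s "(*) :: 'k \<Rightarrow> 'k \<Rightarrow> 'k" by unfold_locales
  have "independent {e}" using assms(2) by simp
  from p.linear_independent_extend[OF this, of "\<lambda>_. 1"] that show thesis by auto
qed

lemma tensor_universal:
  fixes V :: "('k::field, 'v::ab_group_add, 'm) vspace_scheme"
    and W :: "('k, 'w::ab_group_add, 'n) vspace_scheme"
    and E :: "('k, 'e::ab_group_add, 'p) vspace_scheme"
  assumes "vspace V" "vspace W" and E: "vspace E" and b: "bilinear_on V W E b"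
  shows "\<exists>!f. f \<in> car (hom (tensor V W) E) \<and>
           (\<forall>v\<in>car V. \<forall>w\<in>car W. f (tpure V W v w) = b v w)"
proof -
  interpret T: vector_space "tscl :: 'k \<Rightarrow> ('k, 'v, 'w) tens \<Rightarrow> _" by (rule vector_space_tscl)
  interpret E: vector_space "scl E" using E by (simp add: vspace_def)
  have subE: "E.subspace (car E)" using E by (simp add: vspace_def)
  let ?P = "{tpure V W v w | v w. v \<in> car V \<and> w \<in> car W}"
  let ?T = "T.span ?P"
  have T: "car (tensor V W) = ?T" "scl (tensor V W) = tscl" by (simp_all add: tensor_def)
  let ?L = "\<lambda>\<phi>. Vector_Spaces.linear (scl E) ((*) :: 'k \<Rightarrow> 'k \<Rightarrow> 'k) \<phi>"
  define R where "R t e \<longleftrightarrow> e \<in> car E \<and> (\<forall>\<phi>. ?L \<phi> \<longrightarrow> \<phi> e = t (\<lambda>v w. \<phi> (b v w)))" for t e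
  have add: "\<phi> (x + y) = \<phi> x + \<phi> y" if "?L \<phi>" for \<phi> x y
    using that by (metis Vector_Spaces.linear_iff)
  have scale: "\<phi> (scl E c x) = c * \<phi> x" if "?L \<phi>" for \<phi> c x
    using that by (metis Vector_Spaces.linear_iff)
  have uniq: "e = e'" if "R t e" "R t e'" for t e e'
  proof (rule ccontr)
    assume "e \<noteq> e'"
    then have "e - e' \<noteq> 0" by simp
    with E.vector_space_axioms obtain \<phi> where \<phi>: "?L \<phi>" "\<phi> (e - e') = 1"
      by (rule separating_functional)
    have "\<phi> e = \<phi> (e - e') + \<phi> e'" using add[OF \<phi>(1), of "e - e'" e'] by simp
    moreover have "\<phi> e = t (\<lambda>v w. \<phi> (b v w))" "\<phi> e' = t (\<lambda>v w. \<phi> (b v w))"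
      using that \<phi>(1) by (auto simp: R_def)
    ultimately show False using \<phi>(2) by simp
  qed
  have form: "bilinear_on V W ground (\<lambda>v w. \<phi> (b v w))" if "?L \<phi>" for \<phi>
    using b add[OF that] scale[OF that]
    by (auto simp: bilinear_on_def linear_on_def ground_def)
  have pureR: "R (tpure V W v w) (b v w)" if "v \<in> car V" "w \<in> car W" for v w
    using that b form by (auto simp: R_def tpure_def bilinear_on_def linear_on_def)
  have zeroR: "R 0 0"
    using subE scale[of _ 0 0] by (auto simp: R_def E.subspace_0)
  have addR: "R (t + t') (e + e')" if "R t e" "R t' e'" for t t' e e'
    using that add subE by (auto simp: R_def E.subspace_add)
  have sclR: "R (tscl c t) (scl E c e)" if "R t e" for c t e
    using that scale subE by (auto simp: R_def E.subspace_scale tscl_def)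
  have ex: "\<exists>e. R t e" if "t \<in> ?T" for t
    using that
  proof (induction rule: T.span_induct_alt)
    case base
    then show ?case using zeroR by blast
  next
    case (step c x y)
    then show ?case using addR sclR pureR by blast
  qed
  define f where "f t = (if t \<in> ?T then THE e. R t e else 0)" for t
  have fR: "R t (f t)" if "t \<in> ?T" for t
    using theI'[of "R t"] ex[OF that] uniq that by (auto simp: f_def)
  have fI: "f t = e" if "t \<in> ?T" "R t e" for t e
    using fR[OF that(1)] that(2) uniq by blast
  show ?thesis
  proof (rule ex1I[of _ f], intro conjI ballI)
    show "f \<in> car (hom (tensor V W) E)"
    proof -
      have "f t \<in> car E" if "t \<in> ?T" for t using fR[OF that] by (simp add: R_def)
      moreover have "f (t + t') = f t + f t'" if "t \<in> ?T" "t' \<in> ?T" for t t'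
        using that by (intro fI addR fR T.span_add)
      moreover have "f (tscl c t) = scl E c (f t)" if "t \<in> ?T" for c t
        using that by (intro fI sclR fR T.span_scale)
      moreover have "f t = 0" if "t \<notin> ?T" for t using that by (simp add: f_def)
      ultimately show ?thesis by (simp add: hom_def linear_on_def T)
    qed
    show "f (tpure V W v w) = b v w" if "v \<in> car V" "w \<in> car W" for v w
      using that by (intro fI pureR T.span_base) auto
  next
    fix g assume g: "g \<in> car (hom (tensor V W) E) \<and>
      (\<forall>v\<in>car V. \<forall>w\<in>car W. g (tpure V W v w) = b v w)"
    then have g_lin: "\<And>t t'. t \<in> ?T \<Longrightarrow> t' \<in> ?T \<Longrightarrow> g (t + t') = g t + g t'"
      "\<And>c t. t \<in> ?T \<Longrightarrow> g (tscl c t) = scl E c (g t)" "\<And>t. t \<notin> ?T \<Longrightarrow> g t = 0"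
      by (auto simp: hom_def linear_on_def T)
    have "R t (g t)" if "t \<in> ?T" for t
    proof -
      have "t \<in> ?T \<and> R t (g t)" using that
      proof (induction rule: T.span_induct_alt)
        case base
        have "g 0 = 0" using g_lin(1)[OF T.span_zero T.span_zero] by (simp del: zero_fun_apply)
        then have "R 0 (g 0)" using zeroR by (simp only:)
        with T.span_zero show ?case by blast
      next
        case (step c x y)
        from step(1) have x: "x \<in> ?T" by (rule T.span_base)
        have Rx: "R x (g x)" using step(1) g pureR by auto
        have y: "y \<in> ?T" "R y (g y)" using step by auto
        have cx: "tscl c x \<in> ?T" using x by (rule T.span_scale)
        have "g (tscl c x + y) = scl E c (g x) + g y"
          using g_lin(1)[OF cx y(1)] g_lin(2)[OF x] by (simp only:)
        then have "R (tscl c x + y) (g (tscl c x + y))"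
          using addR[OF sclR[OF Rx] y(2)] by (simp only:)
        with T.span_add[OF cx y(1)] show ?case by blast
      qed
      then show ?thesis ..
    qed
    then have "g t = f t" for t
      using fI[of t "g t"] g_lin(3)[of t] by (cases "t \<in> ?T") (simp_all add: f_def)
    then show "g = f" by (rule ext)
  qed
qed

definition tmap ::
  "('k::field, 'v::ab_group_add, 'm) vspace_scheme \<Rightarrow> ('k, 'w::ab_group_add, 'n) vspace_scheme
    \<Rightarrow> ('k, 'v'::ab_group_add, 'm') vspace_scheme \<Rightarrow> ('k, 'w'::ab_group_add, 'n') vspace_scheme
    \<Rightarrow> ('v \<Rightarrow> 'v') \<Rightarrow> ('w \<Rightarrow> 'w') \<Rightarrow> ('k, 'v, 'w) tens \<Rightarrow> ('k, 'v', 'w') tens" where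
  "tmap V W V' W' f g = tlift V W (tensor V' W') (\<lambda>v w. tpure V' W' (f v) (g w))"

text \<open>The associativity isomorphism \<open>(V \<otimes> W) \<otimes> X \<rightarrow> V \<otimes> (W \<otimes> X)\<close>.\<close>

definition tassoc ::
  "('k::field, 'v::ab_group_add, 'm) vspace_scheme \<Rightarrow> ('k, 'w::ab_group_add, 'n) vspace_scheme
    \<Rightarrow> ('k, 'x::ab_group_add, 'p) vspace_scheme
    \<Rightarrow> ('k, ('k, 'v, 'w) tens, 'x) tens \<Rightarrow> ('k, 'v, ('k, 'w, 'x) tens) tens" where
  "tassoc V W X = tlift (tensor V W) X (tensor V (tensor W X))
     (\<lambda>t x. tlift V W (tensor V (tensor W X)) (\<lambda>v w. tpure V (tensor W X) v (tpure W X w x)) t)"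


section \<open>Algebras, Hopf algebras, comodule algebras\<close>

text \<open>The sort \<open>{ring, monoid_mult}\<close> describes rings with one in which \<open>0 = 1\<close> is allowed, so the
  zero algebra is not excluded. Algebras are whole types.\<close>

definition fd_algebra :: "('k::field, 'a::{ring,monoid_mult}, 'm) vspace_scheme \<Rightarrow> bool" where
  "fd_algebra A \<longleftrightarrow> vspace A \<and> car A = UNIV \<and> fin_dim A \<and>
    (\<forall>c x y. scl A c x * y = scl A c (x * y) \<and> x * scl A c y = scl A c (x * y))"

definition tmult ::
  "('k::field, 'a::{ring,monoid_mult}, 'm) vspace_scheme
    \<Rightarrow> ('k, 'b::{ring,monoid_mult}, 'n) vspace_scheme
    \<Rightarrow> ('k, 'a, 'b) tens \<Rightarrow> ('k, 'a, 'b) tens \<Rightarrow> ('k, 'a, 'b) tens" where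
  "tmult A B s t = tlift A B (tensor A B)
     (\<lambda>a b. tlift A B (tensor A B) (\<lambda>a' b'. tpure A B (a * a') (b * b')) t) s"

record ('k, 'h) hopf = "('k, 'h) vspace" +
  comul :: "'h \<Rightarrow> ('k, 'h, 'h) tens"
  counit :: "'h \<Rightarrow> 'k"
  antipode :: "'h \<Rightarrow> 'h"

definition fd_hopf_algebra :: "('k::field, 'h::{ring,monoid_mult}) hopf \<Rightarrow> bool" where
  "fd_hopf_algebra H \<longleftrightarrow> fd_algebra H \<and>
    linear_on H (tensor H H) (comul H) \<and> linear_on H ground (counit H) \<and>
    (\<forall>h. tassoc H H H (tmap H H (tensor H H) H (comul H) id (comul H h)) =
         tmap H H H (tensor H H) id (comul H) (comul H h)) \<and>
    (\<forall>h. tlift H H H (\<lambda>a b. scl H (counit H a) b) (comul H h) = h) \<and>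
    (\<forall>h. tlift H H H (\<lambda>a b. scl H (counit H b) a) (comul H h) = h) \<and>
    comul H 1 = tpure H H 1 1 \<and>
    (\<forall>g h. comul H (g * h) = tmult H H (comul H g) (comul H h)) \<and>
    counit H 1 = 1 \<and>
    (\<forall>g h. counit H (g * h) = counit H g * counit H h) \<and>
    linear_on H H (antipode H) \<and>
    (\<forall>h. tlift H H H (\<lambda>a b. antipode H a * b) (comul H h) = scl H (counit H h) 1) \<and>
    (\<forall>h. tlift H H H (\<lambda>a b. a * antipode H b) (comul H h) = scl H (counit H h) 1)"

record ('k, 'a, 'h) comodalg = "('k, 'a) vspace" +
  coact :: "'a \<Rightarrow> ('k, 'h, 'a) tens"

definition fd_comodule_algebra ::
  "('k::field, 'h::{ring,monoid_mult}) hopf \<Rightarrow> ('k, 'a::{ring,monoid_mult}, 'h) comodalg \<Rightarrow> bool" where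
  "fd_comodule_algebra H K \<longleftrightarrow> fd_algebra K \<and>
    linear_on K (tensor H K) (coact K) \<and>
    (\<forall>k. tassoc H H K (tmap H K (tensor H H) K (comul H) id (coact K k)) =
         tmap H K H (tensor H K) id (coact K) (coact K k)) \<and>
    (\<forall>k. tlift H K K (\<lambda>h a. scl K (counit H h) a) (coact K k) = k) \<and>
    coact K 1 = tpure H K 1 1 \<and>
    (\<forall>k l. coact K (k * l) = tmult H K (coact K k) (coact K l))"


section \<open>Modules\<close>

record ('k, 'v, 'a) amod = "('k, 'v) vspace" +
  act :: "'a \<Rightarrow> 'v \<Rightarrow> 'v"

definition fd_module ::
  "('k::field, 'a::{ring,monoid_mult}, 'm) vspace_scheme
    \<Rightarrow> ('k, 'v::ab_group_add, 'a) amod \<Rightarrow> bool" where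
  "fd_module A M \<longleftrightarrow> vspace M \<and> fin_dim M \<and> bilinear_on A M M (act M) \<and>
    (\<forall>x\<in>car M. act M 1 x = x) \<and>
    (\<forall>a b. \<forall>x\<in>car M. act M (a * b) x = act M a (act M b x))"

definition mhom ::
  "('k::field, 'v::ab_group_add, 'a) amod \<Rightarrow> ('k, 'w::ab_group_add, 'a) amod
    \<Rightarrow> ('k, 'v \<Rightarrow> 'w) vspace" where
  "mhom M N = \<lparr>car = {f \<in> car (hom M N). \<forall>a. \<forall>x\<in>car M. f (act M a x) = act N a (f x)},
               scl = scl (hom M N)\<rparr>"

text \<open>For an \<open>H\<close>-module \<open>X\<close> and an \<open>A\<close>-module \<open>V\<close>, \<open>X \<otimes> V\<close> is an \<open>A\<close>-module through
  \<open>\<delta> : A \<rightarrow> H \<otimes> A\<close>, by \<open>a \<cdot> (x \<otimes> v) = a\<^sub>(\<^sub>-\<^sub>1\<^sub>) \<cdot> x \<otimes> a\<^sub>(\<^sub>0\<^sub>) \<cdot> v\<close>.\<close>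

definition tensor_mod ::
  "('k::field, 'h::ab_group_add, 'm) vspace_scheme \<Rightarrow> ('k, 'a::ab_group_add, 'n) vspace_scheme
    \<Rightarrow> ('a \<Rightarrow> ('k, 'h, 'a) tens) \<Rightarrow> ('k, 'x::ab_group_add, 'h) amod
    \<Rightarrow> ('k, 'v::ab_group_add, 'a) amod \<Rightarrow> ('k, ('k, 'x, 'v) tens, 'a) amod" where
  "tensor_mod H A \<delta> X V = \<lparr>car = car (tensor X V), scl = scl (tensor X V),
     act = (\<lambda>a. tlift X V (tensor X V) (\<lambda>x v.
              tlift H A (tensor X V) (\<lambda>h a'. tpure X V (act X h x) (act V a' v)) (\<delta> a)))\<rparr>"

text \<open>The action of \<open>Rep H\<close> on the category of \<open>K\<close>-modules, and the tensor product of \<open>Rep H\<close>.\<close>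

definition cat_act ::
  "('k::field, 'h::{ring,monoid_mult}) hopf \<Rightarrow> ('k, 'a::{ring,monoid_mult}, 'h) comodalg
    \<Rightarrow> ('k, 'x::ab_group_add, 'h) amod \<Rightarrow> ('k, 'v::ab_group_add, 'a) amod
    \<Rightarrow> ('k, ('k, 'x, 'v) tens, 'a) amod" where
  "cat_act H K = tensor_mod H K (coact K)"

definition rep_tensor ::
  "('k::field, 'h::{ring,monoid_mult}) hopf
    \<Rightarrow> ('k, 'x::ab_group_add, 'h) amod \<Rightarrow> ('k, 'y::ab_group_add, 'h) amod
    \<Rightarrow> ('k, ('k, 'x, 'y) tens, 'h) amod" where
  "rep_tensor H = tensor_mod H H (comul H)"


section \<open>The Yan--Zhu stabilizer\<close>

text \<open>\<open>dual H\<close> is the dual space with the action \<open>\<langle>h \<cdot> \<beta>, a\<rangle> = \<langle>\<beta>, S\<^sup>-\<^sup>1(h) a\<rangle>\<close>. The antipode of a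
  finite-dimensional Hopf algebra is bijective, so \<open>inv\<close> is its inverse.\<close>

definition dual :: "('k::field, 'h::{ring,monoid_mult}) hopf \<Rightarrow> ('k, 'h \<Rightarrow> 'k, 'h) amod" where
  "dual H = \<lparr>car = car (hom H ground), scl = scl (hom H ground),
             act = (\<lambda>h \<beta> a. \<beta> (inv (antipode H) h * a))\<rparr>"

text \<open>The product of the dual algebra, \<open>\<langle>\<alpha>\<beta>, a\<rangle> = \<langle>\<alpha>, a\<^sub>(\<^sub>1\<^sub>)\<rangle>\<langle>\<beta>, a\<^sub>(\<^sub>2\<^sub>)\<rangle>\<close>.\<close>

definition conv ::
  "('k::field, 'h::{ring,monoid_mult}) hopf \<Rightarrow> ('h \<Rightarrow> 'k) \<Rightarrow> ('h \<Rightarrow> 'k) \<Rightarrow> 'h \<Rightarrow> 'k" where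
  "conv H \<alpha> \<beta> = (\<lambda>a. tlift H H ground (\<lambda>x y. \<alpha> x * \<beta> y) (comul H a))"

text \<open>\<open>\<L>(\<alpha> \<otimes> f)(\<beta> \<otimes> u) = \<alpha>\<beta> \<otimes> f(u)\<close>.\<close>

definition yz_L ::
  "('k::field, 'h::{ring,monoid_mult}) hopf
    \<Rightarrow> ('k, 'u::ab_group_add, 'a) amod \<Rightarrow> ('k, 'w::ab_group_add, 'a) amod
    \<Rightarrow> ('k, 'h \<Rightarrow> 'k, 'u \<Rightarrow> 'w) tens
    \<Rightarrow> ('k, 'h \<Rightarrow> 'k, 'u) tens \<Rightarrow> ('k, 'h \<Rightarrow> 'k, 'w) tens" where
  "yz_L H U W = tlift (dual H) (hom U W) (hom (tensor (dual H) U) (tensor (dual H) W))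
     (\<lambda>\<alpha> f. tmap (dual H) U (dual H) W (conv H \<alpha>) f)"

text \<open>The stabilizer is a space of linear maps \<open>H\<^sup>* \<otimes> U \<rightarrow> H\<^sup>* \<otimes> W\<close>; the \<open>H\<close>-action
  \<open>h \<cdot> (\<alpha> \<otimes> f) = \<alpha>(_ h) \<otimes> f\<close> is transported along the injective map \<open>\<L>\<close>.\<close>

definition Stab ::
  "('k::field, 'h::{ring,monoid_mult}) hopf \<Rightarrow> ('k, 'a::{ring,monoid_mult}, 'h) comodalg
    \<Rightarrow> ('k, 'u::ab_group_add, 'a) amod \<Rightarrow> ('k, 'w::ab_group_add, 'a) amod
    \<Rightarrow> ('k, ('k, 'h \<Rightarrow> 'k, 'u) tens \<Rightarrow> ('k, 'h \<Rightarrow> 'k, 'w) tens, 'h) amod" where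
  "Stab H K U W =
    \<lparr>car = car (mhom (cat_act H K (dual H) U) (cat_act H K (dual H) W))
             \<inter> yz_L H U W ` car (tensor (dual H) (hom U W)),
     scl = scl (hom (tensor (dual H) U) (tensor (dual H) W)),
     act = (\<lambda>h T. yz_L H U W
              (tmap (dual H) (hom U W) (dual H) (hom U W) (\<lambda>\<alpha> a. \<alpha> (a * h)) id
                (inv_into (car (tensor (dual H) (hom U W))) (yz_L H U W) T)))\<rparr>"


section \<open>The adjunction, evaluation and composition\<close>

text \<open>The isomorphism \<open>Hom\<^sub>H(X, Stab(U,W)) \<rightarrow> Hom\<^sub>K(X \<otimes> U, W)\<close> sends \<open>g\<close> to
  \<open>x \<otimes> u \<mapsto> (ev\<^sub>1 \<otimes> id)(g(x)(\<epsilon> \<otimes> u))\<close>, where \<open>ev\<^sub>1 \<alpha> = \<alpha>(1)\<close>. If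
  \<open>g(x) = \<L>(\<Sum> \<alpha>\<^sub>i \<otimes> f\<^sub>i)\<close>, this is \<open>\<Sum> \<alpha>\<^sub>i(1) f\<^sub>i(u)\<close>.\<close>

definition stab_adj ::
  "('k::field, 'h::{ring,monoid_mult}) hopf
    \<Rightarrow> ('k, 'x::ab_group_add, 'h) amod
    \<Rightarrow> ('k, 'u::ab_group_add, 'a) amod \<Rightarrow> ('k, 'w::ab_group_add, 'a) amod
    \<Rightarrow> ('x \<Rightarrow> ('k, 'h \<Rightarrow> 'k, 'u) tens \<Rightarrow> ('k, 'h \<Rightarrow> 'k, 'w) tens)
    \<Rightarrow> ('k, 'x, 'u) tens \<Rightarrow> 'w" where
  "stab_adj H X U W g = tlift X U W (\<lambda>x u.
     tlift (dual H) W W (\<lambda>\<alpha> w. scl W (\<alpha> 1) w) (g x (tpure (dual H) U (counit H) u)))"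

text \<open>The evaluation \<open>Stab(U,W) \<otimes> U \<rightarrow> W\<close> corresponds to the identity.\<close>

definition ih_ev ::
  "('k::field, 'h::{ring,monoid_mult}) hopf \<Rightarrow> ('k, 'a::{ring,monoid_mult}, 'h) comodalg
    \<Rightarrow> ('k, 'u::ab_group_add, 'a) amod \<Rightarrow> ('k, 'w::ab_group_add, 'a) amod
    \<Rightarrow> ('k, ('k, 'h \<Rightarrow> 'k, 'u) tens \<Rightarrow> ('k, 'h \<Rightarrow> 'k, 'w) tens, 'u) tens \<Rightarrow> 'w" where
  "ih_ev H K U W = stab_adj H (Stab H K U W) U W (idm (Stab H K U W))"

text \<open>\<open>ev (id \<otimes> ev) : (Stab(W,Z) \<otimes> Stab(U,W)) \<otimes> U \<rightarrow> Z\<close>.\<close>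

definition ih_ev_ev ::
  "('k::field, 'h::{ring,monoid_mult}) hopf \<Rightarrow> ('k, 'a::{ring,monoid_mult}, 'h) comodalg
    \<Rightarrow> ('k, 'u::ab_group_add, 'a) amod \<Rightarrow> ('k, 'w::ab_group_add, 'a) amod
    \<Rightarrow> ('k, 'z::ab_group_add, 'a) amod
    \<Rightarrow> ('k, ('k, ('k, 'h \<Rightarrow> 'k, 'w) tens \<Rightarrow> ('k, 'h \<Rightarrow> 'k, 'z) tens,
                 ('k, 'h \<Rightarrow> 'k, 'u) tens \<Rightarrow> ('k, 'h \<Rightarrow> 'k, 'w) tens) tens, 'u) tens \<Rightarrow> 'z" where
  "ih_ev_ev H K U W Z = ih_ev H K W Z \<circ>
     tmap (Stab H K W Z) (tensor (Stab H K U W) U) (Stab H K W Z) W id (ih_ev H K U W) \<circ>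
     tassoc (Stab H K W Z) (Stab H K U W) U"

definition ih_comp ::
  "('k::field, 'h::{ring,monoid_mult}) hopf \<Rightarrow> ('k, 'a::{ring,monoid_mult}, 'h) comodalg
    \<Rightarrow> ('k, 'u::ab_group_add, 'a) amod \<Rightarrow> ('k, 'w::ab_group_add, 'a) amod
    \<Rightarrow> ('k, 'z::ab_group_add, 'a) amod
    \<Rightarrow> ('k, ('k, 'h \<Rightarrow> 'k, 'w) tens \<Rightarrow> ('k, 'h \<Rightarrow> 'k, 'z) tens,
            ('k, 'h \<Rightarrow> 'k, 'u) tens \<Rightarrow> ('k, 'h \<Rightarrow> 'k, 'w) tens) tens
    \<Rightarrow> ('k, 'h \<Rightarrow> 'k, 'u) tens \<Rightarrow> ('k, 'h \<Rightarrow> 'k, 'z) tens" where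
  "ih_comp H K U W Z =
     (THE c. c \<in> car (mhom (rep_tensor H (Stab H K W Z) (Stab H K U W)) (Stab H K U Z)) \<and>
        stab_adj H (rep_tensor H (Stab H K W Z) (Stab H K U W)) U Z c = ih_ev_ev H K U W Z)"

end

theory Submission
  imports Defs
begin

text \<open>An element of \<open>H\<^sup>* \<otimes> Hom(U, W)\<close> is a linear map \<open>t : H \<rightarrow> Hom(U, W)\<close>, and \<open>\<L>(t)\<close> is \<open>K\<close>-linear if and
  only if \<open>k t(a) u = t(k\<^sub>(\<^sub>-\<^sub>1\<^sub>) a) (k\<^sub>(\<^sub>0\<^sub>) u)\<close> for all \<open>k\<close>, \<open>a\<close>, \<open>u\<close>. The action is \<open>(h t)(a) = t(a h)\<close>.
  Hence an \<open>H\<close>-linear family \<open>t\<^sub>x\<close> is determined by its values at \<open>1\<close>, since \<open>t\<^sub>x(a) = t\<^bsub>a x\<^esub>(1)\<close>, and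
  \<open>K\<close>-linear maps \<open>F : X \<otimes> U \<rightarrow> W\<close> correspond to the families \<open>t\<^sub>x(a) u = F(a x \<otimes> u)\<close>. The composite of
  \<open>\<L>(s)\<close> and \<open>\<L>(t)\<close> is \<open>\<L>\<close> of \<open>a \<mapsto> s(a\<^sub>(\<^sub>1\<^sub>)) t(a\<^sub>(\<^sub>2\<^sub>))\<close>, whose value at \<open>1\<close> is \<open>s(1) t(1)\<close>.

  The characterisation of \<open>K\<close>-linearity needs \<open>S\<^sup>-\<^sup>1\<close>. Bijectivity of \<open>S\<close> follows from a nonzero left integral
  \<open>\<Lambda>\<close>, built from traces: from \<open>S(h) \<Lambda>\<^sub>(\<^sub>1\<^sub>) \<otimes> \<Lambda>\<^sub>(\<^sub>2\<^sub>) = \<Lambda>\<^sub>(\<^sub>1\<^sub>) \<otimes> h \<Lambda>\<^sub>(\<^sub>2\<^sub>)\<close> one obtains \<open>h = 0\<close> whenever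
  \<open>S(h) = 0\<close>.\<close>

text \<open>The inverse antipode enters through the action on \<open>dual H\<close>. The element
  \<open>k\<close> acts on \<open>eps\<close> tensor \<open>u\<close> through \<open>u\<close>
  alone, so \<open>K\<close>-linearity first gives an equation with \<open>Si\<close> of k_(-1) on
  the side of \<open>W\<close>; cancelling adjacent legs carries it over to the side of
  \<open>U\<close>. Since \<open>inv\<close> of a map that is not bijective satisfies no useful law,
  bijectivity of the antipode has to come out of the Hopf axioms.

  The double antipode in the trace formula is forced. Left multiplication by \<open>y\<close>
  reaches the first leg of \<open>i\<close> only; a padding factor
  \<open>S y\<^sub>3 * S (S y\<^sub>2)\<close> under the trace completes it to the coproduct of a
  product exactly when the second leg of \<open>i\<close> also carries \<open>S\<close> twice. The
  vector \<open>x\<close> is left free because a single integral may vanish while the whole family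
  cannot, unless \<open>1 = 0\<close>.

  Tensors are functionals here and do not come as sums of pure tensors. Coordinates with respect to
  a basis of \<open>H\<close> turn Sweedler notation into finite sums, and symbols turn equations
  between elements of the stabilizer into equations between functions on \<open>H\<close>.\<close>

section \<open>Vector spaces and tensor products\<close>

text \<open>The simplifier applies these two rules eta-expanded, which turns sums of tensors into
  \<open>\<lambda>\<close>-abstractions.\<close>

declare plus_fun_apply [simp del] zero_fun_apply [simp del]

section \<open>Linear and bilinear maps between carriers\<close>

lemma
  assumes "vspace V"
  shows vspace_vector_space: "vector_space (scl V)"
    and vspace_subspace: "module.subspace (scl V) (car V)"
  using assms by (auto simp: vspace_def)

lemma
  fixes V :: "('k::field, 'v::ab_group_add, 'm) vspace_scheme"
  assumes V: "vspace V"
  shows vspace_zero [simp]: "0 \<in> car V"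
    and vspace_add [intro]: "x \<in> car V \<Longrightarrow> y \<in> car V \<Longrightarrow> x + y \<in> car V"
    and vspace_scl [intro]: "x \<in> car V \<Longrightarrow> scl V c x \<in> car V"
    and vspace_sum [intro]: "(\<And>i. i \<in> I \<Longrightarrow> f i \<in> car V) \<Longrightarrow> sum f I \<in> car V"
    and scl_add_right: "scl V c (x + y) = scl V c x + scl V c y"
    and scl_add_left: "scl V (c + d) x = scl V c x + scl V d x"
    and scl_scl: "scl V c (scl V d x) = scl V (c * d) x"
    and scl_one [simp]: "scl V 1 x = x"
    and scl_zero_left [simp]: "scl V 0 x = 0"
    and scl_zero_right [simp]: "scl V c 0 = 0"
    and scl_sum_right: "scl V c (sum f I) = (\<Sum>i\<in>I. scl V c (f i))"
    and scl_sum_left: "scl V (sum g I) x = (\<Sum>i\<in>I. scl V (g i) x)"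
proof -
  interpret vector_space "scl V" using V by (rule vspace_vector_space)
  note s = vspace_subspace[OF V]
  show "0 \<in> car V" "x \<in> car V \<Longrightarrow> y \<in> car V \<Longrightarrow> x + y \<in> car V"
    "x \<in> car V \<Longrightarrow> scl V c x \<in> car V"
    "(\<And>i. i \<in> I \<Longrightarrow> f i \<in> car V) \<Longrightarrow> sum f I \<in> car V"
    using s by (auto intro: subspace_0 subspace_add subspace_scale subspace_sum)
  show "scl V c (x + y) = scl V c x + scl V c y" "scl V (c + d) x = scl V c x + scl V d x"
    "scl V c (scl V d x) = scl V (c * d) x" "scl V 1 x = x" "scl V 0 x = 0" "scl V c 0 = 0"
    "scl V c (sum f I) = (\<Sum>i\<in>I. scl V c (f i))"
    "scl V (sum g I) x = (\<Sum>i\<in>I. scl V (g i) x)"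
    by (simp_all add: scale_right_distrib scale_left_distrib scale_sum_right scale_sum_left)
qed

lemma linear_onI:
  assumes "\<And>x. x \<in> car V \<Longrightarrow> f x \<in> car W"
    and "\<And>x y. x \<in> car V \<Longrightarrow> y \<in> car V \<Longrightarrow> f (x + y) = f x + f y"
    and "\<And>c x. x \<in> car V \<Longrightarrow> f (scl V c x) = scl W c (f x)"
  shows "linear_on V W f"
  using assms by (auto simp: linear_on_def)

lemma
  assumes "linear_on V W f"
  shows linear_on_car: "x \<in> car V \<Longrightarrow> f x \<in> car W"
    and linear_on_add: "x \<in> car V \<Longrightarrow> y \<in> car V \<Longrightarrow> f (x + y) = f x + f y"
    and linear_on_scl: "x \<in> car V \<Longrightarrow> f (scl V c x) = scl W c (f x)"
  using assms by (auto simp: linear_on_def)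

lemma linear_on_0:
  assumes "linear_on V W f" "vspace V"
  shows "f 0 = 0"
  using linear_on_add[OF assms(1), of 0 0] vspace_zero[OF assms(2)] by simp

lemma linear_on_sum:
  assumes "linear_on V W f" "vspace V" "\<And>i. i \<in> I \<Longrightarrow> x i \<in> car V"
  shows "f (sum x I) = (\<Sum>i\<in>I. f (x i))"
  using assms(3)
proof (induction I rule: infinite_finite_induct)
  case (insert a I)
  then show ?case
    using linear_on_add[OF assms(1), of "x a" "sum x I"] vspace_sum[OF assms(2), of I x] by simp
qed (simp_all add: linear_on_0[OF assms(1,2)])

lemma linear_on_cong:
  assumes "linear_on V W f" "\<And>x. x \<in> car V \<Longrightarrow> f x = g x" "vspace V"
  shows "linear_on V W g"
proof (rule linear_onI)
  show "g x \<in> car W" if "x \<in> car V" for x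
    using linear_on_car[OF assms(1) that] assms(2)[OF that] by simp
  show "g (x + y) = g x + g y" if "x \<in> car V" "y \<in> car V" for x y
    using linear_on_add[OF assms(1) that] assms(2) that vspace_add[OF assms(3) that] by simp
  show "g (scl V c x) = scl W c (g x)" if "x \<in> car V" for c x
    using linear_on_scl[OF assms(1) that] assms(2) that vspace_scl[OF assms(3) that] by simp
qed

lemma linear_on_compose:
  assumes "linear_on V W f" "linear_on W E g"
  shows "linear_on V E (\<lambda>x. g (f x))"
  using assms by (auto simp: linear_on_def)

lemma linear_on_plus:
  assumes "linear_on V E f" "linear_on V E g" "vspace E"
  shows "linear_on V E (\<lambda>x. f x + g x)"
  using assms by (intro linear_onI)
    (simp_all add: linear_on_car linear_on_add linear_on_scl scl_add_right vspace_add ac_simps)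

lemma linear_on_scale:
  assumes "linear_on V E f" "vspace E"
  shows "linear_on V E (\<lambda>x. scl E c (f x))"
  using assms by (intro linear_onI)
    (simp_all add: linear_on_car linear_on_add linear_on_scl scl_add_right scl_scl vspace_scl
      mult.commute)

lemma linear_on_zero_fun: "vspace E \<Longrightarrow> linear_on V E (\<lambda>x. 0)"
  by (simp add: linear_on_def)

lemma linear_on_sum_fun:
  assumes "\<And>i. i \<in> I \<Longrightarrow> linear_on V E (\<lambda>x. f i x)" "vspace E"
  shows "linear_on V E (\<lambda>x. \<Sum>i\<in>I. f i x)"
  using assms(1)
  by (induction I rule: infinite_finite_induct)
    (auto intro: linear_on_plus linear_on_zero_fun assms(2))

lemma linear_on_ident: "linear_on V V (\<lambda>x. x)"
  by (simp add: linear_on_def)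

lemma linear_on_coeff:
  assumes "linear_on V ground f" "e \<in> car E" "vspace E"
  shows "linear_on V E (\<lambda>x. scl E (f x) e)"
  using assms by (intro linear_onI)
    (simp_all add: linear_on_add linear_on_scl scl_add_left scl_scl vspace_scl ground_def)

lemma vspace_ground [simp]: "vspace ground"
proof -
  have "vector_space ((*) :: 'a \<Rightarrow> 'a \<Rightarrow> 'a)" by unfold_locales (auto simp: algebra_simps)
  then interpret vector_space "(*) :: 'a \<Rightarrow> 'a \<Rightarrow> 'a" .
  show ?thesis by (simp add: vspace_def ground_def vector_space_axioms)
qed

lemma ground_simps [simp]: "car ground = UNIV" "scl ground = (*)"
  by (simp_all add: ground_def)

lemma bilinear_onI:
  assumes "\<And>x. x \<in> car V \<Longrightarrow> linear_on W E (b x)"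
    and "\<And>y. y \<in> car W \<Longrightarrow> linear_on V E (\<lambda>x. b x y)"
  shows "bilinear_on V W E b"
  using assms by (simp add: bilinear_on_def)

lemma
  assumes "bilinear_on V W E b"
  shows bilinear_on_right: "x \<in> car V \<Longrightarrow> linear_on W E (b x)"
    and bilinear_on_left: "y \<in> car W \<Longrightarrow> linear_on V E (\<lambda>x. b x y)"
    and bilinear_on_car: "x \<in> car V \<Longrightarrow> y \<in> car W \<Longrightarrow> b x y \<in> car E"
  using assms by (auto simp: bilinear_on_def linear_on_def)

lemma bilinear_on_compose:
  assumes "bilinear_on V' W' E b" "linear_on V V' f" "linear_on W W' g"
  shows "bilinear_on V W E (\<lambda>x y. b (f x) (g y))"
proof (rule bilinear_onI)
  show "linear_on W E (\<lambda>y. b (f x) (g y))" if "x \<in> car V" for x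
    using assms(3) bilinear_on_right[OF assms(1) linear_on_car[OF assms(2) that]]
    by (rule linear_on_compose)
  show "linear_on V E (\<lambda>x. b (f x) (g y))" if "y \<in> car W" for y
    using assms(2) bilinear_on_left[OF assms(1) linear_on_car[OF assms(3) that]]
    by (rule linear_on_compose)
qed

lemma bilinear_on_post:
  assumes "bilinear_on V W E b" "linear_on E F f"
  shows "bilinear_on V W F (\<lambda>x y. f (b x y))"
  using assms by (auto simp: bilinear_on_def intro: linear_on_compose)

section \<open>Hom spaces\<close>

lemma
  shows car_hom: "car (hom V W) = {f. linear_on V W f \<and> (\<forall>x. x \<notin> car V \<longrightarrow> f x = 0)}"
    and scl_hom [simp]: "scl (hom V W) c f = (\<lambda>x. scl W c (f x))"
  by (simp_all add: hom_def)

lemma hom_linear: "f \<in> car (hom V W) \<Longrightarrow> linear_on V W f"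
  and hom_outside: "f \<in> car (hom V W) \<Longrightarrow> x \<notin> car V \<Longrightarrow> f x = 0"
  by (simp_all add: car_hom)

lemma hom_eqI:
  assumes "f \<in> car (hom V W)" "g \<in> car (hom V W)" "\<And>x. x \<in> car V \<Longrightarrow> f x = g x"
  shows "f = g"
proof
  show "f x = g x" for x using assms by (cases "x \<in> car V") (auto simp: car_hom)
qed

lemma vspace_hom:
  assumes W: "vspace W"
  shows "vspace (hom V W)"
proof -
  have vs: "vector_space (scl (hom V W))"
    by unfold_locales (auto simp: fun_eq_iff plus_fun_apply scl_add_right[OF W] scl_add_left[OF W] scl_scl[OF W] W)
  interpret vector_space "scl (hom V W)" by (rule vs)
  have "subspace (car (hom V W))"
    by (rule subspaceI)
      (auto simp: car_hom plus_fun_def zero_fun_def W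
        intro: linear_on_plus linear_on_scale linear_on_zero_fun)
  with vs show ?thesis by (simp add: vspace_def)
qed

text \<open>The convention of vanishing outside the carrier survives composition because
  \<open>g 0 = 0\<close>.\<close>

lemma hom_comp:
  assumes "f \<in> car (hom V W)" "linear_on W E g" "vspace W"
  shows "(\<lambda>x. g (f x)) \<in> car (hom V E)"
  using assms linear_on_0[OF assms(2,3)] by (auto simp: car_hom intro: linear_on_compose)

lemma hom_restrict:
  assumes "linear_on V W f" "vspace V"
  shows "(\<lambda>x. if x \<in> car V then f x else 0) \<in> car (hom V W)"
proof -
  have "linear_on V W (\<lambda>x. if x \<in> car V then f x else 0)"
    by (rule linear_on_cong[OF assms(1) _ assms(2)]) simp
  then show ?thesis by (simp add: car_hom)
qed

section \<open>Pure tensors, induction and lifts\<close>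

lemma
  shows scl_tensor [simp]: "scl (tensor V W) = tscl"
    and car_tensor: "car (tensor V W) =
      module.span tscl {tpure V W v w | v w. v \<in> car V \<and> w \<in> car W}"
  by (simp_all add: tensor_def)

lemma vspace_tensor [simp]:
  fixes V :: "('k::field, 'v::ab_group_add, 'm) vspace_scheme"
    and W :: "('k, 'w::ab_group_add, 'n) vspace_scheme"
  shows "vspace (tensor V W)"
proof -
  interpret vector_space "tscl :: 'k \<Rightarrow> ('k, 'v, 'w) tens \<Rightarrow> _" by (rule vector_space_tscl)
  show ?thesis by (simp add: vspace_def car_tensor vector_space_axioms)
qed

lemma tpure_car [intro]:
  fixes V :: "('k::field, 'v::ab_group_add, 'm) vspace_scheme"
    and W :: "('k, 'w::ab_group_add, 'n) vspace_scheme"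
  assumes "v \<in> car V" "w \<in> car W"
  shows "tpure V W v w \<in> car (tensor V W)"
proof -
  interpret vector_space "tscl :: 'k \<Rightarrow> ('k, 'v, 'w) tens \<Rightarrow> _" by (rule vector_space_tscl)
  show ?thesis using assms by (auto simp: car_tensor intro: span_base)
qed

lemma bilinear_tpure: "bilinear_on V W (tensor V W) (tpure V W)"
proof -
  have "tpure V W v (w + w') = tpure V W v w + tpure V W v w'"
    "tpure V W v (scl W c w) = tscl c (tpure V W v w)"
    if "v \<in> car V" "w \<in> car W" "w' \<in> car W" for v w w' c
    using that by (auto simp: tpure_def tscl_def fun_eq_iff plus_fun_apply linear_on_add linear_on_scl
      dest!: bilinear_on_right)
  moreover have "tpure V W (v + v') w = tpure V W v w + tpure V W v' w"
    "tpure V W (scl V c v) w = tscl c (tpure V W v w)"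
    if "v \<in> car V" "v' \<in> car V" "w \<in> car W" for v v' w c
    using that by (auto simp: tpure_def tscl_def fun_eq_iff plus_fun_apply
      dest!: bilinear_on_left dest: linear_on_add linear_on_scl)
  ultimately show ?thesis by (intro bilinear_onI linear_onI) auto
qed

lemma tensor_induct [consumes 1, case_names zero add pure]:
  fixes V :: "('k::field, 'v::ab_group_add, 'm) vspace_scheme"
    and W :: "('k, 'w::ab_group_add, 'n) vspace_scheme"
  assumes t: "t \<in> car (tensor V W)"
    and zero: "P 0"
    and add: "\<And>s t. s \<in> car (tensor V W) \<Longrightarrow> t \<in> car (tensor V W) \<Longrightarrow> P s \<Longrightarrow> P t \<Longrightarrow> P (s + t)"
    and pure: "\<And>v w c. v \<in> car V \<Longrightarrow> w \<in> car W \<Longrightarrow> P (tscl c (tpure V W v w))"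
  shows "P t"
proof -
  interpret vector_space "tscl :: 'k \<Rightarrow> ('k, 'v, 'w) tens \<Rightarrow> _" by (rule vector_space_tscl)
  have "t \<in> car (tensor V W) \<and> P t" using t unfolding car_tensor
  proof (induction rule: span_induct_alt)
    case base
    then show ?case using zero span_zero by blast
  next
    case (step c x y)
    then obtain v w where x: "x = tpure V W v w" "v \<in> car V" "w \<in> car W" by auto
    have "tscl c x \<in> car (tensor V W)"
      unfolding car_tensor using step(1) by (intro span_scale span_base)
    then show ?case using step x add[of "tscl c x" y] pure unfolding car_tensor
      by (auto intro: span_add)
  qed
  then show ?thesis ..
qed

lemma tensor_linear_eqI:
  assumes "linear_on (tensor V W) E f" "linear_on (tensor V W) E g"
    and "\<And>v w. v \<in> car V \<Longrightarrow> w \<in> car W \<Longrightarrow> f (tpure V W v w) = g (tpure V W v w)"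
    and "t \<in> car (tensor V W)"
  shows "f t = g t"
  using assms(4)
proof (induction rule: tensor_induct)
  case zero
  then show ?case by (simp add: linear_on_0[OF assms(1)] linear_on_0[OF assms(2)])
next
  case (add s t)
  then show ?case
    using linear_on_add[OF assms(1) add(1,2)] linear_on_add[OF assms(2) add(1,2)] by (simp only:)
next
  case (pure v w c)
  then show ?case
    using linear_on_scl[OF assms(1), of "tpure V W v w" c] linear_on_scl[OF assms(2), of "tpure V W v w" c]
    by (auto simp: assms(3) tpure_car)
qed

lemma
  assumes "vspace V" "vspace W" "vspace E" "bilinear_on V W E b"
  shows tlift_hom: "tlift V W E b \<in> car (hom (tensor V W) E)"
    and tlift_linear: "linear_on (tensor V W) E (tlift V W E b)"
    and tlift_pure: "v \<in> car V \<Longrightarrow> w \<in> car W \<Longrightarrow> tlift V W E b (tpure V W v w) = b v w"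
proof -
  from theI'[OF tensor_universal[OF assms]]
  have *: "tlift V W E b \<in> car (hom (tensor V W) E) \<and>
     (\<forall>v\<in>car V. \<forall>w\<in>car W. tlift V W E b (tpure V W v w) = b v w)"
    unfolding tlift_def .
  then show "tlift V W E b \<in> car (hom (tensor V W) E)" "linear_on (tensor V W) E (tlift V W E b)"
    "v \<in> car V \<Longrightarrow> w \<in> car W \<Longrightarrow> tlift V W E b (tpure V W v w) = b v w"
    by (auto simp: hom_linear)
qed

lemma tlift_unique:
  assumes "vspace V" "vspace W" "vspace E" "bilinear_on V W E b"
    and "linear_on (tensor V W) E f" "t \<in> car (tensor V W)"
    and "\<And>v w. v \<in> car V \<Longrightarrow> w \<in> car W \<Longrightarrow> f (tpure V W v w) = b v w"
  shows "tlift V W E b t = f t"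
  by (rule tensor_linear_eqI[OF tlift_linear[OF assms(1-4)] assms(5) _ assms(6)])
    (simp add: tlift_pure[OF assms(1-4)] assms(7))

lemma linear_tlift:
  assumes "vspace V" "vspace W" "vspace E" "vspace F" "bilinear_on V W E b" "linear_on E F f"
    and "t \<in> car (tensor V W)"
  shows "f (tlift V W E b t) = tlift V W F (\<lambda>v w. f (b v w)) t"
  using assms
  by (intro tlift_unique[symmetric])
    (auto simp: tlift_pure intro: bilinear_on_post linear_on_compose tlift_linear)

lemma tlift_cong:
  assumes "\<And>v w. v \<in> car V \<Longrightarrow> w \<in> car W \<Longrightarrow> b v w = b' v w"
  shows "tlift V W E b = tlift V W E b'"
  using assms by (simp add: tlift_def)

lemma
  assumes "vspace V" "vspace W" "linear_on V V' f" "linear_on W W' g"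
  shows tmap_hom: "tmap V W V' W' f g \<in> car (hom (tensor V W) (tensor V' W'))"
    and tmap_linear: "linear_on (tensor V W) (tensor V' W') (tmap V W V' W' f g)"
    and tmap_pure: "v \<in> car V \<Longrightarrow> w \<in> car W \<Longrightarrow>
      tmap V W V' W' f g (tpure V W v w) = tpure V' W' (f v) (g w)"
proof -
  have b: "bilinear_on V W (tensor V' W') (\<lambda>v w. tpure V' W' (f v) (g w))"
    using bilinear_tpure assms(3,4) by (rule bilinear_on_compose)
  note * = assms(1,2) vspace_tensor b
  show "tmap V W V' W' f g \<in> car (hom (tensor V W) (tensor V' W'))"
    "linear_on (tensor V W) (tensor V' W') (tmap V W V' W' f g)"
    "v \<in> car V \<Longrightarrow> w \<in> car W \<Longrightarrow> tmap V W V' W' f g (tpure V W v w) = tpure V' W' (f v) (g w)"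
    unfolding tmap_def using tlift_hom[OF *] tlift_linear[OF *] tlift_pure[OF *]
    by auto
qed

text \<open>Sweedler expressions nest lifts, so the value of a lift has to be linear in every
  parameter of its bilinear map. Uniqueness of the lift gives this: sums and multiples of lifts have
  the required values on pure tensors.\<close>

lemma linear_tlift_param:
  assumes VWE: "vspace V" "vspace W" "vspace E" and X: "vspace X"
    and b: "\<And>x. x \<in> car X \<Longrightarrow> bilinear_on V W E (b x)"
    and l: "\<And>v w. v \<in> car V \<Longrightarrow> w \<in> car W \<Longrightarrow> linear_on X E (\<lambda>x. b x v w)"
    and t: "t \<in> car (tensor V W)"
  shows "linear_on X E (\<lambda>x. tlift V W E (b x) t)"
proof (rule linear_onI)
  note * = VWE b
  have [simp]: "vspace E" by (rule VWE)
  show "tlift V W E (b x) t \<in> car E" if "x \<in> car X" for x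
    using linear_on_car[OF tlift_linear[OF VWE b[OF that]] t] .
  show "tlift V W E (b (x + y)) t = tlift V W E (b x) t + tlift V W E (b y) t"
    if x: "x \<in> car X" and y: "y \<in> car X" for x y
    by (intro tlift_unique[OF *] linear_on_plus[OF tlift_linear[OF *] tlift_linear[OF *]]
        VWE vspace_add[OF X] x y t)
      (simp add: tlift_pure[OF *] x y linear_on_add[OF l])
  show "tlift V W E (b (scl X c x)) t = scl E c (tlift V W E (b x) t)"
    if x: "x \<in> car X" for c x
    by (intro tlift_unique[OF *] linear_on_scale[OF tlift_linear[OF *]]
        VWE vspace_scl[OF X] x t)
      (simp add: tlift_pure[OF *] x linear_on_scl[OF l])
qed

section \<open>Associativity and trilinear maps\<close>

lemma bilinear_tlift_tpure:
  assumes "vspace V" "vspace W" "vspace X"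
  shows "bilinear_on (tensor V W) X (tensor V (tensor W X))
     (\<lambda>t x. tlift V W (tensor V (tensor W X)) (\<lambda>v w. tpure V (tensor W X) v (tpure W X w x)) t)"
proof -
  let ?E = "tensor V (tensor W X)"
  let ?b = "\<lambda>x v w. tpure V (tensor W X) v (tpure W X w x)"
  have b: "bilinear_on V W ?E (?b x)" if "x \<in> car X" for x
    using that by (intro bilinear_on_compose[OF bilinear_tpure] linear_on_ident
      bilinear_on_left[OF bilinear_tpure])
  have r: "linear_on X ?E (\<lambda>x. ?b x v w)" if "v \<in> car V" "w \<in> car W" for v w
    using bilinear_on_right[OF bilinear_tpure that(2)] bilinear_on_right[OF bilinear_tpure that(1)]
    by (rule linear_on_compose)
  show ?thesis
    by (intro bilinear_onI tlift_linear linear_tlift_param[OF assms(1,2) _ assms(3)] vspace_tensor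
      assms b r)
qed

lemma
  assumes "vspace V" "vspace W" "vspace X"
  shows tassoc_hom: "tassoc V W X \<in> car (hom (tensor (tensor V W) X) (tensor V (tensor W X)))"
    and tassoc_linear: "linear_on (tensor (tensor V W) X) (tensor V (tensor W X)) (tassoc V W X)"
    and tassoc_pure: "t \<in> car (tensor V W) \<Longrightarrow> x \<in> car X \<Longrightarrow>
      tassoc V W X (tpure (tensor V W) X t x) =
      tlift V W (tensor V (tensor W X)) (\<lambda>v w. tpure V (tensor W X) v (tpure W X w x)) t"
    and tassoc_pure_pure: "v \<in> car V \<Longrightarrow> w \<in> car W \<Longrightarrow> x \<in> car X \<Longrightarrow>
      tassoc V W X (tpure (tensor V W) X (tpure V W v w) x) = tpure V (tensor W X) v (tpure W X w x)"
proof -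
  note * = vspace_tensor assms(3) vspace_tensor bilinear_tlift_tpure[OF assms]
  show "tassoc V W X \<in> car (hom (tensor (tensor V W) X) (tensor V (tensor W X)))"
    "linear_on (tensor (tensor V W) X) (tensor V (tensor W X)) (tassoc V W X)"
    unfolding tassoc_def using tlift_hom[OF *] tlift_linear[OF *] by auto
  show p: "t \<in> car (tensor V W) \<Longrightarrow> x \<in> car X \<Longrightarrow>
      tassoc V W X (tpure (tensor V W) X t x) =
      tlift V W (tensor V (tensor W X)) (\<lambda>v w. tpure V (tensor W X) v (tpure W X w x)) t" for t x
    unfolding tassoc_def using tlift_pure[OF *] by auto
  show "tassoc V W X (tpure (tensor V W) X (tpure V W v w) x) = tpure V (tensor W X) v (tpure W X w x)"
    if "v \<in> car V" "w \<in> car W" "x \<in> car X"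
  proof -
    have "bilinear_on V W (tensor V (tensor W X)) (\<lambda>v w. tpure V (tensor W X) v (tpure W X w x))"
      using that by (intro bilinear_on_compose[OF bilinear_tpure] linear_on_ident
        bilinear_on_left[OF bilinear_tpure])
    then show ?thesis using that assms by (simp add: p tpure_car tlift_pure)
  qed
qed

text \<open>Nested lifts stand for a trilinear map on either bracketing. In
  \<open>tlift_tassoc\<close> the tensor \<open>t\<close> need not be pure, because a coproduct will
  be put in its place.\<close>

lemma
  assumes V: "vspace V" and W: "vspace W" and X: "vspace X" and E: "vspace E"
    and T1: "\<And>w x. w \<in> car W \<Longrightarrow> x \<in> car X \<Longrightarrow> linear_on V E (\<lambda>v. T v w x)"
    and T2: "\<And>v x. v \<in> car V \<Longrightarrow> x \<in> car X \<Longrightarrow> linear_on W E (\<lambda>w. T v w x)"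
    and T3: "\<And>v w. v \<in> car V \<Longrightarrow> w \<in> car W \<Longrightarrow> linear_on X E (\<lambda>x. T v w x)"
  shows trilinear_tlift: "bilinear_on V (tensor W X) E (\<lambda>v t. tlift W X E (T v) t)"
    and tlift_tassoc: "t \<in> car (tensor V W) \<Longrightarrow> x \<in> car X \<Longrightarrow>
      tlift V (tensor W X) E (\<lambda>v t. tlift W X E (T v) t)
        (tassoc V W X (tpure (tensor V W) X t x)) = tlift V W E (\<lambda>v w. T v w x) t"
proof -
  show b: "bilinear_on V (tensor W X) E (\<lambda>v t. tlift W X E (T v) t)"
    by (intro bilinear_onI tlift_linear linear_tlift_param[OF W X E V] T1 T2 T3 W X E)
  show "tlift V (tensor W X) E (\<lambda>v t. tlift W X E (T v) t)
      (tassoc V W X (tpure (tensor V W) X t x)) = tlift V W E (\<lambda>v w. T v w x) t"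
    if t: "t \<in> car (tensor V W)" and x: "x \<in> car X"
  proof -
    let ?L = "tlift V (tensor W X) E (\<lambda>v t. tlift W X E (T v) t)"
    have L: "linear_on (tensor V (tensor W X)) E ?L"
      by (intro tlift_linear V vspace_tensor E b)
    have TT: "bilinear_on V W E (\<lambda>v w. T v w x)"
      by (intro bilinear_onI T1 T2 x)
    have "?L (tassoc V W X (tpure (tensor V W) X t x)) =
        tlift V W E (\<lambda>v w. ?L (tpure V (tensor W X) v (tpure W X w x))) t"
      unfolding tassoc_pure[OF V W X t x]
      by (rule linear_tlift[OF V W vspace_tensor E _ L t])
        (intro bilinear_on_compose[OF bilinear_tpure] linear_on_ident
          bilinear_on_left[OF bilinear_tpure] x)
    also have "\<dots> = tlift V W E (\<lambda>v w. T v w x) t"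
    proof -
      have "?L (tpure V (tensor W X) v (tpure W X w x)) = T v w x"
        if "v \<in> car V" "w \<in> car W" for v w
        using that x tlift_pure[OF V vspace_tensor E b that(1) tpure_car[OF that(2) x]]
          tlift_pure[OF W X E bilinear_onI[OF T3 T2], of v] by simp
      then show ?thesis by (simp cong: tlift_cong)
    qed
    finally show ?thesis .
  qed
qed

text \<open>Both sides of the coassociativity law, evaluated against a trilinear map.\<close>

lemma
  assumes V: "vspace V" and X: "vspace X" and E: "vspace E"
    and T1: "\<And>w x. w \<in> car V \<Longrightarrow> x \<in> car X \<Longrightarrow> linear_on V E (\<lambda>v. T v w x)"
    and T2: "\<And>v x. v \<in> car V \<Longrightarrow> x \<in> car X \<Longrightarrow> linear_on V E (\<lambda>w. T v w x)"
    and T3: "\<And>v w. v \<in> car V \<Longrightarrow> w \<in> car V \<Longrightarrow> linear_on X E (\<lambda>x. T v w x)"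
    and t: "t \<in> car (tensor V X)"
  shows tlift_tassoc_comul: "linear_on V (tensor V V) \<Delta> \<Longrightarrow>
      tlift V (tensor V X) E (\<lambda>v t. tlift V X E (T v) t)
        (tassoc V V X (tmap V X (tensor V V) X \<Delta> id t)) =
      tlift V X E (\<lambda>v x. tlift V V E (\<lambda>p q. T p q x) (\<Delta> v)) t"
    and tlift_tmap_coact: "linear_on X (tensor V X) \<delta> \<Longrightarrow>
      tlift V (tensor V X) E (\<lambda>v t. tlift V X E (T v) t) (tmap V X V (tensor V X) id \<delta> t) =
      tlift V X E (\<lambda>v x. tlift V X E (T v) (\<delta> x)) t"
proof -
  let ?L = "tlift V (tensor V X) E (\<lambda>v t. tlift V X E (T v) t)"
  note b = trilinear_tlift[OF V V X E T1 T2 T3]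
  have L: "linear_on (tensor V (tensor V X)) E ?L"
    by (intro tlift_linear V vspace_tensor E b)
  have i: "linear_on V V id" "linear_on X X id" by (simp_all add: linear_on_def)
  show "?L (tassoc V V X (tmap V X (tensor V V) X \<Delta> id t)) =
      tlift V X E (\<lambda>v x. tlift V V E (\<lambda>p q. T p q x) (\<Delta> v)) t"
    if D: "linear_on V (tensor V V) \<Delta>"
  proof (rule sym, rule tlift_unique[OF V X E _ _ t])
    have B: "bilinear_on V V E (\<lambda>p q. T p q x)" if "x \<in> car X" for x
      using that by (intro bilinear_onI T1 T2)
    show "bilinear_on V X E (\<lambda>v x. tlift V V E (\<lambda>p q. T p q x) (\<Delta> v))"
      by (intro bilinear_onI linear_on_compose[OF D tlift_linear[OF V V E B]]
          linear_tlift_param[OF V V E X B] T3 linear_on_car[OF D])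
    show "linear_on (tensor V X) E (\<lambda>t. ?L (tassoc V V X (tmap V X (tensor V V) X \<Delta> id t)))"
      by (rule linear_on_compose[OF tmap_linear[OF V X D i(2)]
          linear_on_compose[OF tassoc_linear[OF V V X] L]])
    show "?L (tassoc V V X (tmap V X (tensor V V) X \<Delta> id (tpure V X v x))) =
        tlift V V E (\<lambda>p q. T p q x) (\<Delta> v)" if "v \<in> car V" "x \<in> car X" for v x
      using that by (simp add: tmap_pure[OF V X D i(2)] tlift_tassoc[OF V V X E T1 T2 T3]
          linear_on_car[OF D])
  qed
  show "?L (tmap V X V (tensor V X) id \<delta> t) = tlift V X E (\<lambda>v x. tlift V X E (T v) (\<delta> x)) t"
    if D: "linear_on X (tensor V X) \<delta>"
  proof (rule sym, rule tlift_unique[OF V X E _ _ t])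
    have B: "bilinear_on V X E (T v)" if "v \<in> car V" for v
      using that by (intro bilinear_onI T3 T2)
    show "bilinear_on V X E (\<lambda>v x. tlift V X E (T v) (\<delta> x))"
      by (intro bilinear_onI linear_on_compose[OF D tlift_linear[OF V X E B]]
          linear_tlift_param[OF V X E V B] T1 linear_on_car[OF D])
    show "linear_on (tensor V X) E (\<lambda>t. ?L (tmap V X V (tensor V X) id \<delta> t))"
      by (rule linear_on_compose[OF tmap_linear[OF V X i(1) D] L])
    show "?L (tmap V X V (tensor V X) id \<delta> (tpure V X v x)) = tlift V X E (T v) (\<delta> x)"
      if "v \<in> car V" "x \<in> car X" for v x
      using that by (simp add: tmap_pure[OF V X i(1) D] tlift_pure[OF V vspace_tensor E b]
          linear_on_car[OF D])
  qed
qed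

section \<open>Bases and finite dimension\<close>

text \<open>Phrased for vectors \<open>x i\<close> with coordinates \<open>c i\<close> instead of a
  set of basis vectors: it serves for a basis of \<open>H\<close>, and again for the dual of
  \<open>H\<close>, where coordinate functionals are the vectors and evaluations are the
  coordinates.\<close>

lemma tensor_expand:
  assumes V: "vspace V" and W: "vspace W" and t: "t \<in> car (tensor V W)"
    and x: "\<And>i. i \<in> I \<Longrightarrow> x i \<in> car V"
    and c: "\<And>i. i \<in> I \<Longrightarrow> linear_on V ground (c i)"
    and expand: "\<And>v. v \<in> car V \<Longrightarrow> (\<Sum>i\<in>I. scl V (c i v) (x i)) = v"
  shows "t = (\<Sum>i\<in>I. tpure V W (x i) (tlift V W W (\<lambda>v w. scl W (c i v) w) t))"
proof -
  have b: "bilinear_on V W W (\<lambda>v w. scl W (c i v) w)" if "i \<in> I" for i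
    using c[OF that] by (auto intro!: bilinear_onI linear_on_scale linear_on_coeff linear_on_ident W)
  note l = tlift_linear[OF V W W b]
  show ?thesis
  proof (rule tensor_linear_eqI[OF linear_on_ident _ _ t])
    show "linear_on (tensor V W) (tensor V W)
      (\<lambda>t. \<Sum>i\<in>I. tpure V W (x i) (tlift V W W (\<lambda>v w. scl W (c i v) w) t))"
      using x by (intro linear_on_sum_fun linear_on_compose[OF l bilinear_on_right[OF bilinear_tpure]]
          vspace_tensor)
    fix v w assume vw: "v \<in> car V" "w \<in> car W"
    have "(\<Sum>i\<in>I. tpure V W (x i) (tlift V W W (\<lambda>v w. scl W (c i v) w) (tpure V W v w)))
      = (\<Sum>i\<in>I. tpure V W (x i) (scl W (c i v) w))"
      by (intro sum.cong refl) (simp add: tlift_pure[OF V W W b] vw)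
    also have "\<dots> = (\<Sum>i\<in>I. tpure V W (scl V (c i v) (x i)) w)"
      by (intro sum.cong refl)
        (use vw x in \<open>simp add: linear_on_scl[OF bilinear_on_right[OF bilinear_tpure]]
          linear_on_scl[OF bilinear_on_left[OF bilinear_tpure]]\<close>)
    also have "\<dots> = tpure V W (\<Sum>i\<in>I. scl V (c i v) (x i)) w"
      by (rule linear_on_sum[OF bilinear_on_left[OF bilinear_tpure vw(2)] V, symmetric])
        (auto intro: vspace_scl[OF V] x)
    finally show "tpure V W v w =
      (\<Sum>i\<in>I. tpure V W (x i) (tlift V W W (\<lambda>v w. scl W (c i v) w) (tpure V W v w)))"
      using expand[OF vw(1)] by simp
  qed
qed

lemma fin_dim_basis:
  assumes V: "vspace V" and fd: "fin_dim V"
  obtains B c where "finite B" "B \<subseteq> car V" "\<And>b. b \<in> B \<Longrightarrow> linear_on V ground (c b)"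
    "\<And>v. v \<in> car V \<Longrightarrow> (\<Sum>b\<in>B. scl V (c b v) b) = v"
    "\<And>a b. a \<in> B \<Longrightarrow> b \<in> B \<Longrightarrow> c a b = (if a = b then 1 else 0)"
proof -
  interpret vector_space "scl V" using V by (rule vspace_vector_space)
  from fd obtain F where F: "finite F" "span F = car V" by (auto simp: fin_dim_def)
  obtain B where B: "B \<subseteq> car V" "independent B" "car V \<subseteq> span B"
    by (rule maximal_independent_subset)
  have fin: "finite B" using independent_span_bound[OF F(1) B(2)] B(1) F(2) by auto
  show thesis
  proof (rule that[OF fin B(1), of "\<lambda>b v. representation B v b"])
    show "linear_on V ground (\<lambda>v. representation B v b)" for b
      using B by (auto intro!: linear_onI simp: representation_add representation_scale subsetD)
    show "(\<Sum>b\<in>B. scl V (representation B v b) b) = v" if "v \<in> car V" for v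
      using B that fin by (auto intro: sum_representation_eq)
    show "representation B b a = (if a = b then 1 else 0)" if "b \<in> B" for a b
      using B that by (auto simp: representation_basis)
  qed
qed

text \<open>\<open>F\<close> may lie outside the carrier, so this covers subspaces of
  finite-dimensional spaces. A maximal independent subset of the carrier spans it and is finite
  because it is independent within the span of \<open>F\<close>.\<close>

lemma fin_dim_subset:
  assumes S: "vspace S" and F: "finite F" and sub: "car S \<subseteq> module.span (scl S) F"
  shows "fin_dim S"
proof -
  interpret vector_space "scl S" using S by (rule vspace_vector_space)
  obtain B where B: "B \<subseteq> car S" "independent B" "car S \<subseteq> span B"
    by (rule maximal_independent_subset)
  have "finite B" using independent_span_bound[OF F B(2)] B(1) sub by auto
  moreover have "span B = car S"
    using B span_minimal[OF B(1) vspace_subspace[OF S]] by auto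
  ultimately show ?thesis by (auto simp: fin_dim_def)
qed

lemma fin_dim_tensor:
  fixes V :: "('k::field, 'v::ab_group_add, 'm) vspace_scheme"
    and W :: "('k, 'w::ab_group_add, 'n) vspace_scheme"
  assumes "vspace V" "vspace W" "fin_dim V" "fin_dim W"
  shows "fin_dim (tensor V W)"
proof -
  interpret vector_space "tscl :: 'k \<Rightarrow> ('k, 'v, 'w) tens \<Rightarrow> _" by (rule vector_space_tscl)
  obtain B c where B: "finite B" "B \<subseteq> car V" "\<And>v. v \<in> car V \<Longrightarrow> (\<Sum>b\<in>B. scl V (c b v) b) = v"
    using fin_dim_basis[OF assms(1,3)] by metis
  obtain C d where C: "finite C" "C \<subseteq> car W" "\<And>w. w \<in> car W \<Longrightarrow> (\<Sum>b\<in>C. scl W (d b w) b) = w"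
    using fin_dim_basis[OF assms(2,4)] by metis
  let ?F = "(\<lambda>(b, b'). tpure V W b b') ` (B \<times> C)"
  show ?thesis
  proof (rule fin_dim_subset[OF vspace_tensor])
    show "finite ?F" using B(1) C(1) by simp
    have "tpure V W v w \<in> span ?F" if vw: "v \<in> car V" "w \<in> car W" for v w
    proof -
      note l = bilinear_on_left[OF bilinear_tpure[of V W]]
      note r = bilinear_on_right[OF bilinear_tpure[of V W]]
      have 1: "tpure V W v w = (\<Sum>b\<in>B. tscl (c b v) (tpure V W b w))"
      proof -
        have "tpure V W v w = tpure V W (\<Sum>b\<in>B. scl V (c b v) b) w" using B(3) vw(1) by simp
        also have "\<dots> = (\<Sum>b\<in>B. tpure V W (scl V (c b v) b) w)"
          by (rule linear_on_sum[OF l[OF vw(2)] assms(1)]) (use B(2) assms(1) in auto)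
        finally show ?thesis using B(2) by (auto simp: linear_on_scl[OF l[OF vw(2)]] intro!: sum.cong)
      qed
      have 2: "tpure V W b w = (\<Sum>b'\<in>C. tscl (d b' w) (tpure V W b b'))" if "b \<in> B" for b
      proof -
        have b: "b \<in> car V" using that B(2) by auto
        have "tpure V W b w = tpure V W b (\<Sum>b'\<in>C. scl W (d b' w) b')" using C(3) vw(2) by simp
        also have "\<dots> = (\<Sum>b'\<in>C. tpure V W b (scl W (d b' w) b'))"
          by (rule linear_on_sum[OF r[OF b] assms(2)]) (use C(2) assms(2) in auto)
        finally show ?thesis using C(2) by (auto simp: linear_on_scl[OF r[OF b]] intro!: sum.cong)
      qed
      show ?thesis unfolding 1
        by (intro span_sum span_scale, subst 2, assumption, intro span_sum span_scale span_base) auto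
    qed
    then show "car (tensor V W) \<subseteq> module.span (scl (tensor V W)) ?F"
      unfolding car_tensor scl_tensor by (intro span_minimal) auto
  qed
qed

lemma fin_dim_hom:
  assumes "vspace V" "vspace W" "fin_dim V" "fin_dim W"
  shows "fin_dim (hom V W)"
proof -
  interpret vector_space "scl (hom V W)" by (rule vspace_vector_space[OF vspace_hom[OF assms(2)]])
  obtain B c where B: "finite B" "B \<subseteq> car V" "\<And>v. v \<in> car V \<Longrightarrow> (\<Sum>b\<in>B. scl V (c b v) b) = v"
    using fin_dim_basis[OF assms(1,3)] by metis
  obtain C d where C: "finite C" "C \<subseteq> car W" "\<And>w. w \<in> car W \<Longrightarrow> (\<Sum>b\<in>C. scl W (d b w) b) = w"
    using fin_dim_basis[OF assms(2,4)] by metis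
  \<comment> \<open>The elementary matrices, cut off outside the carrier as elements of the Hom
    space are. The scalars \<open>d b' (f b)\<close> are the matrix entries of
    \<open>f\<close>.\<close>
  let ?E = "\<lambda>(b, b') v. if v \<in> car V then scl W (c b v) b' else 0"
  let ?F = "?E ` (B \<times> C)"
  have sum_apply: "sum g I v = (\<Sum>i\<in>I. g i v)" for g :: "'i \<Rightarrow> 'b \<Rightarrow> 'd" and I v
    by (induction I rule: infinite_finite_induct) (auto simp: plus_fun_apply zero_fun_apply)
  show ?thesis
  proof (rule fin_dim_subset[OF vspace_hom[OF assms(2)]])
    show "finite ?F" using B(1) C(1) by simp
    show "car (hom V W) \<subseteq> span ?F"
    proof
      fix f assume f: "f \<in> car (hom V W)"
      have f_eq: "f = (\<Sum>(b, b')\<in>B \<times> C. scl (hom V W) (d b' (f b)) (?E (b, b')))"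
      proof
        fix v
        show "f v = (\<Sum>(b, b')\<in>B \<times> C. scl (hom V W) (d b' (f b)) (?E (b, b'))) v"
        proof (cases "v \<in> car V")
          case True
          have "f v = f (\<Sum>b\<in>B. scl V (c b v) b)" using B(3) True by simp
          also have "\<dots> = (\<Sum>b\<in>B. f (scl V (c b v) b))"
            by (rule linear_on_sum[OF hom_linear[OF f] assms(1)]) (use B(2) assms(1) in auto)
          also have "\<dots> = (\<Sum>b\<in>B. scl W (c b v) (\<Sum>b'\<in>C. scl W (d b' (f b)) b'))"
            using B(2) C(3) hom_linear[OF f]
            by (intro sum.cong refl) (auto simp: linear_on_scl linear_on_car subsetD)
          also have "\<dots> = (\<Sum>(b, b')\<in>B \<times> C. scl W (c b v) (scl W (d b' (f b)) b'))"
            by (simp add: scl_sum_right[OF assms(2)] sum.cartesian_product)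
          finally show ?thesis using True
            by (simp add: sum_apply case_prod_beta scl_scl[OF assms(2)] mult.commute)
        next
          case False
          then show ?thesis using f
            by (simp add: sum_apply case_prod_beta hom_outside assms(2))
        qed
      qed
      show "f \<in> span ?F"
        by (subst f_eq, rule span_sum) (force simp del: scl_hom intro!: span_scale[OF span_base])
    qed
  qed
qed

section \<open>Sweedler calculus in a finite-dimensional Hopf algebra\<close>

text \<open>A basis with coordinates belongs to the locale so that Sweedler expressions are finite
  sums: independent coproducts commute by exchanging sums, and linear maps pass inside.
  \<open>coord_basis\<close> makes the basis independent, which later turns injectivity of the
  antipode into surjectivity.\<close>

locale hopf =
  fixes H :: "('k::field, 'h::{ring,monoid_mult}) hopf"
    and basis :: "'h set"
    and e :: "'h \<Rightarrow> 'h \<Rightarrow> 'k"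
  assumes hopf: "fd_hopf_algebra H"
    and finite_basis: "finite basis"
    and coord_linear: "b \<in> basis \<Longrightarrow> linear_on H ground (e b)"
    and coord_expand: "(\<Sum>b\<in>basis. scl H (e b h) b) = h"
    and coord_basis: "a \<in> basis \<Longrightarrow> b \<in> basis \<Longrightarrow> e a b = (if a = b then 1 else 0)"
begin

abbreviation S :: "'h \<Rightarrow> 'h" where "S \<equiv> antipode H"
abbreviation eps :: "'h \<Rightarrow> 'k" where "eps \<equiv> counit H"
abbreviation sH :: "'k \<Rightarrow> 'h \<Rightarrow> 'h" where "sH \<equiv> scl H"

lemma vspace_H [simp]: "vspace H"
  and car_H [simp]: "car H = UNIV"
  and fin_dim_H: "fin_dim H"
  and mult_scl_left [simp]: "sH c x * y = sH c (x * y)"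
  and mult_scl_right [simp]: "x * sH c y = sH c (x * y)"
  and comul_linear: "linear_on H (tensor H H) (comul H)"
  and eps_linear: "linear_on H ground eps"
  and S_linear: "linear_on H H S"
  and comul_coassoc: "tassoc H H H (tmap H H (tensor H H) H (comul H) id (comul H h)) =
         tmap H H H (tensor H H) id (comul H) (comul H h)"
  and comul_eps_left: "tlift H H H (\<lambda>a b. sH (eps a) b) (comul H h) = h"
  and comul_eps_right: "tlift H H H (\<lambda>a b. sH (eps b) a) (comul H h) = h"
  and comul_one: "comul H 1 = tpure H H 1 1"
  and comul_mult: "comul H (g * h) = tmult H H (comul H g) (comul H h)"
  and eps_one [simp]: "eps 1 = 1"
  and eps_mult [simp]: "eps (g * h) = eps g * eps h"
  and comul_S_left: "tlift H H H (\<lambda>a b. S a * b) (comul H h) = sH (eps h) 1"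
  and comul_S_right: "tlift H H H (\<lambda>a b. a * S b) (comul H h) = sH (eps h) 1"
  using hopf by (simp_all add: fd_hopf_algebra_def fd_algebra_def)

lemma comul_car [simp]: "comul H h \<in> car (tensor H H)"
  using linear_on_car[OF comul_linear] by simp

text \<open>\<open>leg X t b\<close> is the second leg of \<open>t\<close> next to the basis vector \<open>b\<close>, that is,
  \<open>t = \<Sum>b. b \<otimes> leg X t b\<close>. For bilinear \<open>T\<close>, \<open>sw T h\<close> is \<open>T h\<^sub>(\<^sub>1\<^sub>) h\<^sub>(\<^sub>2\<^sub>)\<close>.\<close>

definition leg :: "('k, 'x::ab_group_add, 'm) vspace_scheme \<Rightarrow> ('k, 'h, 'x) tens \<Rightarrow> 'h \<Rightarrow> 'x" where
  "leg X t b = tlift H X X (\<lambda>h x. scl X (e b h) x) t"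

definition sw :: "('h \<Rightarrow> 'h \<Rightarrow> 'e::ab_group_add) \<Rightarrow> 'h \<Rightarrow> 'e" where
  "sw T h = (\<Sum>b\<in>basis. T b (leg H (comul H h) b))"

lemma leg_linear:
  assumes "vspace X" "b \<in> basis"
  shows "linear_on (tensor H X) X (\<lambda>t. leg X t b)"
  unfolding leg_def
  by (intro tlift_linear vspace_H assms bilinear_onI linear_on_scale linear_on_ident linear_on_coeff
      coord_linear)

lemma tlift_leg:
  assumes X: "vspace X" and E: "vspace E" and T: "bilinear_on H X E T"
    and t: "t \<in> car (tensor H X)"
  shows "tlift H X E T t = (\<Sum>b\<in>basis. T b (leg X t b))"
proof -
  have l: "leg X t b \<in> car X" if "b \<in> basis" for b
    using linear_on_car[OF leg_linear[OF X that] t] .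
  have "t = (\<Sum>b\<in>basis. tpure H X b (leg X t b))"
    unfolding leg_def
    by (intro tensor_expand vspace_H X t) (auto simp: coord_linear coord_expand)
  then have "tlift H X E T t = tlift H X E T (\<Sum>b\<in>basis. tpure H X b (leg X t b))" by simp
  also have "\<dots> = (\<Sum>b\<in>basis. tlift H X E T (tpure H X b (leg X t b)))"
    by (intro linear_on_sum[OF tlift_linear[OF vspace_H X E T]]) (auto intro!: tpure_car l)
  also have "\<dots> = (\<Sum>b\<in>basis. T b (leg X t b))"
    by (intro sum.cong refl tlift_pure[OF vspace_H X E T]) (auto intro: l)
  finally show ?thesis .
qed

text \<open>The bridge from the lifts of the definitions to \<open>sw\<close>. The sum
  \<open>sw T h\<close> makes sense for any \<open>T\<close>; for bilinear \<open>T\<close> it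
  agrees with the lift and so does not depend on the basis.\<close>

lemma tlift_comul:
  assumes "vspace E" "\<And>y. linear_on H E (\<lambda>x. T x y)" "\<And>x. linear_on H E (T x)"
  shows "tlift H H E T (comul H h) = sw T h"
  unfolding sw_def by (intro tlift_leg assms bilinear_onI) simp_all

lemma linear_leg_comul: "b \<in> basis \<Longrightarrow> linear_on H H (\<lambda>h. leg H (comul H h) b)"
  using linear_on_compose[OF comul_linear leg_linear[OF vspace_H]] .

lemma linear_sw_fun:
  assumes "\<And>p q. linear_on V E (\<lambda>x. T x p q)" "vspace E"
  shows "linear_on V E (\<lambda>x. sw (T x) h)"
  unfolding sw_def using assms by (intro linear_on_sum_fun)

lemma linear_sw_arg:
  assumes "linear_on V H f" "\<And>p. linear_on H E (T p)" "vspace E"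
  shows "linear_on V E (\<lambda>x. sw T (f x))"
  unfolding sw_def
  by (intro linear_on_sum_fun linear_on_compose[OF linear_on_compose[OF assms(1) linear_leg_comul]]
      assms)

lemma linear_mult_left:
  "linear_on V H f \<Longrightarrow> linear_on V H (\<lambda>x. c * f x)"
  by (simp add: linear_on_def distrib_left)

lemma linear_mult_right:
  "linear_on V H f \<Longrightarrow> linear_on V H (\<lambda>x. f x * c)"
  by (simp add: linear_on_def distrib_right)

lemma linear_S: "linear_on V H f \<Longrightarrow> linear_on V H (\<lambda>x. S (f x))"
  by (rule linear_on_compose[OF _ S_linear])

lemma linear_eps: "linear_on V H f \<Longrightarrow> linear_on V ground (\<lambda>x. eps (f x))"
  by (rule linear_on_compose[OF _ eps_linear])

lemma linear_coord: "b \<in> basis \<Longrightarrow> linear_on V H f \<Longrightarrow> linear_on V ground (\<lambda>x. e b (f x))"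
  by (rule linear_on_compose[OF _ coord_linear])

lemma linear_scalar: "linear_on V ground f \<Longrightarrow> linear_on V ground (\<lambda>x. c * f x)"
  "linear_on V ground f \<Longrightarrow> linear_on V ground (\<lambda>x. f x * c)"
  by (simp_all add: linear_on_def distrib_left distrib_right)

text \<open>These discharge the linearity conditions of the Sweedler identities, one slot at a
  time.\<close>

lemmas lin = linear_on_ident linear_sw_fun linear_sw_arg linear_mult_left linear_mult_right
  linear_S linear_eps linear_coord linear_scalar linear_on_scale linear_on_coeff linear_on_sum_fun

lemma sw_linear:
  assumes "linear_on E F f" "vspace E" "\<And>x y. T x y \<in> car E"
  shows "f (sw T h) = sw (\<lambda>x y. f (T x y)) h"
  unfolding sw_def by (rule linear_on_sum[OF assms(1,2)]) (rule assms(3))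

lemma sw_mult_left: "(c :: 'r::ring) * sw T h = sw (\<lambda>x y. c * T x y) h"
  by (simp add: sw_def sum_distrib_left)

lemma sw_scl: "vspace E \<Longrightarrow> scl E c (sw T h) = sw (\<lambda>x y. scl E c (T x y)) h"
  by (simp add: sw_def scl_sum_right)

lemma sw_sum: "(\<Sum>i\<in>I. sw (T i) h) = sw (\<lambda>x y. \<Sum>i\<in>I. T i x y) h"
  unfolding sw_def by (rule sum.swap)

lemma sw_swap: "sw (\<lambda>x y. sw (\<lambda>p q. T x y p q) h) g = sw (\<lambda>p q. sw (\<lambda>x y. T x y p q) g) h"
  unfolding sw_def by (rule sum.swap)

lemma sw_zero [simp]: "sw (\<lambda>x y. 0) h = 0"
  by (simp add: sw_def)

lemma sw_car: "vspace E \<Longrightarrow> (\<And>x y. T x y \<in> car E) \<Longrightarrow> sw T h \<in> car E"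
  unfolding sw_def by (intro vspace_sum)

text \<open>Coassociativity is an equation between nested tensors. Evaluated against a trilinear
  \<open>T\<close> with values in any space \<open>E\<close>, it can be applied inside larger
  expressions.\<close>

lemma sw_coassoc:
  assumes E: "vspace E"
    and T: "\<And>q r. linear_on H E (\<lambda>p. T p q r)" "\<And>p r. linear_on H E (\<lambda>q. T p q r)"
      "\<And>p q. linear_on H E (\<lambda>r. T p q r)"
  shows "sw (\<lambda>x r. sw (\<lambda>p q. T p q r) x) h = sw (\<lambda>p y. sw (\<lambda>q r. T p q r) y) h"
proof -
  have "sw (\<lambda>x r. sw (\<lambda>p q. T p q r) x) h =
      tlift H H E (\<lambda>x r. tlift H H E (\<lambda>p q. T p q r) (comul H x)) (comul H h)"
    by (simp add: tlift_comul E T lin)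
  also have "\<dots> = tlift H H E (\<lambda>p y. tlift H H E (T p) (comul H y)) (comul H h)"
    unfolding tlift_tassoc_comul[OF vspace_H vspace_H E T comul_car comul_linear, symmetric]
      tlift_tmap_coact[OF vspace_H vspace_H E T comul_car comul_linear, symmetric] comul_coassoc ..
  also have "\<dots> = sw (\<lambda>p y. sw (\<lambda>q r. T p q r) y) h"
    by (simp add: tlift_comul E T lin)
  finally show ?thesis .
qed

lemma linear_sw_comul:
  assumes "linear_on H E f" "vspace E" "\<And>y. linear_on H H (\<lambda>x. T x y)" "\<And>x. linear_on H H (T x)"
  shows "f (tlift H H H T (comul H h)) = sw (\<lambda>x y. f (T x y)) h"
  using assms sw_linear[OF assms(1) vspace_H] by (simp add: tlift_comul)

text \<open>The map \<open>f\<close> plays the part of the surrounding expression: the counit and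
  antipode laws are applied to legs that stand somewhere inside a linear context.\<close>

lemma
  assumes "linear_on H E f" "vspace E"
  shows sw_eps_left: "sw (\<lambda>x y. scl E (eps x) (f y)) h = f h"
    and sw_eps_right: "sw (\<lambda>x y. scl E (eps y) (f x)) h = f h"
    and sw_S_left: "sw (\<lambda>x y. f (S x * y)) h = scl E (eps h) (f 1)"
    and sw_S_right: "sw (\<lambda>x y. f (x * S y)) h = scl E (eps h) (f 1)"
proof -
  note * = linear_sw_comul[OF assms]
  show "sw (\<lambda>x y. scl E (eps x) (f y)) h = f h" "sw (\<lambda>x y. scl E (eps y) (f x)) h = f h"
    "sw (\<lambda>x y. f (S x * y)) h = scl E (eps h) (f 1)" "sw (\<lambda>x y. f (x * S y)) h = scl E (eps h) (f 1)"
    using *[of "\<lambda>a b. sH (eps a) b" h] *[of "\<lambda>a b. sH (eps b) a" h]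
      *[of "\<lambda>a b. S a * b" h] *[of "\<lambda>a b. a * S b" h]
    by (simp_all add: comul_eps_left comul_eps_right comul_S_left comul_S_right lin
        linear_on_scl[OF assms(1)])
qed

lemma sw_one:
  assumes "vspace E" "\<And>y. linear_on H E (\<lambda>x. T x y)" "\<And>x. linear_on H E (T x)"
  shows "sw T 1 = T 1 1"
  unfolding tlift_comul[OF assms, symmetric] comul_one
  by (rule tlift_pure) (auto intro: bilinear_onI assms)

lemma sw_mult:
  assumes E: "vspace E" and T: "\<And>y. linear_on H E (\<lambda>x. T x y)" "\<And>x. linear_on H E (T x)"
  shows "sw T (g * h) = sw (\<lambda>a b. sw (\<lambda>a' b'. T (a * a') (b * b')) h) g"
proof -
  have b: "bilinear_on H H E T" by (intro bilinear_onI T)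
  have r: "linear_on H (tensor H H) (\<lambda>b. tpure H H a b)" "linear_on H (tensor H H) (\<lambda>a. tpure H H a b)"
    for a b :: 'h
    using bilinear_on_right[OF bilinear_tpure[of H H]] bilinear_on_left[OF bilinear_tpure[of H H]]
    by auto
  have l: "linear_on H (tensor H H) (\<lambda>b. tpure H H (x * a) (y * b))"
    "linear_on H (tensor H H) (\<lambda>b. tpure H H (a * x) (b * y))"
    "linear_on H (tensor H H) (\<lambda>a. tpure H H (x * a) (y * b))"
    "linear_on H (tensor H H) (\<lambda>a. tpure H H (a * x) (b * y))"
    for a b x y
    by (rule linear_on_compose[OF _ r(1)] linear_on_compose[OF _ r(2)]; simp add: lin)+
  note L = tlift_linear[OF vspace_H vspace_H E b]
  have "comul H (g * h) = sw (\<lambda>a b. sw (\<lambda>a' b'. tpure H H (a * a') (b * b')) h) g"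
    unfolding comul_mult tmult_def by (simp add: tlift_comul lin l)
  then have "sw T (g * h) = tlift H H E T (sw (\<lambda>a b. sw (\<lambda>a' b'. tpure H H (a * a') (b * b')) h) g)"
    using tlift_comul[OF E T, of "g * h"] by simp
  also have "\<dots> = sw (\<lambda>a b. sw (\<lambda>a' b'. tlift H H E T (tpure H H (a * a') (b * b'))) h) g"
    by (simp add: sw_linear[OF L] sw_car tpure_car)
  also have "\<dots> = sw (\<lambda>a b. sw (\<lambda>a' b'. T (a * a') (b * b')) h) g"
    by (simp add: tlift_pure[OF vspace_H vspace_H E b])
  finally show ?thesis .
qed

end

section \<open>The antipode is bijective\<close>

context hopf
begin

section \<open>The antipode reverses products\<close>

lemma eps_S [simp]: "eps (S h) = eps h"
proof -
  have "eps h = eps (sw (\<lambda>x y. S x * y) h)"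
    using sw_S_left[OF linear_on_ident vspace_H, of h] by (simp add: linear_on_scl[OF eps_linear])
  also have "\<dots> = sw (\<lambda>x y. eps y * eps (S x)) h"
    by (subst sw_linear[OF eps_linear]) (simp_all add: mult.commute)
  also have "\<dots> = eps (S h)"
    using sw_eps_right[of ground "\<lambda>x. eps (S x)" h] by (simp add: lin)
  finally show ?thesis ..
qed

lemma S_one [simp]: "S 1 = 1"
  using sw_S_left[OF linear_on_ident vspace_H, of 1] sw_one[of H "\<lambda>x y. S x * y"]
  by (simp add: lin)

text \<open>After inserting \<open>S g\<^sub>1 * g\<^sub>2\<close> in front, the legs
  \<open>g\<^sub>2\<close> and \<open>g\<^sub>3\<close> join those of \<open>h\<close> to the
  coproduct of a product, on which the antipode law leaves a counit.\<close>

lemma S_mult_aux: "sw (\<lambda>x y. x * S (g * y)) h = sH (eps h) (S g)"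
proof -
  \<comment> \<open>The argument \<open>z\<close> holds the place of the factor to be inserted;
    \<open>z = 1\<close> is the left-hand side of the claim.\<close>
  let ?F = "\<lambda>z g. sw (\<lambda>x y. (z * x) * S (g * y)) h"
  have "?F 1 g = sw (\<lambda>g' g\<^sub>3. sH (eps g') (?F 1 g\<^sub>3)) g"
    by (rule sw_eps_left[symmetric]) (simp_all add: lin)
  also have "\<dots> = sw (\<lambda>g' g\<^sub>3. sw (\<lambda>g\<^sub>1 g\<^sub>2. ?F (S g\<^sub>1 * g\<^sub>2) g\<^sub>3) g') g"
    by (subst sw_S_left) (simp_all add: lin)
  also have "\<dots> = sw (\<lambda>g\<^sub>1 g'. sw (\<lambda>g\<^sub>2 g\<^sub>3. ?F (S g\<^sub>1 * g\<^sub>2) g\<^sub>3) g') g"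
    by (rule sw_coassoc[of H]) (simp_all add: lin)
  also have "\<dots> = sw (\<lambda>g\<^sub>1 g'. S g\<^sub>1 * sw (\<lambda>x y. x * S y) (g' * h)) g"
    by (subst sw_mult[of H]) (simp_all add: lin sw_mult_left mult.assoc)
  also have "\<dots> = sw (\<lambda>g\<^sub>1 g'. sH (eps g') (sH (eps h) (S g\<^sub>1))) g"
    using sw_S_right[OF linear_on_ident vspace_H] by (simp add: scl_scl[OF vspace_H])
  also have "\<dots> = sH (eps h) (S g)"
    by (rule sw_eps_right) (simp_all add: lin)
  finally show ?thesis by simp
qed

text \<open>The same insertion, now of \<open>S h\<^sub>1 * h\<^sub>2\<close>; then
  \<open>S_mult_aux\<close> removes \<open>h\<^sub>2\<close> and \<open>h\<^sub>3\<close>.\<close>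

lemma S_mult: "S (g * h) = S h * S g"
proof -
  have "S (g * h) = sw (\<lambda>h' h\<^sub>3. sH (eps h') (S (g * h\<^sub>3))) h"
    by (rule sw_eps_left[symmetric]) (simp_all add: lin)
  also have "\<dots> = sw (\<lambda>h' h\<^sub>3. sw (\<lambda>h\<^sub>1 h\<^sub>2. S h\<^sub>1 * h\<^sub>2 * S (g * h\<^sub>3)) h') h"
    using sw_S_left[of H "\<lambda>x. x * S (g * y)" for y] by (simp add: lin)
  also have "\<dots> = sw (\<lambda>h\<^sub>1 h'. sw (\<lambda>h\<^sub>2 h\<^sub>3. S h\<^sub>1 * h\<^sub>2 * S (g * h\<^sub>3)) h') h"
    by (rule sw_coassoc[of H]) (simp_all add: lin)
  also have "\<dots> = sw (\<lambda>h\<^sub>1 h'. S h\<^sub>1 * sH (eps h') (S g)) h"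
    by (simp add: sw_mult_left S_mult_aux[symmetric] mult.assoc del: mult_scl_right)
  also have "\<dots> = sw (\<lambda>h\<^sub>1 h'. sH (eps h') (S h\<^sub>1 * S g)) h" by simp
  also have "\<dots> = S h * S g"
    by (rule sw_eps_right) (simp_all add: lin)
  finally show ?thesis .
qed

section \<open>Left integrals from traces\<close>

text \<open>The element \<open>\<Sum>\<^sub>i e\<^sub>i(S\<^sup>2(i\<^sub>(\<^sub>2\<^sub>)) x) i\<^sub>(\<^sub>1\<^sub>)\<close>, a trace over \<open>H\<close>. It is a left integral because
  traces are cyclic.\<close>

definition trace_integral :: "'h \<Rightarrow> 'h" where
  "trace_integral x = (\<Sum>i\<in>basis. sw (\<lambda>a b. sH (e i (S (S b) * x)) a) i)"

text \<open>Replace \<open>y * a\<close> by \<open>y\<^sub>1 * a\<close> with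
  \<open>S (S y\<^sub>2 * y\<^sub>3)\<close> inserted under the trace. By \<open>S_mult\<close> this
  factor is \<open>S y\<^sub>3 * S (S y\<^sub>2)\<close>; its second half joins
  \<open>S (S b)\<close>, so that \<open>y\<^sub>1\<close> and \<open>y\<^sub>2\<close> multiply
  \<open>i\<close> as one coproduct. Cyclicity brings \<open>S y\<^sub>3\<close> behind
  \<open>y'\<close>, where the antipode law applies.\<close>

lemma trace_integral_left: "y * trace_integral x = sH (eps y) (trace_integral x)"
proof -
  \<comment> \<open>Summed over \<open>i\<close> at \<open>v = w * i\<close>, this is a partial
    trace: left multiplication by \<open>w\<close>, then the coproduct with
    \<open>S (S b) * x\<close> as second leg, then left multiplication by \<open>u\<close> on that
    leg, traced over it.\<close>
  define \<Psi> where "\<Psi> i u v = sw (\<lambda>a b. sH (e i (u * (S (S b) * x))) a) v" for i u v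
  have lin\<Psi>: "linear_on H H (\<lambda>v. \<Psi> i u (g v))" if "i \<in> basis" "linear_on H H g" for i u g
    unfolding \<Psi>_def by (rule linear_sw_arg[OF that(2)]) (simp_all add: lin that(1))
  \<comment> \<open>Cyclicity in coordinates: the matrix entries \<open>e i (u * j)\<close> of left
    multiplication by \<open>u\<close> pass from the outgoing leg to the incoming vector.\<close>
  have cyclic: "(\<Sum>i\<in>basis. \<Psi> i u (w * i)) = (\<Sum>i\<in>basis. \<Psi> i 1 (w * u * i))" for u w
  proof -
    have e: "e i (u * g) = (\<Sum>j\<in>basis. e i (u * j) * e j g)" if "i \<in> basis" for i g
    proof -
      have "e i (u * g) = e i (u * (\<Sum>j\<in>basis. sH (e j g) j))" by (simp add: coord_expand)
      also have "\<dots> = (\<Sum>j\<in>basis. e i (sH (e j g) (u * j)))"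
        by (simp add: sum_distrib_left linear_on_sum[OF coord_linear[OF that] vspace_H])
      finally show ?thesis using linear_on_scl[OF coord_linear[OF that]] by (simp add: mult.commute)
    qed
    have "\<Psi> i u v = (\<Sum>j\<in>basis. sH (e i (u * j)) (\<Psi> j 1 v))" if i: "i \<in> basis" for i v
    proof -
      have "\<Psi> i u v = sw (\<lambda>a b. \<Sum>j\<in>basis. sH (e i (u * j)) (sH (e j (S (S b) * x)) a)) v"
        unfolding \<Psi>_def
        by (subst e[OF i]) (simp only: scl_sum_left[OF vspace_H] scl_scl[OF vspace_H])
      then show ?thesis by (simp only: \<Psi>_def sw_sum sw_scl[OF vspace_H] mult_1_left)
    qed
    then have "(\<Sum>i\<in>basis. \<Psi> i u (w * i)) = (\<Sum>i\<in>basis. \<Sum>j\<in>basis. sH (e i (u * j)) (\<Psi> j 1 (w * i)))"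
      by simp
    also have "\<dots> = (\<Sum>j\<in>basis. \<Sum>i\<in>basis. \<Psi> j 1 (w * sH (e i (u * j)) i))"
      by (subst sum.swap, intro sum.cong refl)
        (simp add: linear_on_scl[OF lin\<Psi>[OF _ linear_on_ident]])
    also have "\<dots> = (\<Sum>j\<in>basis. \<Psi> j 1 (w * (\<Sum>i\<in>basis. sH (e i (u * j)) i)))"
      by (intro sum.cong refl, unfold sum_distrib_left)
        (rule linear_on_sum[OF lin\<Psi>[OF _ linear_on_ident], symmetric]; simp)
    finally show ?thesis by (simp add: coord_expand mult.assoc)
  qed
  have L: "trace_integral x = (\<Sum>i\<in>basis. \<Psi> i 1 i)" by (simp add: trace_integral_def \<Psi>_def)
  have *: "y * \<Psi> i 1 i = sw (\<lambda>y' y\<^sub>3. \<Psi> i (S y\<^sub>3) (y' * i)) y" if i: "i \<in> basis" for i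
  proof -
    have "sH (e i (S (S b) * x)) (y * a) =
      sw (\<lambda>y' y\<^sub>3. sw (\<lambda>y\<^sub>1 y\<^sub>2. sH (e i (S y\<^sub>3 * (S (S (y\<^sub>2 * b)) * x))) (y\<^sub>1 * a)) y') y" for a b
    proof -
      have "sH (e i (S (S b) * x)) (y * a) = sw (\<lambda>y\<^sub>1 y'. sH (eps y') (sH (e i (S (S b) * x)) (y\<^sub>1 * a))) y"
        by (rule sw_eps_right[symmetric]) (simp_all add: lin i)
      also have "\<dots> = sw (\<lambda>y\<^sub>1 y'. sw (\<lambda>y\<^sub>2 y\<^sub>3. sH (e i (S (S y\<^sub>2 * y\<^sub>3) * (S (S b) * x))) (y\<^sub>1 * a)) y') y"
        using sw_S_left[of H "\<lambda>z. sH (e i (S z * (S (S b) * x))) (y\<^sub>1 * a)" for y\<^sub>1]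
        by (simp add: lin i)
      also have "\<dots> = sw (\<lambda>y' y\<^sub>3. sw (\<lambda>y\<^sub>1 y\<^sub>2. sH (e i (S (S y\<^sub>2 * y\<^sub>3) * (S (S b) * x))) (y\<^sub>1 * a)) y') y"
        by (rule sw_coassoc[of H, symmetric]) (simp_all add: lin i)
      finally show ?thesis by (simp add: S_mult mult.assoc)
    qed
    then have "y * \<Psi> i 1 i = sw (\<lambda>a b. sw (\<lambda>y' y\<^sub>3. sw (\<lambda>y\<^sub>1 y\<^sub>2.
        sH (e i (S y\<^sub>3 * (S (S (y\<^sub>2 * b)) * x))) (y\<^sub>1 * a)) y') y) i"
      by (simp add: \<Psi>_def sw_mult_left)
    also have "\<dots> = sw (\<lambda>y' y\<^sub>3. sw (\<lambda>y\<^sub>1 y\<^sub>2. sw (\<lambda>a b.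
        sH (e i (S y\<^sub>3 * (S (S (y\<^sub>2 * b)) * x))) (y\<^sub>1 * a)) i) y') y"
      by (simp only: sw_swap[where g = i])
    also have "\<dots> = sw (\<lambda>y' y\<^sub>3. \<Psi> i (S y\<^sub>3) (y' * i)) y"
      unfolding \<Psi>_def by (subst sw_mult[of H]) (simp_all add: lin i)
    finally show ?thesis .
  qed
  have "y * trace_integral x = sw (\<lambda>y' y\<^sub>3. \<Sum>i\<in>basis. \<Psi> i (S y\<^sub>3) (y' * i)) y"
    by (simp add: L sum_distrib_left * sw_sum)
  also have "\<dots> = sw (\<lambda>y' y\<^sub>3. \<Sum>i\<in>basis. \<Psi> i 1 (y' * S y\<^sub>3 * i)) y"
    by (intro arg_cong[where f = "\<lambda>T. sw T y"] ext cyclic)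
  also have "\<dots> = sH (eps y) (\<Sum>i\<in>basis. \<Psi> i 1 (1 * i))"
    by (rule sw_S_right[of H "\<lambda>z. \<Sum>i\<in>basis. \<Psi> i 1 (z * i)"])
      (simp_all add: linear_on_sum_fun lin\<Psi> lin)
  finally show ?thesis by (simp add: L)
qed

text \<open>This shows that not all integrals vanish when \<open>1\<close> is nonzero. Summation
  over \<open>j\<close> turns \<open>S j\<close> into \<open>S b\<close>; then
  \<open>S (S b') * S b = S (b * S b')\<close> falls under the antipode law, and what remains is the
  expansion of \<open>1\<close> in the basis.\<close>

lemma trace_integral_contract:
  "(\<Sum>j\<in>basis. sw (\<lambda>a b. sH (e j b) a) (trace_integral (S j))) = 1"
proof -
  have "(\<Sum>j\<in>basis. sw (\<lambda>a b. sH (e j b) a) (trace_integral (S j))) =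
    (\<Sum>j\<in>basis. \<Sum>i\<in>basis. sw (\<lambda>a' b'. sH (e i (S (S b') * S j)) (sw (\<lambda>a b. sH (e j b) a) a')) i)"
  proof (intro sum.cong refl)
    fix j assume j: "j \<in> basis"
    let ?g = "\<lambda>z. sw (\<lambda>a b. sH (e j b) a) z"
    have g: "linear_on H H ?g" by (simp add: lin j)
    show "?g (trace_integral (S j)) =
      (\<Sum>i\<in>basis. sw (\<lambda>a' b'. sH (e i (S (S b') * S j)) (?g a')) i)"
      unfolding trace_integral_def
      by (simp add: linear_on_sum[OF g vspace_H] sw_linear[OF g vspace_H] linear_on_scl[OF g])
  qed
  also have "\<dots> = (\<Sum>i\<in>basis. sw (\<lambda>a' b'. sw (\<lambda>a b. sH (\<Sum>j\<in>basis. e i (S (S b') * S j) * e j b) a) a') i)"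
    by (subst sum.swap) (simp add: sw_sum sw_scl scl_scl scl_sum_left)
  also have "\<dots> = (\<Sum>i\<in>basis. sw (\<lambda>a' b'. sw (\<lambda>a b. sH (e i (S (b * S b'))) a) a') i)"
  proof -
    have "(\<Sum>j\<in>basis. e i (S (S b') * S j) * e j b) = e i (S (b * S b'))" if i: "i \<in> basis" for i b' b
    proof -
      have l: "linear_on H ground (\<lambda>z. e i (S (S b') * S z))" by (simp add: lin i)
      have "e i (S (S b') * S b) = e i (S (S b') * S (\<Sum>j\<in>basis. sH (e j b) j))"
        by (simp add: coord_expand)
      also have "\<dots> = (\<Sum>j\<in>basis. e i (S (S b') * S (sH (e j b) j)))"
        by (rule linear_on_sum[OF l vspace_H]) simp
      also have "\<dots> = (\<Sum>j\<in>basis. e i (S (S b') * S j) * e j b)"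
        using linear_on_scl[OF l] by (intro sum.cong refl) (simp add: mult.commute)
      finally show ?thesis by (simp add: S_mult)
    qed
    then show ?thesis by simp
  qed
  also have "\<dots> = (\<Sum>i\<in>basis. sw (\<lambda>a y. sw (\<lambda>b b'. sH (e i (S (b * S b'))) a) y) i)"
    by (intro sum.cong refl sw_coassoc[of H]) (simp_all add: lin)
  also have "\<dots> = (\<Sum>i\<in>basis. sw (\<lambda>a y. sH (eps y) (sH (e i 1) a)) i)"
    using sw_S_right[of H "\<lambda>z. sH (e i (S z)) a" for i a] by (simp add: lin)
  also have "\<dots> = (\<Sum>i\<in>basis. sH (e i 1) i)"
    by (intro sum.cong refl sw_eps_right) (simp_all add: lin)
  finally show ?thesis by (simp add: coord_expand)
qed

section \<open>Injectivity and bijectivity of the antipode\<close>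

text \<open>Padding the first leg with \<open>S g\<^sub>1 * g\<^sub>2\<close> lets
  \<open>g\<^sub>2\<close> and \<open>g\<^sub>3\<close> act on \<open>L\<close> through one
  coproduct, and the integral property leaves a counit. The functional \<open>f\<close> reads off
  the first leg, so that an equation of tensors becomes one in \<open>H\<close>.\<close>

lemma integral_transfer:
  assumes L: "\<And>y. y * L = sH (eps y) L" and f: "linear_on H ground f"
  shows "sw (\<lambda>a b. sH (f a) (g * b)) L = sw (\<lambda>a b. sH (f (S g * a)) b) L"
proof -
  note lin' = lin linear_on_compose[OF _ f]
  have "sw (\<lambda>a b. sH (f a) (g * b)) L =
      sw (\<lambda>a b. sw (\<lambda>g' g\<^sub>3. sH (eps g') (sH (f a) (g\<^sub>3 * b))) g) L"
    by (subst sw_eps_left) (simp_all add: lin)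
  also have "\<dots> = sw (\<lambda>a b. sw (\<lambda>g' g\<^sub>3. sw (\<lambda>g\<^sub>1 g\<^sub>2. sH (f (S g\<^sub>1 * g\<^sub>2 * a)) (g\<^sub>3 * b)) g') g) L"
    using sw_S_left[of H "\<lambda>z. sH (f (z * a)) c" for a c] by (simp add: lin')
  also have "\<dots> = sw (\<lambda>a b. sw (\<lambda>g\<^sub>1 g'. sw (\<lambda>g\<^sub>2 g\<^sub>3. sH (f (S g\<^sub>1 * g\<^sub>2 * a)) (g\<^sub>3 * b)) g') g) L"
    by (subst sw_coassoc[of H]) (simp_all add: lin')
  also have "\<dots> = sw (\<lambda>g\<^sub>1 g'. sw (\<lambda>g\<^sub>2 g\<^sub>3. sw (\<lambda>a b. sH (f (S g\<^sub>1 * (g\<^sub>2 * a))) (g\<^sub>3 * b)) L) g') g"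
    by (simp only: sw_swap[where g = L] mult.assoc)
  also have "\<dots> = sw (\<lambda>g\<^sub>1 g'. sw (\<lambda>a b. sH (f (S g\<^sub>1 * a)) b) (g' * L)) g"
    by (subst sw_mult[of H]) (simp_all add: lin')
  also have "\<dots> = sw (\<lambda>g\<^sub>1 g'. sH (eps g') (sw (\<lambda>a b. sH (f (S g\<^sub>1 * a)) b) L)) g"
  proof -
    have "linear_on H H (\<lambda>z. sw (\<lambda>a b. sH (f (S g\<^sub>1 * a)) b) z)" for g\<^sub>1 by (simp add: lin')
    from linear_on_scl[OF this] show ?thesis by (simp add: L)
  qed
  also have "\<dots> = sw (\<lambda>a b. sH (f (S g * a)) b) L"
    by (rule sw_eps_right) (simp_all add: lin')
  finally show ?thesis .
qed

text \<open>For a left integral \<open>L\<close>, \<open>e(L) h = e(L\<^sub>(\<^sub>1\<^sub>)) h S(L\<^sub>(\<^sub>2\<^sub>)) L\<^sub>(\<^sub>3\<^sub>)\<close>, and \<open>integral_transfer\<close> turns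
  left multiplication by \<open>h S(x)\<close> on the last leg into a factor \<open>S(h S(x)) = S(S(x)) S(h)\<close>.\<close>

lemma S_eq_0_D:
  assumes "S h = 0"
  shows "h = 0"
proof (cases "\<exists>x. trace_integral x \<noteq> 0")
  case False
  \<comment> \<open>If all these integrals vanish, the contraction gives \<open>1 = 0\<close>: this
    is the zero algebra, which the sort admits.\<close>
  have "sw (\<lambda>a b. sH (e j b) a) 0 = 0" if "j \<in> basis" for j
    by (rule linear_on_0[of H H]) (simp_all add: lin that)
  with trace_integral_contract False have "(1 :: 'h) = 0" by simp
  then have "1 * h = 0 * h" by (simp only:)
  then show ?thesis by simp
next
  case True
  then obtain x where x: "trace_integral x \<noteq> 0" ..
  define L where "L = trace_integral x"
  have L: "y * L = sH (eps y) L" for y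
    unfolding L_def by (rule trace_integral_left)
  \<comment> \<open>It suffices that every coordinate of \<open>L\<close> annihilates
    \<open>h\<close>, since \<open>L\<close> has a nonzero coordinate to divide by.\<close>
  have z: "sH (e k L) h = 0" if k: "k \<in> basis" for k
  proof -
    have "sH (e k L) h = sw (\<lambda>a c. sH (eps c) (sH (e k a) h)) L"
      by (rule sw_eps_right[symmetric]) (simp_all add: lin k)
    also have "\<dots> = sw (\<lambda>a c. sw (\<lambda>b d. sH (e k a) (h * (S b * d))) c) L"
      using sw_S_left[of H "\<lambda>z. sH (e k a) (h * z)" for a] by (simp add: lin)
    also have "\<dots> = sw (\<lambda>c d. sw (\<lambda>a b. sH (e k a) (h * (S b * d))) c) L"
      by (rule sw_coassoc[of H, symmetric]) (simp_all add: lin k)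
    \<comment> \<open>\<open>integral_transfer\<close> moves a fixed factor, whereas
      \<open>h * S b\<close> varies with the leg \<open>b\<close>. Expanding \<open>b\<close> in the
      basis replaces it by the fixed \<open>h * S i\<close>.\<close>
    also have "\<dots> = sw (\<lambda>c d. sw (\<lambda>a b. \<Sum>i\<in>basis. sH (e k a * e i b) (h * (S i * d))) c) L"
    proof -
      have "sH (e k a) (h * (S b * d)) = (\<Sum>i\<in>basis. sH (e k a * e i b) (h * (S i * d)))" for a b d
      proof -
        have l: "linear_on H H (\<lambda>z. sH (e k a) (h * (S z * d)))" by (simp add: lin)
        have "sH (e k a) (h * (S b * d)) = sH (e k a) (h * (S (\<Sum>i\<in>basis. sH (e i b) i) * d))"
          by (simp add: coord_expand)
        also have "\<dots> = (\<Sum>i\<in>basis. sH (e k a) (h * (S (sH (e i b) i) * d)))"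
          by (rule linear_on_sum[OF l vspace_H]) simp
        also have "\<dots> = (\<Sum>i\<in>basis. sH (e k a * e i b) (h * (S i * d)))"
          using linear_on_scl[OF l] by (intro sum.cong refl) (simp add: scl_scl mult.commute)
        finally show ?thesis .
      qed
      then show ?thesis by simp
    qed
    also have "\<dots> = (\<Sum>i\<in>basis. sw (\<lambda>c d. sH (sw (\<lambda>a b. e k a * e i b) c) ((h * S i) * d)) L)"
    proof -
      have "sw (\<lambda>a b. sH (e k a * e i b) z) c = sH (sw (\<lambda>a b. e k a * e i b) c) z" for i z c
        by (simp add: sw_def scl_sum_left)
      then show ?thesis by (simp add: sw_sum[symmetric] mult.assoc)
    qed
    also have "\<dots> = (\<Sum>i\<in>basis. sw (\<lambda>c d. sH (sw (\<lambda>a b. e k a * e i b) (S (h * S i) * c)) d) L)"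
      by (intro sum.cong refl integral_transfer L) (simp add: lin k)
    \<comment> \<open>By \<open>S_mult\<close>, \<open>S (h * S i)\<close> has the factor
      \<open>S h\<close>, which is zero.\<close>
    also have "\<dots> = 0"
    proof -
      have "sw (\<lambda>a b. e k a * e i b) 0 = 0" if "i \<in> basis" for i
        by (rule linear_on_0[of H ground]) (simp_all add: lin k that)
      then show ?thesis by (simp add: S_mult assms)
    qed
    finally show ?thesis .
  qed
  obtain k where k: "k \<in> basis" "e k L \<noteq> 0"
  proof (rule ccontr)
    assume "\<not> thesis"
    with that have "\<And>b. b \<in> basis \<Longrightarrow> e b L = 0" by blast
    then have "L = 0" using coord_expand[of L] by simp
    with x show False by (simp add: L_def)
  qed
  have "h = sH (inverse (e k L)) (sH (e k L) h)" using k(2) by (simp add: scl_scl)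
  then show ?thesis using z[OF k(1)] by simp
qed

text \<open>An injective endomorphism of a finite-dimensional space is onto; the coordinate
  functionals certify that \<open>basis\<close> is independent.\<close>

lemma bij_S: "bij S"
proof -
  interpret vector_space sH by (rule vspace_vector_space[OF vspace_H])
  have "h \<in> span basis" for h
    by (subst coord_expand[of h, symmetric]) (intro span_sum span_scale span_base)
  then have sp: "span basis = UNIV" by blast
  have "independent basis"
  proof (rule notI)
    assume "dependent basis"
    then obtain u v where u: "v \<in> basis" "u v \<noteq> 0" "(\<Sum>b\<in>basis. sH (u b) b) = 0"
      using finite_basis by (auto simp: dependent_finite)
    have "0 = e v (\<Sum>b\<in>basis. sH (u b) b)"
      using u linear_on_0[OF coord_linear vspace_H] by simp
    also have "\<dots> = (\<Sum>b\<in>basis. u b * e v b)"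
      using linear_on_scl[OF coord_linear] by (simp add: linear_on_sum[OF coord_linear vspace_H] u(1))
    also have "\<dots> = u v" using u(1) finite_basis by (simp add: coord_basis if_distrib cong: if_cong)
    finally show False using u(2) by simp
  qed
  then interpret finite_dimensional_vector_space sH basis
    by unfold_locales (simp_all add: finite_basis sp)
  have lin_S: "Vector_Spaces.linear sH sH S"
    using S_linear by (unfold_locales) (auto simp: linear_on_def)
  have "inj S"
  proof (rule injI)
    fix x y assume "S x = S y"
    then have "S (x - y) = 0"
      using linear_on_add[OF S_linear, of "x - y" y] by simp
    then show "x = y" using S_eq_0_D by fastforce
  qed
  with lin_S show ?thesis
    by (simp add: bij_def linear_inj_imp_surj)
qed

end

section \<open>The inverse antipode\<close>

context hopf
begin

abbreviation Si :: "'h \<Rightarrow> 'h" where "Si \<equiv> inv S"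

lemma S_Si [simp]: "S (Si h) = h"
  using bij_S by (simp add: bij_is_surj surj_f_inv_f)

lemma S_inj: "S x = S y \<Longrightarrow> x = y"
  using bij_S by (simp add: bij_is_inj inj_eq)

lemma Si_linear: "linear_on H H Si"
proof (rule linear_onI)
  show "Si (x + y) = Si x + Si y" for x y
    by (rule S_inj) (simp add: linear_on_add[OF S_linear])
  show "Si (sH c x) = sH c (Si x)" for c x
    by (rule S_inj) (simp add: linear_on_scl[OF S_linear])
qed simp

lemma linear_Si: "linear_on V H f \<Longrightarrow> linear_on V H (\<lambda>x. Si (f x))"
  by (rule linear_on_compose[OF _ Si_linear])

lemma eps_Si [simp]: "eps (Si h) = eps h"
  using eps_S[of "Si h"] by simp

text \<open>Applying \<open>S\<close> reverses the products and reduces both laws to those of the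
  antipode. Hence \<open>Si\<close> meets the legs in the opposite order.\<close>

lemma
  assumes "linear_on H E f" "vspace E"
  shows sw_Si_left: "sw (\<lambda>x y. f (Si y * x)) h = scl E (eps h) (f 1)"
    and sw_Si_right: "sw (\<lambda>x y. f (y * Si x)) h = scl E (eps h) (f 1)"
proof -
  have "sw (\<lambda>x y. Si y * x) h = sH (eps h) 1"
    by (rule S_inj) (simp add: sw_S_left[OF linear_on_ident vspace_H] sw_linear[OF S_linear] linear_on_scl[OF S_linear] S_mult)
  moreover have "sw (\<lambda>x y. y * Si x) h = sH (eps h) 1"
    by (rule S_inj) (simp add: sw_S_right[OF linear_on_ident vspace_H] sw_linear[OF S_linear] linear_on_scl[OF S_linear] S_mult)
  ultimately show "sw (\<lambda>x y. f (Si y * x)) h = scl E (eps h) (f 1)"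
    "sw (\<lambda>x y. f (y * Si x)) h = scl E (eps h) (f 1)"
    by (simp_all add: sw_linear[OF assms(1), symmetric] linear_on_scl[OF assms(1)])
qed

text \<open>This identity replaces \<open>\<Delta>(S\<^sup>-\<^sup>1(h)) = S\<^sup>-\<^sup>1(h\<^sub>(\<^sub>2\<^sub>)) \<otimes> S\<^sup>-\<^sup>1(h\<^sub>(\<^sub>1\<^sub>))\<close>.\<close>

lemma sw_Si_mult:
  assumes E: "vspace E" and T: "\<And>y. linear_on H E (\<lambda>x. T x y)" "\<And>x. linear_on H E (T x)"
  shows "sw (\<lambda>h\<^sub>1 h\<^sub>2. sw (\<lambda>a b. T (h\<^sub>2 * a) b) (Si h\<^sub>1 * c)) h = sw (\<lambda>a b. T a (Si h * b)) c"
proof -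
  have T1: "linear_on V E (\<lambda>x. T (f x) y)" if "linear_on V H f" for V :: "('k, 'h) hopf" and f y
    using linear_on_compose[OF that T(1)] .
  have T2: "linear_on V E (\<lambda>x. T y (f x))" if "linear_on V H f" for V :: "('k, 'h) hopf" and f y
    using linear_on_compose[OF that T(2)] .
  note l = lin T1 T2 linear_Si E
  define M where "M s z = sw (\<lambda>a b. T a (Si s * b)) z" for s z
  \<comment> \<open>With \<open>p\<close>, \<open>r\<close>, \<open>s\<close> the three legs of
    \<open>x\<close>, padding \<open>b\<close> with \<open>Si s * r\<close> makes
    \<open>p * a\<close> and \<open>r * b\<close> the legs of the single product
    \<open>q * d\<close>.\<close>
  have "sw (\<lambda>a b. T (x * a) b) d = sw (\<lambda>q s. M s (q * d)) x" for x d
  proof -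
    have "sw (\<lambda>a b. T (x * a) b) d = sw (\<lambda>a b. sw (\<lambda>p q. scl E (eps q) (T (p * a) b)) x) d"
      by (subst sw_eps_right) (simp_all add: l)
    also have "\<dots> = sw (\<lambda>a b. sw (\<lambda>p q. sw (\<lambda>r s. T (p * a) (Si s * r * b)) q) x) d"
      using sw_Si_left[of E "\<lambda>z. T a' (z * b)" for a' b] by (simp add: l)
    also have "\<dots> = sw (\<lambda>a b. sw (\<lambda>q s. sw (\<lambda>p r. T (p * a) (Si s * r * b)) q) x) d"
      by (subst sw_coassoc[of E]) (simp_all add: l)
    also have "\<dots> = sw (\<lambda>q s. sw (\<lambda>p r. sw (\<lambda>a b. T (p * a) (Si s * (r * b))) d) q) x"
      by (simp only: sw_swap[where g = d] mult.assoc)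
    also have "\<dots> = sw (\<lambda>q s. M s (q * d)) x"
      unfolding M_def by (subst sw_mult[of E]) (simp_all add: l)
    finally show ?thesis .
  qed
  then have "sw (\<lambda>h\<^sub>1 h\<^sub>2. sw (\<lambda>a b. T (h\<^sub>2 * a) b) (Si h\<^sub>1 * c)) h =
      sw (\<lambda>h\<^sub>1 h\<^sub>2. sw (\<lambda>q s. M s (q * (Si h\<^sub>1 * c))) h\<^sub>2) h"
    by simp
  \<comment> \<open>At \<open>d = Si h\<^sub>1 * c\<close>, coassociativity makes
    \<open>h\<^sub>1\<close> and \<open>q\<close> adjacent legs, so \<open>q * Si h\<^sub>1\<close>
    cancels.\<close>
  also have "\<dots> = sw (\<lambda>x s. sw (\<lambda>h\<^sub>1 q. M s (q * (Si h\<^sub>1 * c))) x) h"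
    by (rule sw_coassoc[of E, symmetric]) (simp_all add: M_def l)
  also have "\<dots> = sw (\<lambda>x s. sw (\<lambda>h\<^sub>1 q. M s (q * Si h\<^sub>1 * c)) x) h"
    by (simp only: mult.assoc)
  also have "\<dots> = sw (\<lambda>x s. scl E (eps x) (M s c)) h"
    using sw_Si_right[of E "\<lambda>z. M s (z * c)" for s] by (simp add: M_def l)
  also have "\<dots> = M h c"
    by (rule sw_eps_left) (simp_all add: M_def l)
  finally show ?thesis by (simp add: M_def)
qed

section \<open>The tensor product with the dual\<close>

lemma car_dual: "car (dual H) = {f. linear_on H ground f}"
  and scl_dual [simp]: "scl (dual H) c f = (\<lambda>x. c * f x)"
  and act_dual [simp]: "act (dual H) h \<beta> = (\<lambda>a. \<beta> (Si h * a))"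
  by (simp_all add: dual_def car_hom)

lemma vspace_dual [simp]: "vspace (dual H)"
  using vspace_hom[OF vspace_ground, of H] by (simp add: vspace_def dual_def)

lemma fin_dim_dual: "fin_dim (dual H)"
proof -
  have "fin_dim (ground :: ('k, 'k) vspace)"
  proof -
    interpret vector_space "(*) :: 'k \<Rightarrow> 'k \<Rightarrow> 'k"
      using vspace_vector_space[OF vspace_ground] by simp
    have "span {1} = (UNIV :: 'k set)"
      by (auto simp: span_singleton)
    then show ?thesis by (auto simp: fin_dim_def)
  qed
  then have "fin_dim (hom H ground)"
    by (intro fin_dim_hom vspace_H vspace_ground fin_dim_H)
  then show ?thesis by (simp add: fin_dim_def dual_def)
qed

lemma eps_dual [simp]: "eps \<in> car (dual H)"
  by (simp add: car_dual eps_linear)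

lemma dual_apply_linear: "linear_on (dual H) ground (\<lambda>\<alpha>. \<alpha> a)"
  by (simp add: linear_on_def plus_fun_apply)

lemma linear_dual: "\<alpha> \<in> car (dual H) \<Longrightarrow> linear_on V H f \<Longrightarrow> linear_on V ground (\<lambda>x. \<alpha> (f x))"
  by (auto simp: car_dual intro: linear_on_compose)

section \<open>Tensors with the dual as linear maps on \<open>H\<close>\<close>

text \<open>\<open>val V\<close> identifies \<open>H\<^sup>* \<otimes> V\<close> with the linear maps \<open>H \<rightarrow> V\<close>.\<close>

definition val :: "('k, 'v::ab_group_add, 'm) vspace_scheme \<Rightarrow> ('k, 'h \<Rightarrow> 'k, 'v) tens \<Rightarrow> 'h \<Rightarrow> 'v" where
  "val V t a = tlift (dual H) V V (\<lambda>\<alpha> v. scl V (\<alpha> a) v) t"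

context
  fixes V :: "('k, 'v::ab_group_add, 'm) vspace_scheme"
  assumes V: "vspace V"
begin

lemma bilinear_val: "bilinear_on (dual H) V V (\<lambda>\<alpha> v. scl V (\<alpha> a) v)"
  by (intro bilinear_onI linear_on_scale linear_on_ident linear_on_coeff dual_apply_linear V)

lemma val_linear: "linear_on (tensor (dual H) V) V (\<lambda>t. val V t a)"
  unfolding val_def by (intro tlift_linear vspace_dual V bilinear_val)

lemma val_pure:
  "\<alpha> \<in> car (dual H) \<Longrightarrow> v \<in> car V \<Longrightarrow> val V (tpure (dual H) V \<alpha> v) a = scl V (\<alpha> a) v"
  unfolding val_def by (intro tlift_pure vspace_dual V bilinear_val)

lemma val_linear_arg: "t \<in> car (tensor (dual H) V) \<Longrightarrow> linear_on H V (val V t)"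
  unfolding val_def
  by (intro linear_tlift_param[OF vspace_dual V V vspace_H] bilinear_val linear_on_coeff V)
    (auto simp: car_dual)

lemma val_car: "t \<in> car (tensor (dual H) V) \<Longrightarrow> val V t a \<in> car V"
  using linear_on_car[OF val_linear] .

lemma linear_val: "t \<in> car (tensor (dual H) V) \<Longrightarrow> linear_on X H f \<Longrightarrow> linear_on X V (\<lambda>x. val V t (f x))"
  by (rule linear_on_compose[OF _ val_linear_arg])

text \<open>\<open>tensor_expand\<close> with the roles exchanged: the functionals
  \<open>e b\<close> are the vectors, and evaluation at \<open>b\<close> is the coordinate. A tensor
  is therefore determined by its \<open>val\<close>.\<close>

lemma val_expand:
  assumes "t \<in> car (tensor (dual H) V)"
  shows "t = (\<Sum>b\<in>basis. tpure (dual H) V (e b) (val V t b))"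
  unfolding val_def
proof (rule tensor_expand[OF vspace_dual V assms])
  fix \<alpha> assume \<alpha>: "\<alpha> \<in> car (dual H)"
  have *: "sum f I a = (\<Sum>i\<in>I. f i a)" for f :: "'i \<Rightarrow> 'h \<Rightarrow> 'k" and I a
    by (induction I rule: infinite_finite_induct) (auto simp: plus_fun_apply zero_fun_apply)
  have l: "linear_on H ground \<alpha>" using \<alpha> by (simp add: car_dual)
  show "(\<Sum>b\<in>basis. scl (dual H) (\<alpha> b) (e b)) = \<alpha>"
  proof
    fix a
    have "\<alpha> a = \<alpha> (\<Sum>b\<in>basis. sH (e b a) b)" by (simp add: coord_expand)
    also have "\<dots> = (\<Sum>b\<in>basis. \<alpha> b * e b a)"
      using linear_on_scl[OF l] by (simp add: linear_on_sum[OF l] mult.commute)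
    finally show "(\<Sum>b\<in>basis. scl (dual H) (\<alpha> b) (e b)) a = \<alpha> a" by (simp add: *)
  qed
qed (auto simp: car_dual coord_linear dual_apply_linear)

lemma val_eqI:
  assumes "s \<in> car (tensor (dual H) V)" "t \<in> car (tensor (dual H) V)" "\<And>a. val V s a = val V t a"
  shows "s = t"
  using val_expand[OF assms(1)] val_expand[OF assms(2)] assms(3) by simp

lemma val_exists:
  assumes \<phi>: "linear_on H V \<phi>"
  shows "\<exists>t\<in>car (tensor (dual H) V). \<forall>a. val V t a = \<phi> a"
proof (intro bexI allI)
  \<comment> \<open>The dual-basis element, the sum of all \<open>e b\<close> tensor
    \<open>b\<close>, with \<open>\<phi>\<close> applied to the second leg.\<close>
  let ?t = "\<Sum>b\<in>basis. tpure (dual H) V (e b) (\<phi> b)"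
  have e: "e b \<in> car (dual H)" if "b \<in> basis" for b using that by (simp add: car_dual coord_linear)
  have v: "\<phi> b \<in> car V" for b using linear_on_car[OF \<phi>] by simp
  show "?t \<in> car (tensor (dual H) V)" by (intro vspace_sum vspace_tensor tpure_car e v)
  fix a
  have "val V ?t a = (\<Sum>b\<in>basis. val V (tpure (dual H) V (e b) (\<phi> b)) a)"
    by (rule linear_on_sum[OF val_linear vspace_tensor]) (intro tpure_car e v)
  also have "\<dots> = (\<Sum>b\<in>basis. scl V (e b a) (\<phi> b))"
    by (intro sum.cong refl val_pure e v)
  also have "\<dots> = \<phi> (\<Sum>b\<in>basis. sH (e b a) b)"
    by (simp add: linear_on_sum[OF \<phi>] linear_on_scl[OF \<phi>])
  finally show "val V ?t a = \<phi> a" by (simp add: coord_expand)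
qed

end

end

section \<open>Sweedler calculus for a comodule algebra\<close>

locale comodule_algebra = hopf H basis e
  for H :: "('k::field, 'h::{ring,monoid_mult}) hopf" and basis e +
  fixes K :: "('k, 'a::{ring,monoid_mult}, 'h) comodalg"
  assumes comodule_algebra: "fd_comodule_algebra H K"
begin

lemma vspace_K [simp]: "vspace K"
  and car_K [simp]: "car K = UNIV"
  and coact_linear: "linear_on K (tensor H K) (coact K)"
  and coact_coassoc: "tassoc H H K (tmap H K (tensor H H) K (comul H) id (coact K k)) =
         tmap H K H (tensor H K) id (coact K) (coact K k)"
  and coact_eps: "tlift H K K (\<lambda>h a. scl K (counit H h) a) (coact K k) = k"
  using comodule_algebra by (simp_all add: fd_comodule_algebra_def fd_algebra_def)

lemma coact_car [simp]: "coact K k \<in> car (tensor H K)"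
  using linear_on_car[OF coact_linear] by simp

text \<open>The counterpart of \<open>sw\<close> for the coaction: for bilinear \<open>T\<close> it
  is \<open>T\<close> at the legs k_(-1) and k_(0) of \<open>k\<close>.\<close>

definition sk :: "('h \<Rightarrow> 'a \<Rightarrow> 'e::ab_group_add) \<Rightarrow> 'a \<Rightarrow> 'e" where
  "sk T k = (\<Sum>b\<in>basis. T b (leg K (coact K k) b))"

lemma tlift_coact:
  assumes "vspace E" "\<And>y. linear_on H E (\<lambda>x. T x y)" "\<And>x. linear_on K E (T x)"
  shows "tlift H K E T (coact K k) = sk T k"
  unfolding sk_def by (intro tlift_leg assms bilinear_onI) simp_all

lemma linear_leg_coact: "b \<in> basis \<Longrightarrow> linear_on K K (\<lambda>k. leg K (coact K k) b)"
  using linear_on_compose[OF coact_linear leg_linear[OF vspace_K]] .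

lemma linear_sk_fun:
  assumes "\<And>p q. linear_on V E (\<lambda>x. T x p q)" "vspace E"
  shows "linear_on V E (\<lambda>x. sk (T x) k)"
  unfolding sk_def using assms by (intro linear_on_sum_fun)

lemma linear_sk_arg:
  assumes "linear_on V K f" "\<And>p. linear_on K E (T p)" "vspace E"
  shows "linear_on V E (\<lambda>x. sk T (f x))"
  unfolding sk_def
  by (intro linear_on_sum_fun linear_on_compose[OF linear_on_compose[OF assms(1) linear_leg_coact]]
      assms)

lemma sk_linear:
  assumes "linear_on E F f" "vspace E" "\<And>x y. T x y \<in> car E"
  shows "f (sk T k) = sk (\<lambda>x y. f (T x y)) k"
  unfolding sk_def by (rule linear_on_sum[OF assms(1,2)]) (rule assms(3))

lemma sw_sk_swap:
  "sw (\<lambda>x y. sk (\<lambda>p q. T x y p q) k) h = sk (\<lambda>p q. sw (\<lambda>x y. T x y p q) h) k"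
  unfolding sw_def sk_def by (rule sum.swap)

lemma sk_coassoc:
  assumes E: "vspace E"
    and T: "\<And>q r. linear_on H E (\<lambda>p. T p q r)" "\<And>p r. linear_on H E (\<lambda>q. T p q r)"
      "\<And>p q. linear_on K E (\<lambda>r. T p q r)"
  shows "sk (\<lambda>x r. sw (\<lambda>p q. T p q r) x) k = sk (\<lambda>p y. sk (\<lambda>q r. T p q r) y) k"
proof -
  have "sk (\<lambda>x r. sw (\<lambda>p q. T p q r) x) k =
      tlift H K E (\<lambda>x r. tlift H H E (\<lambda>p q. T p q r) (comul H x)) (coact K k)"
    by (simp add: tlift_coact tlift_comul E T lin)
  also have "\<dots> = tlift H K E (\<lambda>p y. tlift H K E (T p) (coact K y)) (coact K k)"
    unfolding tlift_tassoc_comul[OF vspace_H vspace_K E T coact_car comul_linear, symmetric]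
      tlift_tmap_coact[OF vspace_H vspace_K E T coact_car coact_linear, symmetric] coact_coassoc ..
  also have "\<dots> = sk (\<lambda>p y. sk (\<lambda>q r. T p q r) y) k"
    by (simp add: tlift_coact E T lin linear_sk_fun linear_sk_arg)
  finally show ?thesis .
qed

lemma sk_eps:
  assumes "linear_on K E f" "vspace E"
  shows "sk (\<lambda>x y. scl E (eps x) (f y)) k = f k"
proof -
  have "sk (\<lambda>x y. scl K (eps x) y) k = k"
    using coact_eps[of k] by (simp add: tlift_coact lin)
  then show ?thesis
    using sk_linear[OF assms(1) vspace_K, of "\<lambda>x y. scl K (eps x) y" k]
    by (simp add: linear_on_scl[OF assms(1)])
qed

end

section \<open>Symbols of elements of the stabilizer\<close>

context hopf
begin

lemma sw_add: "sw (\<lambda>x y. T x y + T' x y) h = sw T h + sw T' h"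
  by (simp add: sw_def sum.distrib)

lemma sw_coeff: "vspace E \<Longrightarrow> sw (\<lambda>x y. scl E (T x y) v) h = scl E (sw T h) v"
  by (simp add: sw_def scl_sum_left)

lemma conv_apply:
  assumes "\<alpha> \<in> car (dual H)" "\<beta> \<in> car (dual H)"
  shows "conv H \<alpha> \<beta> a = sw (\<lambda>x y. \<alpha> x * \<beta> y) a"
  unfolding conv_def using assms by (intro tlift_comul vspace_ground linear_scalar) (auto simp: car_dual)

lemma conv_dual:
  assumes "\<alpha> \<in> car (dual H)" "\<beta> \<in> car (dual H)"
  shows "conv H \<alpha> \<beta> \<in> car (dual H)"
proof -
  have "conv H \<alpha> \<beta> = (\<lambda>a. sw (\<lambda>x y. \<alpha> x * \<beta> y) a)" using conv_apply[OF assms] by blast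
  moreover have "linear_on H ground (\<lambda>a. sw (\<lambda>x y. \<alpha> x * \<beta> y) a)"
    using assms by (intro linear_sw_arg linear_on_ident linear_scalar) (auto simp: car_dual)
  ultimately show ?thesis by (simp add: car_dual)
qed

lemma conv_linear:
  assumes \<alpha>: "\<alpha> \<in> car (dual H)"
  shows "linear_on (dual H) (dual H) (conv H \<alpha>)"
proof (rule linear_onI)
  show "conv H \<alpha> \<beta> \<in> car (dual H)" if "\<beta> \<in> car (dual H)" for \<beta> using \<alpha> that by (rule conv_dual)
  show "conv H \<alpha> (\<beta> + \<gamma>) = conv H \<alpha> \<beta> + conv H \<alpha> \<gamma>"
    if "\<beta> \<in> car (dual H)" "\<gamma> \<in> car (dual H)" for \<beta> \<gamma>
    by (rule ext) (simp add: conv_apply \<alpha> that vspace_add[OF vspace_dual] plus_fun_apply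
        distrib_left sw_add)
  show "conv H \<alpha> (scl (dual H) c \<beta>) = scl (dual H) c (conv H \<alpha> \<beta>)" if "\<beta> \<in> car (dual H)" for c \<beta>
    using vspace_scl[OF vspace_dual that, of c]
    by (intro ext) (simp add: conv_apply \<alpha> that sw_mult_left algebra_simps)
qed

text \<open>If \<open>A = \<L>(t)\<close>, then \<open>symbol U W A a u = t(a) u\<close>.\<close>

definition symbol ::
  "('k, 'u::ab_group_add, 'm) vspace_scheme \<Rightarrow> ('k, 'w::ab_group_add, 'n) vspace_scheme
    \<Rightarrow> (('k, 'h \<Rightarrow> 'k, 'u) tens \<Rightarrow> ('k, 'h \<Rightarrow> 'k, 'w) tens) \<Rightarrow> 'h \<Rightarrow> 'u \<Rightarrow> 'w" where
  "symbol U W A a u = val W (A (tpure (dual H) U eps u)) a"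

lemma linear_eval: "v \<in> car V \<Longrightarrow> linear_on (hom V W) W (\<lambda>f. f v)"
  by (auto intro!: linear_onI simp: plus_fun_apply car_hom linear_on_def)

abbreviation HT :: "('k, 'v::ab_group_add, 'm) vspace_scheme \<Rightarrow> ('k, ('k, 'h \<Rightarrow> 'k, 'v) tens) vspace"
  where "HT V \<equiv> tensor (dual H) V"

abbreviation yz_range ::
  "('k, 'u::ab_group_add, 'b) amod \<Rightarrow> ('k, 'w::ab_group_add, 'b) amod
    \<Rightarrow> (('k, 'h \<Rightarrow> 'k, 'u) tens \<Rightarrow> ('k, 'h \<Rightarrow> 'k, 'w) tens) set"
  where "yz_range U W \<equiv> yz_L H U W ` car (HT (hom U W))"

context
  fixes U :: "('k, 'u::ab_group_add, 'a) amod"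
    and W :: "('k, 'w::ab_group_add, 'a) amod"
  assumes U: "vspace U" and W: "vspace W"
begin

lemma val_tmap:
  assumes \<alpha>: "\<alpha> \<in> car (dual H)" and f: "f \<in> car (hom U W)" and s: "s \<in> car (HT U)"
  shows "val W (tmap (dual H) U (dual H) W (conv H \<alpha>) f s) a =
    sw (\<lambda>x y. scl W (\<alpha> x) (f (val U s y))) a"
proof (rule tensor_linear_eqI[OF _ _ _ s, where E = W])
  note fl = hom_linear[OF f]
  note tm = vspace_dual U conv_linear[OF \<alpha>] fl
  show "linear_on (HT U) W (\<lambda>s. val W (tmap (dual H) U (dual H) W (conv H \<alpha>) f s) a)"
    by (rule linear_on_compose[OF tmap_linear[OF tm] val_linear[OF W]])
  show "linear_on (HT U) W (\<lambda>s. sw (\<lambda>x y. scl W (\<alpha> x) (f (val U s y))) a)"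
    by (intro linear_sw_fun linear_on_scale linear_on_compose[OF val_linear[OF U] fl] W)
  fix \<beta> u assume *: "\<beta> \<in> car (dual H)" "u \<in> car U"
  show "val W (tmap (dual H) U (dual H) W (conv H \<alpha>) f (tpure (dual H) U \<beta> u)) a =
    sw (\<lambda>x y. scl W (\<alpha> x) (f (val U (tpure (dual H) U \<beta> u) y))) a"
    using * by (simp add: tmap_pure[OF tm] val_pure[OF W] val_pure[OF U] conv_dual \<alpha>
        linear_on_car[OF fl] linear_on_scl[OF fl] scl_scl[OF W] sw_coeff[OF W] conv_apply)
qed

lemma hom_tensor_eqI:
  assumes A: "A \<in> car (hom (HT U) (HT W))" "A' \<in> car (hom (HT U) (HT W))"
    and "\<And>s a. s \<in> car (HT U) \<Longrightarrow> val W (A s) a = val W (A' s) a"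
  shows "A = A'"
  by (intro hom_eqI[OF A] val_eqI[OF W] assms(3) linear_on_car[OF hom_linear[OF A(1)]]
      linear_on_car[OF hom_linear[OF A(2)]])

text \<open>Operators are compared through \<open>val\<close>, where \<open>val_tmap\<close>
  displays the dependence on \<open>\<alpha>\<close> and \<open>f\<close> as a visibly bilinear
  sum.\<close>

lemma bilinear_L:
  "bilinear_on (dual H) (hom U W) (hom (HT U) (HT W)) (\<lambda>\<alpha> f. tmap (dual H) U (dual H) W (conv H \<alpha>) f)"
proof -
  let ?T = "\<lambda>\<alpha> f. tmap (dual H) U (dual H) W (conv H \<alpha>) f"
  have vs: "vspace (hom U W)" "vspace (hom (HT U) (HT W))" using W by (simp_all add: vspace_hom)
  have T: "?T \<alpha> f \<in> car (hom (HT U) (HT W))" if "\<alpha> \<in> car (dual H)" "f \<in> car (hom U W)" for \<alpha> f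
    by (intro tmap_hom vspace_dual U conv_linear hom_linear that)
  have Ts: "?T \<alpha> f s \<in> car (HT W)" if "\<alpha> \<in> car (dual H)" "f \<in> car (hom U W)" "s \<in> car (HT U)" for \<alpha> f s
    using linear_on_car[OF hom_linear[OF T[OF that(1,2)]] that(3)] .
  note simps = val_tmap plus_fun_apply linear_on_add[OF val_linear[OF W]]
    linear_on_scl[OF val_linear[OF W]] Ts vspace_add[OF vspace_dual] vspace_add[OF vs(1)]
  show ?thesis
  proof (intro bilinear_onI linear_onI T)
    fix \<alpha> f g assume *: "\<alpha> \<in> car (dual H)" "f \<in> car (hom U W)" "g \<in> car (hom U W)"
    show "?T \<alpha> (f + g) = ?T \<alpha> f + ?T \<alpha> g"
      by (intro hom_tensor_eqI T vspace_add[OF vs(2)] vspace_add[OF vs(1)] *)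
        (simp add: simps * scl_add_right[OF W] sw_add)
  next
    fix \<alpha> f c assume *: "\<alpha> \<in> car (dual H)" "f \<in> car (hom U W)"
    show "?T \<alpha> (scl (hom U W) c f) = scl (hom (HT U) (HT W)) c (?T \<alpha> f)"
    proof (rule hom_tensor_eqI)
      show "?T \<alpha> (scl (hom U W) c f) \<in> car (hom (HT U) (HT W))" "scl (hom (HT U) (HT W)) c (?T \<alpha> f) \<in> car (hom (HT U) (HT W))"
        by (intro T vspace_scl[OF vs(2)] vspace_scl[OF vs(1)] *)+
      fix s a assume s: "s \<in> car (HT U)"
      have "val W (?T \<alpha> (scl (hom U W) c f) s) a = sw (\<lambda>x y. scl W (\<alpha> x) (scl W c (f (val U s y)))) a"
        using val_tmap[OF *(1) vspace_scl[OF vs(1) *(2), of c] s] by simp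
      then show "val W (?T \<alpha> (scl (hom U W) c f) s) a = val W (scl (hom (HT U) (HT W)) c (?T \<alpha> f) s) a"
        using linear_on_scl[OF val_linear[OF W] Ts[OF * s]]
        by (simp add: val_tmap * s sw_scl[OF W] scl_scl[OF W] mult.commute)
    qed
  next
    fix f \<alpha> \<beta> assume *: "f \<in> car (hom U W)" "\<alpha> \<in> car (dual H)" "\<beta> \<in> car (dual H)"
    show "?T (\<alpha> + \<beta>) f = ?T \<alpha> f + ?T \<beta> f"
      by (intro hom_tensor_eqI T vspace_add[OF vs(2)] vspace_add[OF vspace_dual] *)
        (simp add: simps * scl_add_left[OF W] sw_add)
  next
    fix f \<alpha> c assume *: "f \<in> car (hom U W)" "\<alpha> \<in> car (dual H)"
    show "?T (scl (dual H) c \<alpha>) f = scl (hom (HT U) (HT W)) c (?T \<alpha> f)"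
    proof (rule hom_tensor_eqI)
      show "?T (scl (dual H) c \<alpha>) f \<in> car (hom (HT U) (HT W))" "scl (hom (HT U) (HT W)) c (?T \<alpha> f) \<in> car (hom (HT U) (HT W))"
        by (intro T vspace_scl[OF vs(2)] vspace_scl[OF vspace_dual] *)+
      fix s a assume s: "s \<in> car (HT U)"
      have "val W (?T (scl (dual H) c \<alpha>) f s) a = sw (\<lambda>x y. scl W (c * \<alpha> x) (f (val U s y))) a"
        using val_tmap[OF vspace_scl[OF vspace_dual *(2), of c] *(1) s] by simp
      then show "val W (?T (scl (dual H) c \<alpha>) f s) a = val W (scl (hom (HT U) (HT W)) c (?T \<alpha> f) s) a"
        using linear_on_scl[OF val_linear[OF W] Ts[OF *(2,1) s]]
        by (simp add: val_tmap * s sw_scl[OF W] scl_scl[OF W])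
    qed
  qed
qed

lemma yz_L_linear: "linear_on (HT (hom U W)) (hom (HT U) (HT W)) (yz_L H U W)"
  and yz_L_pure: "\<alpha> \<in> car (dual H) \<Longrightarrow> f \<in> car (hom U W) \<Longrightarrow>
    yz_L H U W (tpure (dual H) (hom U W) \<alpha> f) = tmap (dual H) U (dual H) W (conv H \<alpha>) f"
proof -
  note * = vspace_dual vspace_hom[OF W] vspace_hom[OF vspace_tensor] bilinear_L
  show "linear_on (HT (hom U W)) (hom (HT U) (HT W)) (yz_L H U W)"
    "\<alpha> \<in> car (dual H) \<Longrightarrow> f \<in> car (hom U W) \<Longrightarrow>
      yz_L H U W (tpure (dual H) (hom U W) \<alpha> f) = tmap (dual H) U (dual H) W (conv H \<alpha>) f"
    unfolding yz_L_def using tlift_linear[OF *] tlift_pure[OF *] by auto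
qed

lemma yz_L_hom: "t \<in> car (HT (hom U W)) \<Longrightarrow> yz_L H U W t \<in> car (hom (HT U) (HT W))"
  using linear_on_car[OF yz_L_linear] .

text \<open>Under \<open>val\<close>, \<open>\<L>\<close> becomes convolution of functions on
  \<open>H\<close>, with application of linear maps as the product. Both sides are linear in
  \<open>t\<close>, and on pure tensors this is \<open>val_tmap\<close>.\<close>

lemma val_yz_L:
  assumes t: "t \<in> car (HT (hom U W))" and s: "s \<in> car (HT U)"
  shows "val W (yz_L H U W t s) a = sw (\<lambda>x y. val (hom U W) t x (val U s y)) a"
proof (rule tensor_linear_eqI[OF _ _ _ t, where E = W])
  show "linear_on (HT (hom U W)) W (\<lambda>t. val W (yz_L H U W t s) a)"
    by (rule linear_on_compose[OF linear_on_compose[OF yz_L_linear linear_eval[OF s]] val_linear[OF W]])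
  show "linear_on (HT (hom U W)) W (\<lambda>t. sw (\<lambda>x y. val (hom U W) t x (val U s y)) a)"
    by (intro linear_sw_fun W linear_on_compose[OF val_linear[OF vspace_hom[OF W]]]
        linear_eval val_car U s)
  fix \<alpha> f assume *: "\<alpha> \<in> car (dual H)" "f \<in> car (hom U W)"
  then show "val W (yz_L H U W (tpure (dual H) (hom U W) \<alpha> f) s) a =
      sw (\<lambda>x y. val (hom U W) (tpure (dual H) (hom U W) \<alpha> f) x (val U s y)) a"
    by (simp add: yz_L_pure val_tmap s val_pure[OF vspace_hom[OF W]])
qed

text \<open>\<open>eps\<close> is the unit of the dual algebra, so convolving with
  \<open>eps\<close> tensor \<open>u\<close> gives back \<open>t\<close>. In particular
  \<open>t\<close> can be recovered from its image.\<close>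

lemma symbol_yz_L:
  assumes t: "t \<in> car (HT (hom U W))" and u: "u \<in> car U"
  shows "symbol U W (yz_L H U W t) a u = val (hom U W) t a u"
proof -
  have t': "val (hom U W) t x \<in> car (hom U W)" for x by (rule val_car[OF vspace_hom[OF W] t])
  have "symbol U W (yz_L H U W t) a u =
      sw (\<lambda>x y. val (hom U W) t x (val U (tpure (dual H) U eps u) y)) a"
    unfolding symbol_def by (rule val_yz_L[OF t]) (intro tpure_car eps_dual u)
  also have "\<dots> = sw (\<lambda>x y. scl W (eps y) (val (hom U W) t x u)) a"
    by (simp add: val_pure[OF U] u linear_on_scl[OF hom_linear[OF t']])
  also have "\<dots> = val (hom U W) t a u"
    by (intro sw_eps_right linear_on_compose[OF val_linear_arg[OF vspace_hom[OF W] t]]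
        linear_eval u W)
  finally show ?thesis .
qed

lemma
  assumes A: "A \<in> car (hom (HT U) (HT W))"
  shows symbol_car: "u \<in> car U \<Longrightarrow> symbol U W A a u \<in> car W"
    and linear_symbol_left: "u \<in> car U \<Longrightarrow> linear_on X H f \<Longrightarrow> linear_on X W (\<lambda>x. symbol U W A (f x) u)"
    and linear_symbol_right: "linear_on Y U g \<Longrightarrow> linear_on Y W (\<lambda>x. symbol U W A a (g x))"
proof -
  have eu: "tpure (dual H) U eps u \<in> car (HT U)" if "u \<in> car U" for u
    by (intro tpure_car eps_dual that)
  note Al = hom_linear[OF A]
  show "u \<in> car U \<Longrightarrow> symbol U W A a u \<in> car W"
    unfolding symbol_def by (intro val_car W linear_on_car[OF Al] eu)
  show "u \<in> car U \<Longrightarrow> linear_on X H f \<Longrightarrow> linear_on X W (\<lambda>x. symbol U W A (f x) u)"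
    unfolding symbol_def by (intro linear_val W linear_on_car[OF Al] eu)
  show "linear_on Y W (\<lambda>x. symbol U W A a (g x))" if "linear_on Y U g"
    unfolding symbol_def
    by (intro linear_on_compose[OF linear_on_compose[OF _ Al] val_linear[OF W]]
        linear_on_compose[OF that bilinear_on_right[OF bilinear_tpure]] eps_dual)
qed

lemma linear_symbol:
  assumes "u \<in> car U"
  shows "linear_on (hom (HT U) (HT W)) W (\<lambda>A. symbol U W A a u)"
  unfolding symbol_def
  by (intro linear_on_compose[OF linear_eval val_linear[OF W]] tpure_car eps_dual assms)

text \<open>An operator in the range is rebuilt from its symbol, which is why equations in the
  stabilizer can be checked on symbols.\<close>

lemma yz_L_apply:
  assumes A: "A \<in> yz_range U W" and s: "s \<in> car (HT U)"
  shows "val W (A s) a = sw (\<lambda>x y. symbol U W A x (val U s y)) a"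
  using A by (auto simp: val_yz_L symbol_yz_L s val_car[OF U])

lemma symbol_eqI:
  assumes A: "A \<in> yz_range U W" "A' \<in> yz_range U W"
    and "\<And>a u. u \<in> car U \<Longrightarrow> symbol U W A a u = symbol U W A' a u"
  shows "A = A'"
  by (rule hom_tensor_eqI) (use A in \<open>auto simp: yz_L_hom yz_L_apply val_car[OF U] assms(3)\<close>)

lemma symbol_exists:
  assumes \<tau>: "\<And>u. u \<in> car U \<Longrightarrow> linear_on H W (\<lambda>a. \<tau> a u)" "\<And>a. linear_on U W (\<tau> a)"
  obtains A where "A \<in> yz_range U W" "\<And>a u. u \<in> car U \<Longrightarrow> symbol U W A a u = \<tau> a u"
proof -
  let ?\<phi> = "\<lambda>a u. if u \<in> car U then \<tau> a u else 0"
  have "linear_on H (hom U W) ?\<phi>"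
    by (intro linear_onI hom_restrict \<tau> U)
      (auto simp: fun_eq_iff plus_fun_apply linear_on_add[OF \<tau>(1)] linear_on_scl[OF \<tau>(1)] W)
  from val_exists[OF vspace_hom[OF W] this] obtain t
    where t: "t \<in> car (HT (hom U W))" "\<And>a. val (hom U W) t a = ?\<phi> a" by blast
  show thesis
    by (rule that[of "yz_L H U W t"]) (use t in \<open>auto simp: symbol_yz_L\<close>)
qed

end

end

section \<open>The stabilizer as a module\<close>

lemma
  assumes "fd_module A M"
  shows module_vspace: "vspace M"
    and module_fin_dim: "fin_dim M"
    and module_bilinear: "bilinear_on A M M (act M)"
    and module_one: "x \<in> car M \<Longrightarrow> act M 1 x = x"
    and module_mult: "x \<in> car M \<Longrightarrow> act M (a * b) x = act M a (act M b x)"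
  using assms by (simp_all add: fd_module_def)

lemma
  fixes \<delta> :: "'a::ab_group_add \<Rightarrow> ('k::field, 'h::ab_group_add, 'a) tens"
  assumes vs: "vspace H" "vspace A" "vspace X" "vspace V"
    and X: "bilinear_on H X X (act X)" and V: "bilinear_on A V V (act V)"
    and \<delta>: "\<delta> a \<in> car (tensor H A)"
  shows tensor_mod_linear: "linear_on (tensor X V) (tensor X V) (act (tensor_mod H A \<delta> X V) a)"
    and tensor_mod_pure: "x \<in> car X \<Longrightarrow> v \<in> car V \<Longrightarrow>
      act (tensor_mod H A \<delta> X V) a (tpure X V x v) =
      tlift H A (tensor X V) (\<lambda>h a'. tpure X V (act X h x) (act V a' v)) (\<delta> a)"
proof -
  have b: "bilinear_on H A (tensor X V) (\<lambda>h a'. tpure X V (act X h x) (act V a' v))"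
    if "x \<in> car X" "v \<in> car V" for x v
    by (intro bilinear_on_compose[OF bilinear_tpure] bilinear_on_left[OF X] bilinear_on_left[OF V] that)
  have "bilinear_on X V (tensor X V)
     (\<lambda>x v. tlift H A (tensor X V) (\<lambda>h a'. tpure X V (act X h x) (act V a' v)) (\<delta> a))"
    by (intro bilinear_onI linear_tlift_param[OF vs(1,2) vspace_tensor] vs b \<delta>
        linear_on_compose[OF bilinear_on_right[OF X] bilinear_on_left[OF bilinear_tpure]]
        linear_on_compose[OF bilinear_on_right[OF V] bilinear_on_right[OF bilinear_tpure]]
        bilinear_on_car[OF X] bilinear_on_car[OF V])
  note * = vs(3,4) vspace_tensor this
  show "linear_on (tensor X V) (tensor X V) (act (tensor_mod H A \<delta> X V) a)"
    "x \<in> car X \<Longrightarrow> v \<in> car V \<Longrightarrow> act (tensor_mod H A \<delta> X V) a (tpure X V x v) =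
      tlift H A (tensor X V) (\<lambda>h a'. tpure X V (act X h x) (act V a' v)) (\<delta> a)"
    using tlift_linear[OF *] tlift_pure[OF *] by (simp_all add: tensor_mod_def)
qed

lemma linear_act_left:
  assumes "fd_module A M" "x \<in> car M" "linear_on V A f"
  shows "linear_on V M (\<lambda>y. act M (f y) x)"
  using linear_on_compose[OF assms(3) bilinear_on_left[OF module_bilinear[OF assms(1)] assms(2)]] .

lemma linear_act_right:
  assumes "fd_module A M" "a \<in> car A" "linear_on V M f"
  shows "linear_on V M (\<lambda>y. act M a (f y))"
  using linear_on_compose[OF assms(3) bilinear_on_right[OF module_bilinear[OF assms(1)] assms(2)]] .

lemma module_act_car: "fd_module A M \<Longrightarrow> a \<in> car A \<Longrightarrow> x \<in> car M \<Longrightarrow> act M a x \<in> car M"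
  using bilinear_on_car[OF module_bilinear] .

context comodule_algebra
begin

lemma car_cat_act [simp]: "car (cat_act H K X U) = car (tensor X U)"
  and scl_cat_act [simp]: "scl (cat_act H K X U) = tscl"
  by (simp_all add: cat_act_def tensor_mod_def)

lemma hom_cat_act:
  "hom (cat_act H K X U) W = hom (tensor X U) W"
  "hom V (cat_act H K X U) = hom V (tensor X U)"
  by (simp_all add: hom_def linear_on_def)

lemma
  assumes X: "vspace X" "bilinear_on H X X (act X)" and U: "fd_module K U"
  shows cat_act_linear: "linear_on (tensor X U) (tensor X U) (act (cat_act H K X U) k)"
    and cat_act_pure: "x \<in> car X \<Longrightarrow> u \<in> car U \<Longrightarrow> act (cat_act H K X U) k (tpure X U x u) =
      sk (\<lambda>h k'. tpure X U (act X h x) (act U k' u)) k"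
proof -
  note * = vspace_H vspace_K X(1) module_vspace[OF U] X(2) module_bilinear[OF U] coact_car
  show "linear_on (tensor X U) (tensor X U) (act (cat_act H K X U) k)"
    unfolding cat_act_def by (rule tensor_mod_linear[OF *])
  show "act (cat_act H K X U) k (tpure X U x u) = sk (\<lambda>h k'. tpure X U (act X h x) (act U k' u)) k"
    if "x \<in> car X" "u \<in> car U"
  proof -
    have x: "act X h x \<in> car X" for h using bilinear_on_car[OF X(2)] that by simp
    have u: "act U k u \<in> car U" for k using module_act_car[OF U] that by simp
    show ?thesis
      unfolding cat_act_def tensor_mod_pure[OF * that]
      by (intro tlift_coact vspace_tensor
          linear_on_compose[OF bilinear_on_left[OF X(2) that(1)] bilinear_on_left[OF bilinear_tpure]]
          linear_on_compose[OF bilinear_on_left[OF module_bilinear[OF U] that(2)]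
            bilinear_on_right[OF bilinear_tpure]] x u)
  qed
qed

lemma dual_translate: "\<beta> \<in> car (dual H) \<Longrightarrow> (\<lambda>a. \<beta> (h * a)) \<in> car (dual H)"
  using linear_dual[OF _ linear_mult_left[OF linear_on_ident]] by (simp add: car_dual)

lemma bilinear_act_dual: "bilinear_on H (dual H) (dual H) (act (dual H))"
proof (intro bilinear_onI linear_onI)
  fix h h' c and \<beta> assume \<beta>: "\<beta> \<in> car (dual H)"
  show "act (dual H) h \<beta> \<in> car (dual H)" using dual_translate[OF \<beta>] by simp
  have l: "linear_on H ground \<beta>" using \<beta> by (simp add: car_dual)
  show "act (dual H) (h + h') \<beta> = act (dual H) h \<beta> + act (dual H) h' \<beta>"
    by (simp add: fun_eq_iff plus_fun_apply linear_on_add[OF Si_linear] linear_on_add[OF l] distrib_right)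
  show "act (dual H) (sH c h) \<beta> = scl (dual H) c (act (dual H) h \<beta>)"
    using linear_on_scl[OF l] by (simp add: linear_on_scl[OF Si_linear])
  show "act (dual H) h \<beta> \<in> car (dual H)" by fact
qed (auto simp: plus_fun_apply dual_translate fun_eq_iff)

section \<open>\<open>K\<close>-linearity read on symbols\<close>

text \<open>The equation characterises the symbols of the elements of the stabilizer.\<close>

definition equivariant ::
  "('k, 'u::ab_group_add, 'a) amod \<Rightarrow> ('k, 'w::ab_group_add, 'a) amod \<Rightarrow> ('h \<Rightarrow> 'u \<Rightarrow> 'w) \<Rightarrow> bool"
  where "equivariant U W \<tau> \<longleftrightarrow>
    (\<forall>k a. \<forall>u\<in>car U. act W k (\<tau> a u) = sk (\<lambda>h k'. \<tau> (h * a) (act U k' u)) k)"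

lemma val_act:
  assumes U: "fd_module K U" and s: "s \<in> car (HT U)"
  shows "val U (act (cat_act H K (dual H) U) k s) a = sk (\<lambda>h k'. act U k' (val U s (Si h * a))) k"
proof (rule tensor_linear_eqI[OF _ _ _ s, where E = U])
  note vU = module_vspace[OF U]
  show "linear_on (HT U) U (\<lambda>s. val U (act (cat_act H K (dual H) U) k s) a)"
    by (rule linear_on_compose[OF cat_act_linear[OF vspace_dual bilinear_act_dual U] val_linear[OF vU]])
  show "linear_on (HT U) U (\<lambda>s. sk (\<lambda>h k'. act U k' (val U s (Si h * a))) k)"
    by (intro linear_sk_fun linear_act_right[OF U] val_linear vU) simp
  fix \<beta> u assume *: "\<beta> \<in> car (dual H)" "u \<in> car U"
  have au: "act U k' u \<in> car U" for k' using module_act_car[OF U _ *(2)] by simp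
  have sc: "act U k' (scl U c u) = scl U c (act U k' u)" for k' c
    using linear_on_scl[OF bilinear_on_right[OF module_bilinear[OF U]] *(2)] by simp
  show "val U (act (cat_act H K (dual H) U) k (tpure (dual H) U \<beta> u)) a =
      sk (\<lambda>h k'. act U k' (val U (tpure (dual H) U \<beta> u) (Si h * a))) k"
    by (simp add: cat_act_pure[OF vspace_dual bilinear_act_dual U *] val_pure[OF vU] * au sc
        dual_translate tpure_car sk_linear[OF val_linear[OF vU] vspace_tensor])
qed

context
  fixes U :: "('k, 'u::ab_group_add, 'a) amod"
    and W :: "('k, 'w::ab_group_add, 'a) amod"
  assumes U: "fd_module K U" and W: "fd_module K W"
begin

text \<open>Tensors \<open>eps\<close> tensor \<open>u\<close> suffice to derive the equation, since
  they determine the symbol. For the converse, the action on a general tensor is given by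
  \<open>val_act\<close>, and \<open>sw_Si_mult\<close> passes its \<open>Si\<close> from the
  argument of a convolution to the second factor.\<close>

lemma Stab_iff:
  "A \<in> car (Stab H K U W) \<longleftrightarrow> A \<in> yz_range U W \<and> equivariant U W (symbol U W A)"
proof -
  note vU = module_vspace[OF U] and vW = module_vspace[OF W]
  let ?u = "act (cat_act H K (dual H) U)" and ?w = "act (cat_act H K (dual H) W)"
  have "(\<forall>k. \<forall>s\<in>car (HT U). A (?u k s) = ?w k (A s)) \<longleftrightarrow> equivariant U W (symbol U W A)"
    if A: "A \<in> yz_range U W"
  proof
    have Ah: "A \<in> car (hom (HT U) (HT W))" using A yz_L_hom[OF vU vW] by auto
    have As: "A s \<in> car (HT W)" if "s \<in> car (HT U)" for s
      using linear_on_car[OF hom_linear[OF Ah] that] .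
    have us: "?u k s \<in> car (HT U)" if "s \<in> car (HT U)" for k s
      using linear_on_car[OF cat_act_linear[OF vspace_dual bilinear_act_dual U] that] .
    have ws: "?w k s \<in> car (HT W)" if "s \<in> car (HT W)" for k s
      using linear_on_car[OF cat_act_linear[OF vspace_dual bilinear_act_dual W] that] .
    have actU [simp]: "act U k u \<in> car U" if "u \<in> car U" for k u
      using module_act_car[OF U _ that] by simp
    have symA: "symbol U W A a u \<in> car W" if "u \<in> car U" for a u
      using symbol_car[OF vU vW Ah that] .
    note l = lin linear_sk_fun linear_sk_arg linear_Si vW vU symA
      linear_act_left[OF W] linear_act_right[OF W] linear_act_left[OF U] linear_act_right[OF U]
      linear_symbol_left[OF vU vW Ah] linear_symbol_right[OF vU vW Ah] linear_val[OF vU] val_car[OF vU]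
    let ?t = "symbol U W A"
    {
      assume K: "\<forall>k. \<forall>s\<in>car (HT U). A (?u k s) = ?w k (A s)"
      show "equivariant U W ?t" unfolding equivariant_def
      proof (intro allI ballI)
        fix k a u assume u: "u \<in> car U"
        \<comment> \<open>The action on \<open>eps\<close> tensor \<open>u\<close> only changes
          \<open>u\<close>, because \<open>eps (Si h * a) = eps h * eps a\<close>. This leaves the
          inverse antipode on the side of \<open>W\<close>.\<close>
        have C: "?t a (act U k u) = sk (\<lambda>h k'. act W k' (?t (Si h * a) u)) k" for a k
        proof -
          let ?s = "tpure (dual H) U eps u"
          have s: "?s \<in> car (HT U)" by (intro tpure_car eps_dual u)
          have "?u k ?s = sk (\<lambda>h k'. tscl (eps h) (tpure (dual H) U eps (act U k' u))) k"
            using linear_on_scl[OF bilinear_on_left[OF bilinear_tpure[of "dual H" U]] eps_dual]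
            by (simp add: cat_act_pure[OF vspace_dual bilinear_act_dual U eps_dual u] u)
          also have "\<dots> = tpure (dual H) U eps (act U k u)"
            using sk_eps[OF linear_on_compose[OF bilinear_on_left[OF module_bilinear[OF U] u]
                  bilinear_on_right[OF bilinear_tpure eps_dual]] vspace_tensor]
            by simp
          finally have "?t a (act U k u) = val W (A (?u k ?s)) a" by (simp add: symbol_def)
          also have "\<dots> = sk (\<lambda>h k'. act W k' (?t (Si h * a) u)) k"
            using K s by (simp add: val_act[OF W As] symbol_def)
          finally show ?thesis .
        qed
        \<comment> \<open>Applying \<open>C\<close> to \<open>act U k' u\<close> puts
          \<open>Si h' * h\<close> with adjacent legs in front of \<open>a\<close>, and these
          cancel.\<close>
        have "sk (\<lambda>h k'. ?t (h * a) (act U k' u)) k =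
            sk (\<lambda>h k'. sk (\<lambda>h' k''. act W k'' (?t (Si h' * (h * a)) u)) k') k"
          by (simp add: C)
        also have "\<dots> = sk (\<lambda>g k''. sw (\<lambda>h h'. act W k'' (?t (Si h' * h * a) u)) g) k"
          by (subst sk_coassoc[of W, symmetric]) (simp_all add: l u mult.assoc)
        also have "\<dots> = sk (\<lambda>g k''. scl W (eps g) (act W k'' (?t a u))) k"
          using sw_Si_left[of W "\<lambda>z. act W k'' (?t (z * a) u)" for k''] by (simp add: l u)
        also have "\<dots> = act W k (?t a u)"
          by (rule sk_eps) (simp_all add: l u)
        finally show "act W k (?t a u) = sk (\<lambda>h k'. ?t (h * a) (act U k' u)) k" ..
      qed
    }
    {
      assume "equivariant U W ?t"
      then have E: "act W k (?t a u) = sk (\<lambda>h k'. ?t (h * a) (act U k' u)) k" if "u \<in> car U" for k a u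
        using that by (simp add: equivariant_def)
      show "\<forall>k. \<forall>s\<in>car (HT U). A (?u k s) = ?w k (A s)"
      proof (intro allI ballI val_eqI[OF vW] As us ws)
        fix k s a assume s: "s \<in> car (HT U)"
        let ?v = "val U s"
        have "val W (?w k (A s)) a = sk (\<lambda>h k'. act W k' (sw (\<lambda>x y. ?t x (?v y)) (Si h * a))) k"
          by (simp add: val_act[OF W As[OF s]] yz_L_apply[OF vU vW A s])
        also have "\<dots> = sk (\<lambda>h k'. sw (\<lambda>x y. act W k' (?t x (?v y))) (Si h * a)) k"
          using sw_linear[OF bilinear_on_right[OF module_bilinear[OF W]] vW] by (simp add: l s)
        also have "\<dots> = sk (\<lambda>h k'. sk (\<lambda>h' k''. sw (\<lambda>x y. ?t (h' * x) (act U k'' (?v y))) (Si h * a)) k') k"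
          by (simp add: E l s sw_sk_swap)
        also have "\<dots> = sk (\<lambda>g k''. sw (\<lambda>h h'. sw (\<lambda>x y. ?t (h' * x) (act U k'' (?v y))) (Si h * a)) g) k"
          by (rule sk_coassoc[of W, symmetric]) (simp_all add: l s)
        \<comment> \<open>The leg \<open>h'\<close> produced by equivariance is absorbed, and
          \<open>Si g\<close> ends up in the argument of \<open>?v\<close>, just as in the action on
          \<open>s\<close>.\<close>
        also have "\<dots> = sk (\<lambda>g k''. sw (\<lambda>x y. ?t x (act U k'' (?v (Si g * y)))) a) k"
          by (subst sw_Si_mult[of W]) (simp_all add: l s)
        also have "\<dots> = sw (\<lambda>x y. ?t x (sk (\<lambda>h k'. act U k' (?v (Si h * y))) k)) a"
        proof -
          have "linear_on U W (?t x)" for x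
            using linear_symbol_right[OF vU vW Ah linear_on_ident] .
          from sk_linear[OF this vU] show ?thesis by (simp add: l s sw_sk_swap)
        qed
        also have "\<dots> = val W (A (?u k s)) a"
          by (simp add: yz_L_apply[OF vU vW A us[OF s]] val_act[OF U s])
        finally show "val W (A (?u k s)) a = val W (?w k (A s)) a" ..
      qed
    }
  qed
  then show ?thesis
    using yz_L_hom[OF vU vW] by (auto simp: Stab_def mhom_def hom_cat_act)
qed

end

end

lemma mhom_iff:
  "f \<in> car (mhom M N) \<longleftrightarrow>
    f \<in> car (hom M N) \<and> (\<forall>a. \<forall>x\<in>car M. f (act M a x) = act N a (f x))"
  by (simp add: mhom_def)

lemma scl_mhom [simp]: "scl (mhom M N) c f = (\<lambda>x. scl N c (f x))"
  by (simp add: mhom_def)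

text \<open>\<open>rep_tensor H X Y\<close> and \<open>tensor X Y\<close> are records of different
  types with equal carrier and scalars. Tensor products see these two fields only and may be formed
  over either record.\<close>

lemma tensor_record_cong:
  fixes V :: "('k::field, 'v::ab_group_add, 'm) vspace_scheme"
    and V' :: "('k, 'v, 'n) vspace_scheme"
    and W :: "('k, 'w::ab_group_add, 'p) vspace_scheme"
  assumes "car V = car V'" "scl V = scl V'"
  shows "tpure V W = tpure V' W" "tensor V W = tensor V' W" "tlift V W E = tlift V' W E"
proof -
  have "bilinear_on V W (ground :: ('k, 'k) vspace) = bilinear_on V' W ground"
    by (intro ext) (simp add: bilinear_on_def linear_on_def assms)
  then show t: "tpure V W = tpure V' W" by (simp add: tpure_def fun_eq_iff)
  show T: "tensor V W = tensor V' W" by (simp add: tensor_def t assms(1))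
  show "tlift V W E = tlift V' W E" by (simp add: tlift_def fun_eq_iff t T assms(1))
qed

section \<open>The stabilizer as a finite-dimensional \<open>H\<close>-module\<close>

context comodule_algebra
begin

lemma sk_add: "sk (\<lambda>x y. T x y + T' x y) k = sk T k + sk T' k"
  by (simp add: sk_def sum.distrib)

lemma sk_scl: "vspace E \<Longrightarrow> scl E c (sk T k) = sk (\<lambda>x y. scl E c (T x y)) k"
  by (simp add: sk_def scl_sum_right)

context
  fixes U :: "('k, 'u::ab_group_add, 'a) amod"
    and W :: "('k, 'w::ab_group_add, 'a) amod"
  assumes U: "fd_module K U" and W: "fd_module K W"
begin

lemma vspace_modules [simp]: "vspace U" "vspace W"
  using module_vspace[OF U] module_vspace[OF W] .

lemma actU_car [simp]: "u \<in> car U \<Longrightarrow> act U k u \<in> car U"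
  and actW_car [simp]: "w \<in> car W \<Longrightarrow> act W k w \<in> car W"
  by (simp_all add: module_act_car[OF U] module_act_car[OF W])

lemma scl_Stab [simp]: "scl (Stab H K U W) c A = (\<lambda>s. tscl c (A s))"
  by (simp add: Stab_def)

lemma Stab_range: "A \<in> car (Stab H K U W) \<Longrightarrow> A \<in> yz_range U W"
  and Stab_equivariant: "A \<in> car (Stab H K U W) \<Longrightarrow> equivariant U W (symbol U W A)"
  by (simp_all add: Stab_iff[OF U W])

lemma Stab_mhom:
  "A \<in> car (Stab H K U W) \<Longrightarrow> A \<in> car (mhom (cat_act H K (dual H) U) (cat_act H K (dual H) W))"
  by (simp add: Stab_def)

lemma range_hom: "A \<in> yz_range U W \<Longrightarrow> A \<in> car (hom (HT U) (HT W))"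
  by (auto simp: yz_L_hom)

lemma Stab_hom: "A \<in> car (Stab H K U W) \<Longrightarrow> A \<in> car (hom (HT U) (HT W))"
  by (intro range_hom Stab_range)

lemma Stab_eqI:
  "A \<in> car (Stab H K U W) \<Longrightarrow> A' \<in> car (Stab H K U W) \<Longrightarrow>
    (\<And>a u. u \<in> car U \<Longrightarrow> symbol U W A a u = symbol U W A' a u) \<Longrightarrow> A = A'"
  by (rule symbol_eqI[of U W]) (simp_all add: Stab_range)

lemma Stab_exists:
  assumes \<tau>: "\<And>u. u \<in> car U \<Longrightarrow> linear_on H W (\<lambda>a. \<tau> a u)" "\<And>a. linear_on U W (\<tau> a)"
    and eq: "equivariant U W \<tau>"
  obtains A where "A \<in> car (Stab H K U W)" "\<And>a u. u \<in> car U \<Longrightarrow> symbol U W A a u = \<tau> a u"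
proof -
  obtain A where A: "A \<in> yz_range U W" "\<And>a u. u \<in> car U \<Longrightarrow> symbol U W A a u = \<tau> a u"
    by (rule symbol_exists[of U W \<tau>]) (use \<tau> in auto)
  have "equivariant U W (symbol U W A)"
    using eq by (simp add: equivariant_def A(2))
  with A show thesis by (intro that[of A]) (simp_all add: Stab_iff[OF U W])
qed

lemma symbol_add: "u \<in> car U \<Longrightarrow> A \<in> car (hom (HT U) (HT W)) \<Longrightarrow> A' \<in> car (hom (HT U) (HT W)) \<Longrightarrow>
    symbol U W (A + A') a u = symbol U W A a u + symbol U W A' a u"
  and symbol_scl: "u \<in> car U \<Longrightarrow> A \<in> car (hom (HT U) (HT W)) \<Longrightarrow>
    symbol U W (\<lambda>s. tscl c (A s)) a u = scl W c (symbol U W A a u)"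
  using linear_on_add[OF linear_symbol[of U W u]] linear_on_scl[OF linear_symbol[of U W u]] by simp_all

text \<open>The range of \<open>\<L>\<close> is the image of a linear map, and
  \<open>equivariant\<close> is a linear condition on the symbol.\<close>

lemma vspace_Stab: "vspace (Stab H K U W)"
proof -
  let ?h = "hom (HT U) (HT W)"
  have vh: "vspace ?h" by (intro vspace_hom vspace_tensor)
  have s: "scl (Stab H K U W) = scl ?h" by (simp add: Stab_def)
  interpret vector_space "scl ?h" using vh by (rule vspace_vector_space)
  have L: "linear_on (HT (hom U W)) ?h (yz_L H U W)" by (rule yz_L_linear) simp_all
  have T: "vspace (HT (hom U W))" by simp
  have Wl: "linear_on W W (act W k)" for k
    using bilinear_on_right[OF module_bilinear[OF W]] by simp
  have "subspace (car (Stab H K U W))"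
  proof (rule subspaceI)
    have z: "symbol U W 0 a u = 0" if "u \<in> car U" for a u
      using linear_on_0[OF linear_symbol[OF _ _ that, of W] vh] by simp
    have "0 = yz_L H U W 0" using linear_on_0[OF L T] ..
    then have "0 \<in> yz_range U W" using vspace_zero[OF T] by (rule image_eqI)
    then show "0 \<in> car (Stab H K U W)"
      by (simp add: Stab_iff[OF U W] equivariant_def z linear_on_0[OF Wl] sk_def)
  next
    fix A A' assume A: "A \<in> car (Stab H K U W)" "A' \<in> car (Stab H K U W)"
    from A[THEN Stab_range] obtain t t' where t: "t \<in> car (HT (hom U W))" "A = yz_L H U W t"
      "t' \<in> car (HT (hom U W))" "A' = yz_L H U W t'" by blast
    have "A + A' = yz_L H U W (t + t')" using linear_on_add[OF L t(1,3)] t by simp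
    then have "A + A' \<in> yz_range U W" using vspace_add[OF T t(1,3)] by (rule image_eqI)
    moreover have "equivariant U W (symbol U W (A + A'))"
      using A[THEN Stab_equivariant] A[THEN Stab_hom]
      by (simp add: equivariant_def symbol_add linear_on_add[OF Wl] symbol_car sk_add)
    ultimately show "A + A' \<in> car (Stab H K U W)" by (simp add: Stab_iff[OF U W])
  next
    fix c A assume A: "A \<in> car (Stab H K U W)"
    from Stab_range[OF A] obtain t where t: "t \<in> car (HT (hom U W))" "A = yz_L H U W t" by blast
    have "scl ?h c A = yz_L H U W (scl (HT (hom U W)) c t)" using linear_on_scl[OF L t(1)] t by simp
    then have "scl ?h c A \<in> yz_range U W" using vspace_scl[OF T t(1)] by (rule image_eqI)
    moreover have "equivariant U W (symbol U W (scl ?h c A))"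
      using Stab_equivariant[OF A] Stab_hom[OF A]
      by (simp add: equivariant_def symbol_scl linear_on_scl[OF Wl] symbol_car sk_scl)
    ultimately show "scl ?h c A \<in> car (Stab H K U W)" by (simp add: Stab_iff[OF U W])
  qed
  then show ?thesis by (simp add: vspace_def s vector_space_axioms)
qed

lemma fin_dim_Stab: "fin_dim (Stab H K U W)"
proof -
  have "fin_dim (hom (HT U) (HT W))"
    by (intro fin_dim_hom vspace_tensor fin_dim_tensor vspace_dual fin_dim_dual vspace_modules
        module_fin_dim[OF U] module_fin_dim[OF W])
  then obtain F where F: "finite F" "module.span (scl (hom (HT U) (HT W))) F = car (hom (HT U) (HT W))"
    by (auto simp: fin_dim_def)
  have s: "scl (Stab H K U W) = scl (hom (HT U) (HT W))" by (simp add: Stab_def)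
  show ?thesis
    by (rule fin_dim_subset[OF vspace_Stab F(1)]) (auto simp: s F(2) Stab_hom)
qed

text \<open>Right translation by \<open>h\<close> commutes with the left multiplications in
  \<open>equivariant\<close>, so the action preserves the stabilizer.\<close>

lemma
  assumes A: "A \<in> car (Stab H K U W)"
  shows act_Stab_car: "act (Stab H K U W) h A \<in> car (Stab H K U W)"
    and symbol_act_Stab: "u \<in> car U \<Longrightarrow> symbol U W (act (Stab H K U W) h A) a u = symbol U W A (a * h) u"
proof -
  let ?T = "HT (hom U W)" and ?\<rho> = "\<lambda>\<alpha> a. \<alpha> (a * h)"
  \<comment> \<open>The action is defined by a chosen preimage under \<open>\<L>\<close>. Only the
    equation \<open>yz_L H U W t = A\<close> enters, and the symbol depends on \<open>A\<close>
    alone.\<close>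
  define t where "t = inv_into (car ?T) (yz_L H U W) A"
  have t: "t \<in> car ?T" "yz_L H U W t = A"
    using Stab_range[OF A] by (auto simp: t_def inv_into_into f_inv_into_f)
  have vh: "vspace (hom U W)" by (simp add: vspace_hom)
  have \<rho>: "linear_on (dual H) (dual H) ?\<rho>"
    by (rule linear_onI)
      (auto simp: car_dual fun_eq_iff plus_fun_apply intro: linear_on_compose[OF linear_mult_right[OF linear_on_ident]])
  have i: "linear_on (hom U W) (hom U W) id" by (simp add: linear_on_def)
  let ?m = "tmap (dual H) (hom U W) (dual H) (hom U W) ?\<rho> id"
  note tm = vspace_dual vh \<rho> i
  have m: "?m t \<in> car ?T" using linear_on_car[OF tmap_linear[OF tm] t(1)] .
  have vm: "val (hom U W) (?m t) a = val (hom U W) t (a * h)" for a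
    by (rule tensor_linear_eqI[OF linear_on_compose[OF tmap_linear[OF tm] val_linear[OF vh]]
        val_linear[OF vh] _ t(1)])
      (simp add: tmap_pure[OF tm] val_pure[OF vh] linear_on_car[OF \<rho>])
  have act: "act (Stab H K U W) h A = yz_L H U W (?m t)"
    by (simp add: Stab_def t_def)
  show sy: "symbol U W (act (Stab H K U W) h A) a u = symbol U W A (a * h) u" if "u \<in> car U" for a u
    unfolding act using symbol_yz_L[OF vspace_modules m that] symbol_yz_L[OF vspace_modules t(1) that]
    by (simp add: vm t(2))
  show "act (Stab H K U W) h A \<in> car (Stab H K U W)"
    unfolding Stab_iff[OF U W]
  proof
    show "act (Stab H K U W) h A \<in> yz_range U W" unfolding act using m by blast
    show "equivariant U W (symbol U W (act (Stab H K U W) h A))"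
      using Stab_equivariant[OF A] by (simp add: equivariant_def sy mult.assoc)
  qed
qed

text \<open>On symbols the axioms are those of right translation: acting by \<open>h\<close> and
  then by \<open>g\<close> evaluates at \<open>a * g * h\<close>.\<close>

lemma Stab_module: "fd_module H (Stab H K U W)"
proof -
  let ?S = "Stab H K U W"
  note vS = vspace_Stab
  note c = act_Stab_car
  have add: "A + A' \<in> car ?S" if "A \<in> car ?S" "A' \<in> car ?S" for A A' using vspace_add[OF vS that] .
  have sc: "(\<lambda>s. tscl c (A s)) \<in> car ?S" if "A \<in> car ?S" for A c using vspace_scl[OF vS that, of c] by simp
  note sh = symbol_add symbol_scl Stab_hom symbol_act_Stab add sc c
  have "bilinear_on H ?S ?S (act ?S)"
  proof (intro bilinear_onI linear_onI)
    show "act ?S h A \<in> car ?S" "act ?S h A \<in> car ?S" if "A \<in> car ?S" for h A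
      by (rule c[OF that])+
    show "act ?S h (A + A') = act ?S h A + act ?S h A'" if "A \<in> car ?S" "A' \<in> car ?S" for h A A'
      by (rule Stab_eqI) (simp_all add: sh that)
    show "act ?S h (scl ?S x A) = scl ?S x (act ?S h A)" if "A \<in> car ?S" for h x A
      by (rule Stab_eqI) (simp_all add: sh that)
    fix A assume A: "A \<in> car ?S"
    have l: "linear_on H W (\<lambda>a. symbol U W A a u)" if "u \<in> car U" for u
      by (rule linear_symbol_left[OF _ _ Stab_hom[OF A] that linear_on_ident]) simp_all
    show "act ?S (h + h') A = act ?S h A + act ?S h' A" for h h'
      by (rule Stab_eqI) (simp_all add: sh A distrib_left linear_on_add[OF l])
    show "act ?S (sH x h) A = scl ?S x (act ?S h A)" for x h
      by (rule Stab_eqI) (simp_all add: sh A linear_on_scl[OF l])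
  qed
  moreover have "act ?S 1 A = A" if "A \<in> car ?S" for A
    by (rule Stab_eqI) (simp_all add: that c symbol_act_Stab)
  moreover have "act ?S (g * h) A = act ?S g (act ?S h A)" if "A \<in> car ?S" for A g h
    by (rule Stab_eqI) (simp_all add: that c symbol_act_Stab mult.assoc)
  ultimately show ?thesis
    unfolding fd_module_def using vS fin_dim_Stab by blast
qed

end

section \<open>The adjunction\<close>

context
  fixes U :: "('k, 'u::ab_group_add, 'a) amod"
    and W :: "('k, 'w::ab_group_add, 'a) amod"
  assumes U: "fd_module K U" and W: "fd_module K W"
begin

text \<open>The formula in \<open>stab_adj\<close> unfolds to the symbol of \<open>g x\<close> at
  \<open>1\<close>, which is bilinear in \<open>x\<close> and \<open>u\<close>.\<close>

lemma
  assumes X: "vspace X" and g: "linear_on X (Stab H K U W) g"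
  shows stab_adj_hom: "stab_adj H X U W g \<in> car (hom (tensor X U) W)"
    and stab_adj_pure: "x \<in> car X \<Longrightarrow> u \<in> car U \<Longrightarrow>
      stab_adj H X U W g (tpure X U x u) = symbol U W (g x) 1 u"
proof -
  note vU = module_vspace[OF U] and vW = module_vspace[OF W]
  have h: "g x \<in> car (hom (HT U) (HT W))" if "x \<in> car X" for x
    using Stab_hom[OF U W linear_on_car[OF g that]] .
  have "linear_on X W (\<lambda>x. symbol U W (g x) 1 u)" if "u \<in> car U" for u
  proof (rule linear_onI)
    show "symbol U W (g x) 1 u \<in> car W" if "x \<in> car X" for x
      using symbol_car[OF vU vW h[OF that] \<open>u \<in> car U\<close>] .
    show "symbol U W (g (x + y)) 1 u = symbol U W (g x) 1 u + symbol U W (g y) 1 u"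
      if "x \<in> car X" "y \<in> car X" for x y
      using that \<open>u \<in> car U\<close> by (simp add: linear_on_add[OF g] symbol_add[OF U W] h)
    show "symbol U W (g (scl X c x)) 1 u = scl W c (symbol U W (g x) 1 u)" if "x \<in> car X" for c x
      using that \<open>u \<in> car U\<close> by (simp add: linear_on_scl[OF g] scl_Stab[OF U W] symbol_scl[OF U W] h)
  qed
  then have b: "bilinear_on X U W (\<lambda>x u. symbol U W (g x) 1 u)"
    by (intro bilinear_onI linear_symbol_right[OF vU vW] h linear_on_ident)
  have e: "stab_adj H X U W g = tlift X U W (\<lambda>x u. symbol U W (g x) 1 u)"
    by (simp add: stab_adj_def symbol_def val_def)
  note * = X vU vW b
  show "stab_adj H X U W g \<in> car (hom (tensor X U) W)"
    "x \<in> car X \<Longrightarrow> u \<in> car U \<Longrightarrow> stab_adj H X U W g (tpure X U x u) = symbol U W (g x) 1 u"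
    unfolding e using tlift_hom[OF *] tlift_pure[OF *] by auto
qed

lemma mhom_Stab_linear: "g \<in> car (mhom X (Stab H K U W)) \<Longrightarrow> linear_on X (Stab H K U W) g"
  by (simp add: mhom_iff hom_linear)

lemma symbol_mhom:
  assumes "g \<in> car (mhom X (Stab H K U W))" "x \<in> car X" "u \<in> car U"
  shows "symbol U W (g x) a u = symbol U W (g (act X a x)) 1 u"
  using assms linear_on_car[OF mhom_Stab_linear[OF assms(1)] assms(2)]
  by (simp add: mhom_iff symbol_act_Stab[OF U W])

text \<open>Phrased for a vector space stable under \<open>act\<close>, so that it applies directly
  to \<open>rep_tensor\<close> of two stabilizers when composition is identified.\<close>

lemma stab_adj_inj:
  assumes X: "vspace X" and act: "\<And>a x. x \<in> car X \<Longrightarrow> act X a x \<in> car X"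
    and g: "g \<in> car (mhom X (Stab H K U W))" "g' \<in> car (mhom X (Stab H K U W))"
    and eq: "stab_adj H X U W g = stab_adj H X U W g'"
  shows "g = g'"
proof (rule hom_eqI)
  show "g \<in> car (hom X (Stab H K U W))" "g' \<in> car (hom X (Stab H K U W))"
    using g by (simp_all add: mhom_iff)
  fix x assume x: "x \<in> car X"
  note gl = g[THEN mhom_Stab_linear]
  show "g x = g' x"
  proof (rule Stab_eqI[OF U W linear_on_car[OF gl(1) x] linear_on_car[OF gl(2) x]])
    fix a u assume u: "u \<in> car U"
    have "symbol U W (g (act X a x)) 1 u = symbol U W (g' (act X a x)) 1 u"
      using stab_adj_pure[OF X gl(1) act[OF x] u] stab_adj_pure[OF X gl(2) act[OF x] u] eq by simp
    then show "symbol U W (g x) a u = symbol U W (g' x) a u"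
      by (simp add: symbol_mhom[OF g(1) x u] symbol_mhom[OF g(2) x u])
  qed
qed

context
  fixes X :: "('k, 'x::ab_group_add, 'h) amod"
  assumes X: "fd_module H X"
begin

lemma stab_adj_mhom:
  assumes g: "g \<in> car (mhom X (Stab H K U W))"
  shows "stab_adj H X U W g \<in> car (mhom (cat_act H K X U) W)"
proof -
  note vU = module_vspace[OF U] and vW = module_vspace[OF W] and vX = module_vspace[OF X]
  let ?f = "stab_adj H X U W g"
  note gl = mhom_Stab_linear[OF g]
  note f = stab_adj_hom[OF vX gl]
  note fl = hom_linear[OF f]
  note ca = vX module_bilinear[OF X] U
  have "?f (act (cat_act H K X U) k t) = act W k (?f t)" if t: "t \<in> car (tensor X U)" for k t
  proof (rule tensor_linear_eqI[OF linear_on_compose[OF cat_act_linear[OF ca] fl] _ _ t])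
    show "linear_on (tensor X U) W (\<lambda>t. act W k (?f t))"
      using linear_act_right[OF W _ fl] by simp
    fix x u assume x: "x \<in> car X" and u: "u \<in> car U"
    have hx: "act X h x \<in> car X" for h using module_act_car[OF X _ x] by simp
    have ku: "act U k' u \<in> car U" for k' using module_act_car[OF U _ u] by simp
    have "?f (act (cat_act H K X U) k (tpure X U x u)) =
        sk (\<lambda>h k'. ?f (tpure X U (act X h x) (act U k' u))) k"
      by (simp add: cat_act_pure[OF ca x u] sk_linear[OF fl vspace_tensor] tpure_car hx ku)
    \<comment> \<open>The factor \<open>1\<close> is kept so that the term matches
      \<open>equivariant\<close> at \<open>a = 1\<close>.\<close>
    also have "\<dots> = sk (\<lambda>h k'. symbol U W (g x) (h * 1) (act U k' u)) k"
      by (simp add: stab_adj_pure[OF vX gl hx ku] symbol_mhom[OF g x ku])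
    also have "\<dots> = act W k (symbol U W (g x) 1 u)"
      using Stab_equivariant[OF U W linear_on_car[OF gl x]] u unfolding equivariant_def by metis
    finally show "?f (act (cat_act H K X U) k (tpure X U x u)) = act W k (?f (tpure X U x u))"
      by (simp add: stab_adj_pure[OF vX gl x u])
  qed
  then show ?thesis using f by (simp add: mhom_iff hom_cat_act)
qed

lemma stab_adj_linear:
  "linear_on (mhom X (Stab H K U W)) (mhom (cat_act H K X U) W) (stab_adj H X U W)"
proof (rule linear_onI)
  note vU = module_vspace[OF U] and vW = module_vspace[OF W] and vX = module_vspace[OF X]
  note vS = vspace_Stab[OF U W]
  note l = mhom_Stab_linear
  show "stab_adj H X U W g \<in> car (mhom (cat_act H K X U) W)" if "g \<in> car (mhom X (Stab H K U W))" for g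
    using that by (rule stab_adj_mhom)
  show "stab_adj H X U W (g + g') = stab_adj H X U W g + stab_adj H X U W g'"
    if g: "g \<in> car (mhom X (Stab H K U W))" "g' \<in> car (mhom X (Stab H K U W))" for g g'
  proof -
    have gg: "linear_on X (Stab H K U W) (g + g')"
      using linear_on_plus[OF l[OF g(1)] l[OF g(2)] vS] by (simp add: plus_fun_def)
    have f: "stab_adj H X U W g + stab_adj H X U W g' \<in> car (hom (tensor X U) W)"
      by (intro vspace_add[OF vspace_hom[OF vW]] stab_adj_hom[OF vX] l g)
    show ?thesis
      by (rule hom_eqI[OF stab_adj_hom[OF vX gg] f],
          rule tensor_linear_eqI[OF hom_linear[OF stab_adj_hom[OF vX gg]] hom_linear[OF f]])
        (simp_all add: plus_fun_apply stab_adj_pure[OF vX] gg l[OF g(1)] l[OF g(2)] symbol_add[OF U W]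
          Stab_hom[OF U W] linear_on_car[OF l[OF g(1)]] linear_on_car[OF l[OF g(2)]])
  qed
  show "stab_adj H X U W (scl (mhom X (Stab H K U W)) c g) =
      scl (mhom (cat_act H K X U) W) c (stab_adj H X U W g)"
    if g: "g \<in> car (mhom X (Stab H K U W))" for c g
  proof -
    have e: "scl (mhom X (Stab H K U W)) c g = (\<lambda>x s. tscl c (g x s))"
      by (simp add: scl_Stab[OF U W])
    have gg: "linear_on X (Stab H K U W) (\<lambda>x s. tscl c (g x s))"
      using linear_on_scale[OF l[OF g] vS, of c] by (simp add: scl_Stab[OF U W])
    have f: "scl (mhom (cat_act H K X U) W) c (stab_adj H X U W g) \<in> car (hom (tensor X U) W)"
      using vspace_scl[OF vspace_hom[OF vW] stab_adj_hom[OF vX l[OF g]], of c] by simp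
    show ?thesis unfolding e
      by (rule hom_eqI[OF stab_adj_hom[OF vX gg] f],
          rule tensor_linear_eqI[OF hom_linear[OF stab_adj_hom[OF vX gg]] hom_linear[OF f]])
        (simp_all add: stab_adj_pure[OF vX gg] stab_adj_pure[OF vX l[OF g]] symbol_scl[OF U W]
          scl_Stab[OF U W] Stab_hom[OF U W] linear_on_car[OF l[OF g]])
  qed
qed

lemma stab_adj_surj:
  assumes F: "F \<in> car (mhom (cat_act H K X U) W)"
  shows "\<exists>g\<in>car (mhom X (Stab H K U W)). stab_adj H X U W g = F"
proof -
  note vU = module_vspace[OF U] and vW = module_vspace[OF W] and vX = module_vspace[OF X]
  note vS = vspace_Stab[OF U W]
  note ca = vX module_bilinear[OF X] U
  have FK: "F (act (cat_act H K X U) k t) = act W k (F t)" if "t \<in> car (tensor X U)" for k t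
    using F that by (simp add: mhom_iff)
  have Fh: "F \<in> car (hom (tensor X U) W)" using F by (simp add: mhom_iff hom_cat_act)
  note Fl = hom_linear[OF Fh]
  have hx: "act X h x \<in> car X" if "x \<in> car X" for h x using module_act_car[OF X _ that] by simp
  have ku: "act U k u \<in> car U" if "u \<in> car U" for k u using module_act_car[OF U _ that] by simp
  \<comment> \<open>\<open>symbol_mhom\<close> leaves no other choice: an \<open>H\<close>-linear
    preimage of \<open>F\<close> must have this symbol at \<open>x\<close>. Its equivariance is the
    \<open>K\<close>-linearity of \<open>F\<close>.\<close>
  let ?\<tau> = "\<lambda>x a u. F (tpure X U (act X a x) u)"
  have "\<exists>A\<in>car (Stab H K U W). \<forall>a. \<forall>u\<in>car U. symbol U W A a u = ?\<tau> x a u" if x: "x \<in> car X" for x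
  proof -
    have 1: "linear_on H W (\<lambda>a. ?\<tau> x a u)" if "u \<in> car U" for u
      by (intro linear_on_compose[OF linear_on_compose[OF bilinear_on_left[OF module_bilinear[OF X] x]
            bilinear_on_left[OF bilinear_tpure that]] Fl])
    have 2: "linear_on U W (?\<tau> x a)" for a
      by (intro linear_on_compose[OF bilinear_on_right[OF bilinear_tpure] Fl] hx x)
    have "equivariant U W (?\<tau> x)"
      unfolding equivariant_def
    proof (intro allI ballI)
      fix k a u assume u: "u \<in> car U"
      have "act W k (?\<tau> x a u) = F (sk (\<lambda>h k'. tpure X U (act X h (act X a x)) (act U k' u)) k)"
        using x u hx by (simp add: FK[symmetric] tpure_car cat_act_pure[OF ca])
      also have "\<dots> = sk (\<lambda>h k'. F (tpure X U (act X h (act X a x)) (act U k' u))) k"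
        using x u hx ku by (simp add: sk_linear[OF Fl vspace_tensor] tpure_car)
      finally show "act W k (?\<tau> x a u) = sk (\<lambda>h k'. ?\<tau> x (h * a) (act U k' u)) k"
        using module_mult[OF X x] by simp
    qed
    from Stab_exists[OF U W 1 2 this] show ?thesis by metis
  qed
  then obtain G where G: "\<And>x. x \<in> car X \<Longrightarrow> G x \<in> car (Stab H K U W)"
    "\<And>x a u. x \<in> car X \<Longrightarrow> u \<in> car U \<Longrightarrow> symbol U W (G x) a u = ?\<tau> x a u"
    by metis
  note Gh = Stab_hom[OF U W G(1)]
  have add: "?\<tau> (x + y) a u = ?\<tau> x a u + ?\<tau> y a u" if "x \<in> car X" "y \<in> car X" "u \<in> car U" for x y a u
    using that bilinear_on_right[OF module_bilinear[OF X], of a]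
    by (simp add: linear_on_add[OF bilinear_on_left[OF bilinear_tpure that(3)]] hx
        linear_on_add[OF Fl] tpure_car linear_on_add)
  have scl: "?\<tau> (scl X c x) a u = scl W c (?\<tau> x a u)" if "x \<in> car X" "u \<in> car U" for x c a u
    using that bilinear_on_right[OF module_bilinear[OF X], of a]
      linear_on_scl[OF Fl, of "tpure X U (act X a x) u" c]
    by (simp add: linear_on_scl[OF bilinear_on_left[OF bilinear_tpure that(2)]] hx
        tpure_car linear_on_scl)
  have Gl: "linear_on X (Stab H K U W) G"
  proof (rule linear_onI)
    show "G x \<in> car (Stab H K U W)" if "x \<in> car X" for x using G(1)[OF that] .
    show "G (x + y) = G x + G y" if "x \<in> car X" "y \<in> car X" for x y
      using that vspace_add[OF vX that] vspace_add[OF vS G(1)[OF that(1)] G(1)[OF that(2)]]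
      by (intro Stab_eqI[OF U W] G(1)) (simp_all add: symbol_add[OF U W] Gh G(2) add)
    show "G (scl X c x) = scl (Stab H K U W) c (G x)" if "x \<in> car X" for c x
      using that vspace_scl[OF vX that, of c] vspace_scl[OF vS G(1)[OF that], of c]
      by (intro Stab_eqI[OF U W] G(1)) (simp_all add: scl_Stab[OF U W] symbol_scl[OF U W] Gh G(2) scl)
  qed
  \<comment> \<open>The choice of \<open>G\<close> is arbitrary outside \<open>car X\<close>, where
    elements of the Hom space have to vanish.\<close>
  define g where "g = (\<lambda>x. if x \<in> car X then G x else 0)"
  have gG: "g x = G x" if "x \<in> car X" for x using that by (simp add: g_def)
  have gh: "g \<in> car (hom X (Stab H K U W))"
    unfolding g_def by (rule hom_restrict[OF Gl vX])
  have "g (act X a x) = act (Stab H K U W) a (g x)" if x: "x \<in> car X" for a x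
    unfolding gG[OF x] gG[OF hx[OF x]]
    by (intro Stab_eqI[OF U W] G(1) hx x act_Stab_car[OF U W])
      (simp add: G hx x symbol_act_Stab[OF U W] module_mult[OF X x])
  with gh have g: "g \<in> car (mhom X (Stab H K U W))" by (simp add: mhom_iff)
  have "stab_adj H X U W g = F"
  proof (rule hom_eqI[OF stab_adj_hom[OF vX hom_linear[OF gh]] Fh])
    fix t assume t: "t \<in> car (tensor X U)"
    show "stab_adj H X U W g t = F t"
      by (rule tensor_linear_eqI[OF hom_linear[OF stab_adj_hom[OF vX hom_linear[OF gh]]] Fl _ t])
        (simp add: stab_adj_pure[OF vX hom_linear[OF gh]] gG G module_one[OF X])
  qed
  with g show ?thesis by blast
qed

lemma stab_adj_bij:
  "bij_betw (stab_adj H X U W) (car (mhom X (Stab H K U W))) (car (mhom (cat_act H K X U) W))"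
  unfolding bij_betw_def
proof
  show "inj_on (stab_adj H X U W) (car (mhom X (Stab H K U W)))"
    by (rule inj_onI, rule stab_adj_inj) (simp_all add: module_vspace[OF X] module_act_car[OF X])
  show "stab_adj H X U W ` car (mhom X (Stab H K U W)) = car (mhom (cat_act H K X U) W)"
    using stab_adj_mhom stab_adj_surj by blast
qed

end

text \<open>On \<open>x\<close> tensor \<open>u\<close> both sides are the symbol of
  \<open>g (p x)\<close> at \<open>1\<close>.\<close>

lemma stab_adj_natural:
  assumes X: "fd_module H X" and Y: "fd_module H Y"
    and p: "p \<in> car (mhom X Y)" and g: "g \<in> car (mhom Y (Stab H K U W))"
  shows "stab_adj H X U W (g \<circ> p) = stab_adj H Y U W g \<circ> tmap X U Y U p id"
proof -
  note vU = module_vspace[OF U] and vX = module_vspace[OF X] and vY = module_vspace[OF Y]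
  have pl: "linear_on X Y p" using p by (simp add: mhom_iff hom_linear)
  note gl = mhom_Stab_linear[OF g]
  have gp: "linear_on X (Stab H K U W) (g \<circ> p)"
    using linear_on_compose[OF pl gl] by (simp add: o_def)
  have i: "linear_on U U id" by (simp add: linear_on_def)
  note f = stab_adj_hom[OF vX gp]
  have f': "stab_adj H Y U W g \<circ> tmap X U Y U p id \<in> car (hom (tensor X U) W)"
    using hom_comp[OF tmap_hom[OF vX vU pl i] hom_linear[OF stab_adj_hom[OF vY gl]] vspace_tensor]
    by (simp add: o_def)
  show ?thesis
    by (rule hom_eqI[OF f f'], rule tensor_linear_eqI[OF hom_linear[OF f] hom_linear[OF f']])
      (simp_all add: stab_adj_pure[OF vX gp] stab_adj_pure[OF vY gl] tmap_pure[OF vX vU pl i]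
        linear_on_car[OF pl])
qed

end

end

section \<open>Composition\<close>

context hopf
begin

lemma
  fixes X :: "('k, 'x::ab_group_add, 'h) amod" and Y :: "('k, 'y::ab_group_add, 'h) amod"
  shows car_rep_tensor [simp]: "car (rep_tensor H X Y) = car (tensor X Y)"
    and scl_rep_tensor [simp]: "scl (rep_tensor H X Y) = tscl"
    and hom_rep_tensor: "hom (rep_tensor H X Y) V = hom (tensor X Y) V"
    and vspace_rep_tensor: "vspace (rep_tensor H X Y)"
proof -
  show *: "car (rep_tensor H X Y) = car (tensor X Y)" "scl (rep_tensor H X Y) = tscl"
    by (simp_all add: rep_tensor_def tensor_mod_def)
  show "hom (rep_tensor H X Y) V = hom (tensor X Y) V"
    by (simp add: hom_def linear_on_def *)
  show "vspace (rep_tensor H X Y)"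
    using vspace_tensor[of X Y] by (simp add: vspace_def *)
qed

lemma
  assumes X: "fd_module H X" and Y: "fd_module H Y"
  shows rep_tensor_linear: "linear_on (tensor X Y) (tensor X Y) (act (rep_tensor H X Y) h)"
    and rep_tensor_pure: "x \<in> car X \<Longrightarrow> y \<in> car Y \<Longrightarrow> act (rep_tensor H X Y) h (tpure X Y x y) =
      sw (\<lambda>a b. tpure X Y (act X a x) (act Y b y)) h"
proof -
  note * = vspace_H vspace_H module_vspace[OF X] module_vspace[OF Y]
    module_bilinear[OF X] module_bilinear[OF Y] comul_car
  show "linear_on (tensor X Y) (tensor X Y) (act (rep_tensor H X Y) h)"
    unfolding rep_tensor_def by (rule tensor_mod_linear[OF *])
  show "act (rep_tensor H X Y) h (tpure X Y x y) = sw (\<lambda>a b. tpure X Y (act X a x) (act Y b y)) h"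
    if "x \<in> car X" "y \<in> car Y"
    unfolding rep_tensor_def tensor_mod_pure[OF * that]
    by (intro tlift_comul vspace_tensor
        linear_on_compose[OF bilinear_on_left[OF module_bilinear[OF X] that(1)]
          bilinear_on_left[OF bilinear_tpure]]
        linear_on_compose[OF bilinear_on_left[OF module_bilinear[OF Y] that(2)]
          bilinear_on_right[OF bilinear_tpure]]
        module_act_car[OF X] module_act_car[OF Y] that) simp_all
qed

end

context comodule_algebra
begin

context
  fixes U :: "('k, 'u::ab_group_add, 'a) amod"
    and W :: "('k, 'w::ab_group_add, 'a) amod"
    and Z :: "('k, 'z::ab_group_add, 'a) amod"
  assumes U: "fd_module K U" and W: "fd_module K W" and Z: "fd_module K Z"
begin

abbreviation "SUW \<equiv> Stab H K U W"
abbreviation "SWZ \<equiv> Stab H K W Z"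
abbreviation "SUZ \<equiv> Stab H K U Z"

text \<open>Coassociativity makes the symbol of a composite the convolution of the symbols. An
  element of the range with that symbol is constructed and then shown to be
  \<open>B \<circ> A\<close>, which places the composite in the range of \<open>\<L>\<close>;
  \<open>K\<close>-linearity is inherited from the factors.\<close>

lemma
  assumes A: "A \<in> car SUW" and B: "B \<in> car SWZ"
  shows comp_Stab: "B \<circ> A \<in> car SUZ"
    and symbol_comp: "u \<in> car U \<Longrightarrow>
      symbol U Z (B \<circ> A) a u = sw (\<lambda>x y. symbol W Z B x (symbol U W A y u)) a"
proof -
  note vU = module_vspace[OF U] and vW = module_vspace[OF W] and vZ = module_vspace[OF Z]
  note Ar = Stab_range[OF U W A] and Ah = Stab_hom[OF U W A]
  note Br = Stab_range[OF W Z B] and Bh = Stab_hom[OF W Z B]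
  let ?\<tau> = "\<lambda>a u. sw (\<lambda>x y. symbol W Z B x (symbol U W A y u)) a"
  have c: "symbol U W A a u \<in> car W" if "u \<in> car U" for a u using symbol_car[OF vU vW Ah that] .
  note l = lin vZ linear_symbol_left[OF vW vZ Bh] linear_symbol_right[OF vW vZ Bh]
    linear_symbol_left[OF vU vW Ah] linear_symbol_right[OF vU vW Ah] c
  have As: "A s \<in> car (HT W)" if "s \<in> car (HT U)" for s
    using linear_on_car[OF hom_linear[OF Ah] that] .
  have BA: "B \<circ> A \<in> car (hom (HT U) (HT Z))"
    using hom_comp[OF Ah hom_linear[OF Bh] vspace_tensor] by (simp add: o_def)
  obtain C where C: "C \<in> yz_range U Z" "\<And>a u. u \<in> car U \<Longrightarrow> symbol U Z C a u = ?\<tau> a u"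
    by (rule symbol_exists[OF vU vZ, of ?\<tau>]) (simp_all add: l)
  have "B \<circ> A = C"
  proof (rule hom_tensor_eqI[OF vU vZ BA])
    show "C \<in> car (hom (HT U) (HT Z))" using C(1) yz_L_hom[OF vU vZ] by auto
    fix s a assume s: "s \<in> car (HT U)"
    let ?v = "val U s"
    have v: "?v y \<in> car U" "linear_on H U ?v" for y
      using val_car[OF vU s] val_linear_arg[OF vU s] .
    have "val Z ((B \<circ> A) s) a = sw (\<lambda>x y. symbol W Z B x (sw (\<lambda>p q. symbol U W A p (?v q)) y)) a"
      by (simp add: yz_L_apply[OF vW vZ Br As[OF s]] yz_L_apply[OF vU vW Ar s])
    also have "\<dots> = sw (\<lambda>x y. sw (\<lambda>p q. symbol W Z B x (symbol U W A p (?v q))) y) a"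
      using sw_linear[OF linear_symbol_right[OF vW vZ Bh linear_on_ident] vW] by (simp add: c v)
    also have "\<dots> = sw (\<lambda>x y. sw (\<lambda>p q. symbol W Z B p (symbol U W A q (?v y))) x) a"
      by (rule sw_coassoc[of Z, symmetric]) (simp_all add: l v)
    also have "\<dots> = val Z (C s) a"
      by (simp add: yz_L_apply[OF vU vZ C(1) s] C(2) v)
    finally show "val Z ((B \<circ> A) s) a = val Z (C s) a" .
  qed
  with C have r: "B \<circ> A \<in> yz_range U Z" and sy: "\<And>a u. u \<in> car U \<Longrightarrow> symbol U Z (B \<circ> A) a u = ?\<tau> a u"
    by simp_all
  show "u \<in> car U \<Longrightarrow> symbol U Z (B \<circ> A) a u = ?\<tau> a u" using sy .
  have "B \<circ> A \<in> car (mhom (cat_act H K (dual H) U) (cat_act H K (dual H) Z))"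
    using Stab_mhom[OF U W A] Stab_mhom[OF W Z B] BA As by (simp add: mhom_iff hom_cat_act)
  with r show "B \<circ> A \<in> car SUZ" by (simp add: Stab_def)
qed

lemma bilinear_comp: "bilinear_on SWZ SUW SUZ (\<lambda>B A. B \<circ> A)"
proof (intro bilinear_onI linear_onI comp_Stab)
  fix B assume B: "B \<in> car SWZ"
  note Bh = Stab_hom[OF W Z B]
  note Bl = hom_linear[OF Bh]
  show "B \<circ> (A + A') = (B \<circ> A) + (B \<circ> A')" if A: "A \<in> car SUW" "A' \<in> car SUW" for A A'
  proof
    note Ah = A[THEN Stab_hom[OF U W]]
    show "(B \<circ> (A + A')) s = ((B \<circ> A) + (B \<circ> A')) s" for s
    proof (cases "s \<in> car (HT U)")
      case True
      then show ?thesis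
        using linear_on_add[OF Bl linear_on_car[OF hom_linear[OF Ah(1)]] linear_on_car[OF hom_linear[OF Ah(2)]]]
        by (simp add: plus_fun_apply)
    next
      case False
      then show ?thesis
        using linear_on_0[OF Bl vspace_tensor] Ah by (simp add: plus_fun_apply hom_outside)
    qed
  qed
  show "B \<circ> scl SUW c A = scl SUZ c (B \<circ> A)" if A: "A \<in> car SUW" for c A
  proof
    note Ah = Stab_hom[OF U W A]
    show "(B \<circ> scl SUW c A) s = scl SUZ c (B \<circ> A) s" for s
    proof (cases "s \<in> car (HT U)")
      case True
      then show ?thesis
        using linear_on_scl[OF Bl linear_on_car[OF hom_linear[OF Ah]]]
        by (simp add: scl_Stab[OF U W] scl_Stab[OF U Z])
    next
      case False
      then show ?thesis
        using linear_on_0[OF Bl vspace_tensor] Ah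
          scl_zero_right[OF vspace_tensor[of "dual H" W]] scl_zero_right[OF vspace_tensor[of "dual H" Z]]
        by (simp add: scl_Stab[OF U W] scl_Stab[OF U Z] hom_outside)
    qed
  qed
qed (simp_all add: scl_Stab[OF U Z] scl_Stab[OF W Z] fun_eq_iff plus_fun_apply)

text \<open>The candidate for \<open>ih_comp\<close>: composition lifted to the tensor product,
  where \<open>H\<close>-linearity makes sense.\<close>

definition comp_map where
  "comp_map = tlift SWZ SUW SUZ (\<lambda>B A. B \<circ> A)"

lemmas comp_vs = vspace_Stab[OF W Z] vspace_Stab[OF U W] vspace_Stab[OF U Z] bilinear_comp

lemma comp_map_hom: "comp_map \<in> car (hom (tensor SWZ SUW) SUZ)"
  and comp_map_pure: "B \<in> car SWZ \<Longrightarrow> A \<in> car SUW \<Longrightarrow> comp_map (tpure SWZ SUW B A) = B \<circ> A"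
  unfolding comp_map_def using tlift_hom[OF comp_vs] tlift_pure[OF comp_vs] by auto

text \<open>\<open>h\<close> acts on the two factors by right translation of their symbols by its
  legs. As the coproduct is multiplicative, this is right translation of their convolution by
  \<open>h\<close>.\<close>

lemma comp_map_mhom: "comp_map \<in> car (mhom (rep_tensor H SWZ SUW) SUZ)"
proof -
  note vU = module_vspace[OF U] and vW = module_vspace[OF W] and vZ = module_vspace[OF Z]
  note mWZ = Stab_module[OF W Z] and mUW = Stab_module[OF U W] and mUZ = Stab_module[OF U Z]
  note cl = hom_linear[OF comp_map_hom]
  have "comp_map (act (rep_tensor H SWZ SUW) h t) = act SUZ h (comp_map t)"
    if t: "t \<in> car (tensor SWZ SUW)" for h t
  proof (rule tensor_linear_eqI[OF linear_on_compose[OF rep_tensor_linear[OF mWZ mUW] cl] _ _ t])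
    show "linear_on (tensor SWZ SUW) SUZ (\<lambda>t. act SUZ h (comp_map t))"
      by (rule linear_act_right[OF mUZ _ cl]) simp
    fix B A assume B: "B \<in> car SWZ" and A: "A \<in> car SUW"
    have aB: "act SWZ a B \<in> car SWZ" and bA: "act SUW a A \<in> car SUW" for a
      using act_Stab_car[OF W Z B] act_Stab_car[OF U W A] .
    note Ah = Stab_hom[OF U W A] and Bh = Stab_hom[OF W Z B]
    note l = lin vZ linear_symbol_left[OF vW vZ Bh] linear_symbol_right[OF vW vZ Bh]
      linear_symbol_left[OF vU vW Ah] linear_symbol_right[OF vU vW Ah] symbol_car[OF vU vW Ah]
    have "comp_map (act (rep_tensor H SWZ SUW) h (tpure SWZ SUW B A)) =
        sw (\<lambda>a b. act SWZ a B \<circ> act SUW b A) h"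
      by (simp add: rep_tensor_pure[OF mWZ mUW B A] sw_linear[OF cl vspace_tensor] tpure_car aB bA
          comp_map_pure)
    also have "\<dots> = act SUZ h (B \<circ> A)"
    proof (rule Stab_eqI[OF U Z])
      show "sw (\<lambda>a b. act SWZ a B \<circ> act SUW b A) h \<in> car SUZ"
        by (intro sw_car vspace_Stab[OF U Z] comp_Stab aB bA)
      show "act SUZ h (B \<circ> A) \<in> car SUZ" by (intro act_Stab_car[OF U Z] comp_Stab A B)
      fix g u assume u: "u \<in> car U"
      have "symbol U Z (sw (\<lambda>a b. act SWZ a B \<circ> act SUW b A) h) g u =
          sw (\<lambda>a b. symbol U Z (act SWZ a B \<circ> act SUW b A) g u) h"
        by (rule sw_linear[OF linear_symbol[OF vU vZ u] vspace_hom[OF vspace_tensor]])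
          (intro Stab_hom[OF U Z] comp_Stab aB bA)
      also have "\<dots> = sw (\<lambda>a b. sw (\<lambda>x y. symbol W Z B (x * a) (symbol U W A (y * b) u)) g) h"
        by (simp add: symbol_comp[OF bA aB u] symbol_act_Stab[OF U W A u] symbol_act_Stab[OF W Z B]
            symbol_car[OF vU vW Ah u])
      also have "\<dots> = sw (\<lambda>x y. sw (\<lambda>a b. symbol W Z B (x * a) (symbol U W A (y * b) u)) h) g"
        by (rule sw_swap)
      also have "\<dots> = sw (\<lambda>x y. symbol W Z B x (symbol U W A y u)) (g * h)"
        by (rule sw_mult[of Z, symmetric]) (simp_all add: l u)
      also have "\<dots> = symbol U Z (act SUZ h (B \<circ> A)) g u"
        by (simp add: symbol_act_Stab[OF U Z comp_Stab[OF A B] u] symbol_comp[OF A B u])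
      finally show "symbol U Z (sw (\<lambda>a b. act SWZ a B \<circ> act SUW b A) h) g u =
          symbol U Z (act SUZ h (B \<circ> A)) g u" .
    qed
    finally show "comp_map (act (rep_tensor H SWZ SUW) h (tpure SWZ SUW B A)) =
        act SUZ h (comp_map (tpure SWZ SUW B A))"
      by (simp add: comp_map_pure A B)
  qed
  then show ?thesis using comp_map_hom by (simp add: mhom_iff hom_rep_tensor)
qed

end

section \<open>Evaluation and the defining property of composition\<close>

lemma
  fixes U :: "('k, 'u::ab_group_add, 'a) amod"
    and W :: "('k, 'w::ab_group_add, 'a) amod"
  assumes U: "fd_module K U" and W: "fd_module K W"
  shows ih_ev_hom: "ih_ev H K U W \<in> car (hom (tensor (Stab H K U W) U) W)"
    and ih_ev_pure: "A \<in> car (Stab H K U W) \<Longrightarrow> u \<in> car U \<Longrightarrow>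
      ih_ev H K U W (tpure (Stab H K U W) U A u) = symbol U W A 1 u"
proof -
  note vS = vspace_Stab[OF U W]
  have "linear_on (Stab H K U W) (Stab H K U W) (idm (Stab H K U W))"
    by (rule linear_on_cong[OF linear_on_ident _ vS]) (simp add: idm_def)
  note i = stab_adj_hom[OF U W vS this] stab_adj_pure[OF U W vS this]
  show "ih_ev H K U W \<in> car (hom (tensor (Stab H K U W) U) W)"
    "A \<in> car (Stab H K U W) \<Longrightarrow> u \<in> car U \<Longrightarrow>
      ih_ev H K U W (tpure (Stab H K U W) U A u) = symbol U W A 1 u"
    unfolding ih_ev_def using i by (auto simp: idm_def)
qed

context
  fixes U :: "('k, 'u::ab_group_add, 'a) amod"
    and W :: "('k, 'w::ab_group_add, 'a) amod"
    and Z :: "('k, 'z::ab_group_add, 'a) amod"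
  assumes U: "fd_module K U" and W: "fd_module K W" and Z: "fd_module K Z"
begin

lemma
  shows ih_ev_ev_hom: "ih_ev_ev H K U W Z \<in>
      car (hom (tensor (tensor (Stab H K W Z) (Stab H K U W)) U) Z)"
    and ih_ev_ev_pure: "B \<in> car (Stab H K W Z) \<Longrightarrow> A \<in> car (Stab H K U W) \<Longrightarrow> u \<in> car U \<Longrightarrow>
      ih_ev_ev H K U W Z (tpure (tensor (Stab H K W Z) (Stab H K U W)) U
        (tpure (Stab H K W Z) (Stab H K U W) B A) u) = symbol W Z B 1 (symbol U W A 1 u)"
proof -
  note vU = module_vspace[OF U] and vW = module_vspace[OF W] and vZ = module_vspace[OF Z]
  note vS = vspace_Stab[OF W Z] vspace_Stab[OF U W] vspace_Stab[OF U Z]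
  have i: "linear_on (Stab H K W Z) (Stab H K W Z) id" by (simp add: linear_on_def)
  note tm = vS(1) vspace_tensor i hom_linear[OF ih_ev_hom[OF U W]]
  note el = hom_linear[OF ih_ev_hom[OF W Z]]
  show "ih_ev_ev H K U W Z \<in> car (hom (tensor (tensor (Stab H K W Z) (Stab H K U W)) U) Z)"
    using hom_comp[OF tassoc_hom[OF vS(1,2) vU]
        linear_on_compose[OF tmap_linear[OF tm] el] vspace_tensor]
    by (simp add: ih_ev_ev_def o_def)
  show "ih_ev_ev H K U W Z (tpure (tensor (Stab H K W Z) (Stab H K U W)) U
        (tpure (Stab H K W Z) (Stab H K U W) B A) u) = symbol W Z B 1 (symbol U W A 1 u)"
    if "B \<in> car (Stab H K W Z)" "A \<in> car (Stab H K U W)" "u \<in> car U"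
    using that by (simp add: ih_ev_ev_def tassoc_pure_pure[OF vS(1,2) vU] tmap_pure[OF tm] tpure_car
        ih_ev_pure[OF U W] ih_ev_pure[OF W Z] symbol_car[OF vU vW Stab_hom[OF U W]])
qed

text \<open>The coproduct of \<open>1\<close> is \<open>1\<close> tensor \<open>1\<close>, so at
  \<open>1\<close> the convolution of symbols has the single term that iterated evaluation
  computes.\<close>

lemma stab_adj_comp_map:
  "stab_adj H (rep_tensor H (Stab H K W Z) (Stab H K U W)) U Z (comp_map U W Z) = ih_ev_ev H K U W Z"
proof -
  let ?B = "Stab H K W Z" and ?A = "Stab H K U W"
  let ?T = "tensor ?B ?A" and ?R = "rep_tensor H ?B ?A"
  note vU = module_vspace[OF U] and vW = module_vspace[OF W] and vZ = module_vspace[OF Z]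
  \<comment> \<open>\<open>stab_adj\<close> is formed over the record that carries the action,
    \<open>ih_ev_ev\<close> over the bare tensor product.\<close>
  have tc: "tpure ?R U = tpure ?T U" "tensor ?R U = tensor ?T U"
    by (rule tensor_record_cong; simp)+
  have cl: "linear_on ?R (Stab H K U Z) (comp_map U W Z)"
    by (rule mhom_Stab_linear[OF U Z comp_map_mhom[OF U W Z]])
  note f = stab_adj_hom[OF U Z vspace_rep_tensor cl, unfolded tc]
    and p = stab_adj_pure[OF U Z vspace_rep_tensor cl, unfolded tc car_rep_tensor]
  note g = ih_ev_ev_hom
  show ?thesis
  proof (rule hom_eqI[OF f g], rule tensor_linear_eqI[OF hom_linear[OF f] hom_linear[OF g]])
    fix t u assume t: "t \<in> car ?T" and u: "u \<in> car U"
    note l = bilinear_on_left[OF bilinear_tpure u]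
    show "stab_adj H ?R U Z (comp_map U W Z) (tpure ?T U t u) = ih_ev_ev H K U W Z (tpure ?T U t u)"
    proof (rule tensor_linear_eqI[OF linear_on_compose[OF l hom_linear[OF f]]
          linear_on_compose[OF l hom_linear[OF g]] _ t])
      fix B A assume B: "B \<in> car ?B" and A: "A \<in> car ?A"
      note Ah = Stab_hom[OF U W A] and Bh = Stab_hom[OF W Z B]
      have "sw (\<lambda>x y. symbol W Z B x (symbol U W A y u)) 1 = symbol W Z B 1 (symbol U W A 1 u)"
        by (rule sw_one[of Z])
          (simp_all add: vZ u linear_symbol_left[OF vW vZ Bh] linear_symbol_right[OF vW vZ Bh]
            linear_symbol_left[OF vU vW Ah] symbol_car[OF vU vW Ah] lin)
      then show "stab_adj H ?R U Z (comp_map U W Z) (tpure ?T U (tpure ?B ?A B A) u) =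
          ih_ev_ev H K U W Z (tpure ?T U (tpure ?B ?A B A) u)"
        by (simp add: p tpure_car A B u comp_map_pure[OF U W Z] symbol_comp[OF U W Z A B]
            ih_ev_ev_pure)
    qed
  qed
qed

text \<open>\<open>comp_map\<close> witnesses the definite description; its uniqueness is
  injectivity of the adjunction at the tensor product of the two stabilizers.\<close>

lemma ih_comp_eq: "ih_comp H K U W Z = comp_map U W Z"
  unfolding ih_comp_def
proof (rule the_equality)
  let ?R = "rep_tensor H (Stab H K W Z) (Stab H K U W)"
  show "comp_map U W Z \<in> car (mhom ?R (Stab H K U Z)) \<and>
      stab_adj H ?R U Z (comp_map U W Z) = ih_ev_ev H K U W Z"
    using comp_map_mhom[OF U W Z] stab_adj_comp_map by simp
  fix c assume c: "c \<in> car (mhom ?R (Stab H K U Z)) \<and> stab_adj H ?R U Z c = ih_ev_ev H K U W Z"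
  show "c = comp_map U W Z"
  proof (rule stab_adj_inj[OF U Z vspace_rep_tensor])
    show "act ?R a x \<in> car ?R" if "x \<in> car ?R" for a x
      using linear_on_car[OF rep_tensor_linear[OF Stab_module[OF W Z] Stab_module[OF U W]]] that
      by simp
  qed (use c comp_map_mhom[OF U W Z] stab_adj_comp_map in simp_all)
qed

end

end

theorem proposition3p1:
  fixes H :: "('k::{alg_closed_field,field_char_0}, 'h::{ring,monoid_mult}) hopf"
    and K :: "('k, 'a::{ring,monoid_mult}, 'h) comodalg"
    and U :: "('k, 'u::ab_group_add, 'a) amod"
    and W :: "('k, 'w::ab_group_add, 'a) amod"
    and Z :: "('k, 'z::ab_group_add, 'a) amod"
  assumes "fd_hopf_algebra H" and "fd_comodule_algebra H K"
    and "fd_module K U" and "fd_module K W" and "fd_module K Z"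
  shows
    "fd_module H (Stab H K U W) \<and>
     (\<forall>X :: ('k, 'x::ab_group_add, 'h) amod. fd_module H X \<longrightarrow>
        linear_on (mhom X (Stab H K U W)) (mhom (cat_act H K X U) W) (stab_adj H X U W) \<and>
        bij_betw (stab_adj H X U W)
          (car (mhom X (Stab H K U W))) (car (mhom (cat_act H K X U) W))) \<and>
     (\<forall>(X :: ('k, 'x, 'h) amod) (Y :: ('k, 'y::ab_group_add, 'h) amod).
        fd_module H X \<longrightarrow> fd_module H Y \<longrightarrow>
        (\<forall>p\<in>car (mhom X Y). \<forall>g\<in>car (mhom Y (Stab H K U W)).
           stab_adj H X U W (g \<circ> p) = stab_adj H Y U W g \<circ> tmap X U Y U p id)) \<and>
     ih_comp H K U W Z
       \<in> car (mhom (rep_tensor H (Stab H K W Z) (Stab H K U W)) (Stab H K U Z)) \<and>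
     stab_adj H (rep_tensor H (Stab H K W Z) (Stab H K U W)) U Z (ih_comp H K U W Z)
       = ih_ev_ev H K U W Z \<and>
     (\<forall>A\<in>car (Stab H K U W). \<forall>B\<in>car (Stab H K W Z).
        B \<circ> A \<in> car (Stab H K U Z) \<and>
        ih_comp H K U W Z (tpure (Stab H K W Z) (Stab H K U W) B A) = B \<circ> A)"
proof -
  have H: "vspace H" "fin_dim H" "car H = UNIV"
    using assms(1) by (simp_all add: fd_hopf_algebra_def fd_algebra_def)
  obtain B e where B: "finite B" "B \<subseteq> car H" "\<And>b. b \<in> B \<Longrightarrow> linear_on H ground (e b)"
    "\<And>h. h \<in> car H \<Longrightarrow> (\<Sum>b\<in>B. scl H (e b h) b) = h"
    "\<And>a b. a \<in> B \<Longrightarrow> b \<in> B \<Longrightarrow> e a b = (if a = b then 1 else 0)"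
    by (rule fin_dim_basis[OF H(1,2)], rule that)
  interpret comodule_algebra H B e K
    by unfold_locales (use assms(1,2) B H(3) in simp_all)
  note UWZ = assms(3-5) and UW = assms(3,4)
  show ?thesis
    unfolding ih_comp_eq[OF UWZ]
    by (intro conjI allI impI ballI Stab_module[OF UW] stab_adj_linear[OF UW] stab_adj_bij[OF UW]
        stab_adj_natural[OF UW] comp_map_mhom[OF UWZ] stab_adj_comp_map[OF UWZ] comp_Stab[OF UWZ]
        comp_map_pure[OF UWZ])
qed

end
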